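(* For any $r$-multipartition $[\lambda(j)]$ of $n$ and any composition $\omega$ of $n$, the questions of whether $K_{[\lambda(j)]\omega}>0$ and whether $K_{[\lambda(j)]\omega}=1$ can be answered in polynomial time (that is, in time polynomial in $\mathrm{size}([\lambda(j)],\omega)$).
   Context: A composition of $n$ is a finite sequence of non-negative integers with sum $n$. An $r$-multipartition of $n$ is a sequence $[\lambda(j)]=[\lambda(1),\ldots,\lambda(r)]$ of (possibly empty) partitions with $\sum_j|\lambda(j)|=n$. A semistandard Young tableau of shape $\lambda$ is a filling of the Young diagram of $\lambda$ by positive integers, weakly increasing along rows and strictly increasing down columns; its weight is the sequence whose $i$-th entry is the number of times $i$ occurs. A semistandard Young $r$-multitableau of shape $[\lambda(j)]$ and weight $\omega$ is a sequence $[T(1),\ldots,T(r)]$ of semistandard Young tableaux, $T(j)$ of shape $\lambda(j)$ and weight $\omega(j)$, with $\omega_i=\sum_{j=1}^r\omega(j)_i$ for all $i$. $K_{[\lambda(j)]\omega}$ is the number of these. The input is the list of tuples $\lambda(1),\ldots,\lambda(r),\omega$, and $\mathrm{size}([\lambda(j)],\omega)$ is the number of bits used to describe it (with integers written in binary). *)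

theory Defs
  imports "HOL-Computational_Algebra.Polynomial"
begin

section \<open>Partitions, compositions, semistandard multitableaux\<close>

definition partition_of :: "nat \<Rightarrow> nat list \<Rightarrow> bool" where
  "partition_of n l \<longleftrightarrow> sorted_wrt (\<ge>) l \<and> 0 \<notin> set l \<and> sum_list l = n"

definition composition_of :: "nat \<Rightarrow> nat list \<Rightarrow> bool" where
  "composition_of n w \<longleftrightarrow> sum_list w = n"

definition multipartition :: "nat \<Rightarrow> nat \<Rightarrow> nat list list \<Rightarrow> bool" where
  "multipartition r n ls \<longleftrightarrow> length ls = r \<and>
     (\<forall>l\<in>set ls. partition_of (sum_list l) l) \<and> (\<Sum>l\<leftarrow>ls. sum_list l) = n"

text \<open>A tableau is the list of its rows, from top to bottom.\<close>

definition semistandard :: "nat list \<Rightarrow> nat list list \<Rightarrow> bool" where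
  "semistandard l T \<longleftrightarrow>
     map length T = l \<and>
     (\<forall>row\<in>set T. 0 \<notin> set row \<and> sorted row) \<and>
     (\<forall>i j. Suc i < length T \<and> j < length (T ! Suc i) \<longrightarrow> T ! i ! j < T ! Suc i ! j)"

definition weight :: "nat list list \<Rightarrow> nat \<Rightarrow> nat" where
  "weight T i = count_list (concat T) i"

text \<open>The entries of a composition are indexed from \<open>1\<close>, and the sequence is continued by zeros.\<close>

definition entry :: "nat list \<Rightarrow> nat \<Rightarrow> nat" where
  "entry w i = (if 1 \<le> i \<and> i \<le> length w then w ! (i - 1) else 0)"

definition multitableaux :: "nat list list \<Rightarrow> nat list \<Rightarrow> nat list list list set" where
  "multitableaux ls w =
     {Ts. list_all2 semistandard ls Ts \<and> (\<forall>i\<ge>1. entry w i = (\<Sum>T\<leftarrow>Ts. weight T i))}"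

definition kostka :: "nat list list \<Rightarrow> nat list \<Rightarrow> nat" where
  "kostka ls w = card (multitableaux ls w)"

text \<open>So \<^term>\<open>card\<close> is a genuine count.\<close>

lemma finite_multitableaux: "finite (multitableaux ls w)"
proof -
  define R where "R = {row. set row \<subseteq> {..length w} \<and> length row \<le> Max (insert 0 (set (concat ls)))}"
  define B where "B = {T. set T \<subseteq> R \<and> length T \<le> Max (insert 0 (length ` set ls))}"
  have "finite R" unfolding R_def by (rule finite_lists_length_le) simp
  hence "finite B" unfolding B_def by (rule finite_lists_length_le)
  hence fin: "finite {Ts. set Ts \<subseteq> B \<and> length Ts = length ls}" by (rule finite_lists_length_eq)
  have "multitableaux ls w \<subseteq> {Ts. set Ts \<subseteq> B \<and> length Ts = length ls}"
  proof
    fix Ts assume "Ts \<in> multitableaux ls w"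
    hence ss: "list_all2 semistandard ls Ts"
      and wt: "\<And>i. i \<ge> 1 \<Longrightarrow> entry w i = (\<Sum>T\<leftarrow>Ts. weight T i)"
      by (auto simp: multitableaux_def)
    have "T \<in> B" if T: "T \<in> set Ts" for T
    proof -
      from ss T obtain l where l: "l \<in> set ls" and sl: "semistandard l T"
        by (metis list_all2_conv_all_nth in_set_conv_nth)
      have "row \<in> R" if row: "row \<in> set T" for row
      proof -
        have "i \<le> length w" if i: "i \<in> set row" for i
        proof (rule ccontr)
          assume "\<not> i \<le> length w"
          hence "entry w i = 0" "i \<ge> 1" by (auto simp: entry_def)
          with wt have "(\<Sum>T\<leftarrow>Ts. weight T i) = 0" by simp
          hence "weight T i = 0" using T by simp
          thus False using i row by (auto simp: weight_def count_list_0_iff)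
        qed
        moreover have "length row \<in> set (concat ls)"
          using l sl row by (force simp: semistandard_def)
        ultimately show ?thesis by (auto simp: R_def intro: Max_ge)
      qed
      moreover have "length T = length l" using sl by (auto simp: semistandard_def)
      ultimately show ?thesis using l by (auto simp: B_def intro: Max_ge)
    qed
    thus "Ts \<in> {Ts. set Ts \<subseteq> B \<and> length Ts = length ls}"
      using ss by (auto dest: list_all2_lengthD)
  qed
  thus ?thesis using fin by (rule finite_subset)
qed


section \<open>Deterministic multitape Turing machines\<close>

datatype move = MoveLeft | Stay | MoveRight

text \<open>Tape symbols and states are natural numbers; the symbol \<open>0\<close> is the blank, and
  \<open>1\<close> and \<open>2\<close> stand for the input bits \<open>0\<close> and \<open>1\<close>.\<close>

record machine =
  num_tapes :: nat
  states :: "nat set"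
  alphabet :: "nat set"
  start :: nat
  accept :: nat
  reject :: nat
  delta :: "nat \<Rightarrow> nat list \<Rightarrow> nat \<times> (nat \<times> move) list"

definition wf_machine :: "machine \<Rightarrow> bool" where
  "wf_machine M \<longleftrightarrow>
     num_tapes M \<ge> 1 \<and> finite (states M) \<and> finite (alphabet M) \<and> {0, 1, 2} \<subseteq> alphabet M \<and>
     {start M, accept M, reject M} \<subseteq> states M \<and> accept M \<noteq> reject M \<and>
     (\<forall>q\<in>states M. \<forall>as. length as = num_tapes M \<and> set as \<subseteq> alphabet M \<longrightarrow>
        fst (delta M q as) \<in> states M \<and>
        length (snd (delta M q as)) = num_tapes M \<and>
        fst ` set (snd (delta M q as)) \<subseteq> alphabet M)"

text \<open>A tape is its two-way infinite contents together with the position of the head.\<close>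

type_synonym tape = "(int \<Rightarrow> nat) \<times> int"

fun read :: "tape \<Rightarrow> nat" where
  "read (c, p) = c p"

fun offset :: "move \<Rightarrow> int" where
  "offset MoveLeft = -1" | "offset Stay = 0" | "offset MoveRight = 1"

fun act :: "tape \<Rightarrow> nat \<times> move \<Rightarrow> tape" where
  "act (c, p) (a, m) = (c(p := a), p + offset m)"

type_synonym config = "nat \<times> tape list"

fun step :: "machine \<Rightarrow> config \<Rightarrow> config" where
  "step M (q, ts) =
     (if q = accept M \<or> q = reject M then (q, ts)
      else let (q', acts) = delta M q (map read ts) in (q', map2 act ts acts))"

definition input_tape :: "bool list \<Rightarrow> tape" where
  "input_tape x =
     ((\<lambda>p. if 0 \<le> p \<and> p < int (length x) then (if x ! nat p then 2 else 1) else 0), 0)"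

definition initial :: "machine \<Rightarrow> bool list \<Rightarrow> config" where
  "initial M x = (start M, input_tape x # replicate (num_tapes M - 1) (input_tape []))"

text \<open>One machine and one polynomial serve all instances in \<open>D\<close>; inputs that do not encode an
  instance in \<open>D\<close> are unconstrained. Since \<^const>\<open>step\<close> does nothing in the two halting states, the
  answer of a machine is unique.\<close>

definition polytime_decidable :: "('a \<Rightarrow> bool list) \<Rightarrow> 'a set \<Rightarrow> ('a \<Rightarrow> bool) \<Rightarrow> bool" where
  "polytime_decidable enc D P \<longleftrightarrow>
     (\<exists>M. wf_machine M \<and>
       (\<exists>p :: nat poly. \<forall>x\<in>D. \<exists>t \<le> poly p (length (enc x)).
          fst ((step M ^^ t) (initial M (enc x))) = (if P x then accept M else reject M)))"


section \<open>Instances and their encoding\<close>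

definition instances :: "(nat list list \<times> nat list) set" where
  "instances = {(ls, w). \<exists>r n. multipartition r n ls \<and> composition_of n w}"

text \<open>Most significant bit first, without leading zeros.\<close>

fun binary :: "nat \<Rightarrow> bool list" where
  "binary n = (if n < 2 then [n = 1] else binary (n div 2) @ [odd n])"

declare binary.simps [simp del]

text \<open>The four symbols \<open>0\<close>, \<open>1\<close>, comma and semicolon are written as the bit pairs \<open>00\<close>, \<open>01\<close>, \<open>10\<close>
  and \<open>11\<close>. Every integer is terminated by a comma and every tuple by a semicolon.\<close>

definition enc_nat :: "nat \<Rightarrow> bool list" where
  "enc_nat n = concat (map (\<lambda>b. [False, b]) (binary n)) @ [True, False]"

definition enc_tuple :: "nat list \<Rightarrow> bool list" where
  "enc_tuple xs = concat (map enc_nat xs) @ [True, True]"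

fun encode :: "nat list list \<times> nat list \<Rightarrow> bool list" where
  "encode (ls, w) = concat (map enc_tuple ls) @ enc_tuple w"

lemma binary_inject: "binary m = binary n \<longleftrightarrow> m = n"
proof (induction m arbitrary: n rule: less_induct)
  case (less m)
  have ne: "binary k \<noteq> []" for k by (subst binary.simps) auto
  show ?case
  proof (cases "m < 2 \<or> n < 2")
    case True
    thus ?thesis using ne[of "m div 2"] ne[of "n div 2"]
      by (subst (1 2) binary.simps) (auto simp: append_eq_Cons_conv Cons_eq_append_conv)
  next
    case False
    hence "binary m = binary n \<longleftrightarrow> m div 2 = n div 2 \<and> odd m = odd n"
      using less.IH[of "m div 2" "n div 2"] by (subst (1 2) binary.simps) auto
    also have "\<dots> \<longleftrightarrow> m = n"
      by (metis even_two_times_div_two odd_two_times_div_two_succ)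
    finally show ?thesis .
  qed
qed

lemma enc_nat_append_inject: "enc_nat m @ u = enc_nat n @ v \<longleftrightarrow> m = n \<and> u = v"
proof -
  have "concat (map (\<lambda>b. [False, b]) xs) @ [True, False] @ u =
        concat (map (\<lambda>b. [False, b]) ys) @ [True, False] @ v \<longleftrightarrow> xs = ys \<and> u = v" for xs ys
  proof (induction xs arbitrary: ys)
    case Nil
    show ?case by (cases ys) auto
  next
    case (Cons x xs)
    show ?case using Cons.IH by (cases ys) auto
  qed
  thus ?thesis by (simp add: enc_nat_def binary_inject)
qed

lemma enc_nat_start: "\<exists>b u. enc_nat n = False # b # u"
proof (cases "binary n")
  case Nil
  thus ?thesis by (subst (asm) binary.simps) (auto split: if_splits)
qed (auto simp: enc_nat_def)

lemma enc_tuple_append_inject: "enc_tuple xs @ u = enc_tuple ys @ v \<longleftrightarrow> xs = ys \<and> u = v"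
proof (induction xs arbitrary: ys)
  case Nil
  show ?case
  proof (cases ys)
    case (Cons y ys')
    thus ?thesis using enc_nat_start[of y] by (auto simp: enc_tuple_def)
  qed (auto simp: enc_tuple_def)
next
  case (Cons x xs)
  show ?case
  proof (cases ys)
    case Nil
    thus ?thesis using enc_nat_start[of x] by (auto simp: enc_tuple_def)
  next
    case (Cons y ys')
    thus ?thesis using Cons.IH[of ys'] by (auto simp: enc_tuple_def enc_nat_append_inject)
  qed
qed

lemma inj_encode: "inj encode"
proof -
  have ne: "enc_tuple xs \<noteq> []" for xs by (simp add: enc_tuple_def)
  have "concat (map enc_tuple xs) = concat (map enc_tuple ys) \<Longrightarrow> xs = ys" for xs ys
  proof (induction xs arbitrary: ys)
    case Nil
    thus ?case using ne by (cases ys) auto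
  next
    case (Cons x xs)
    thus ?case using ne by (cases ys) (auto simp: enc_tuple_append_inject)
  qed
  note * = this
  have eq: "encode (ls, w) = concat (map enc_tuple (ls @ [w]))" for ls w by simp
  show ?thesis
  proof (rule injI)
    fix x y assume "encode x = encode y"
    thus "x = y" using * by (cases x; cases y) (auto simp only: eq append1_eq_conv)
  qed
qed

end

theory Submission
  imports Defs
begin

text \<open>
  Write $D_k$ for the total size of the first $k$ rows of all $\lambda(j)$ and $\Omega_k$ for the sum of the $k$
  largest entries of $\omega$. Removing the largest letter from a multitableau removes a horizontal
  strip; the strip that takes boxes from the longest columns keeps all prefix sums $D_k$ as large as
  possible, whence $K > 0$ iff $\Omega_k \le D_k$ for all $k$. As $K$ is symmetric in $\omega$, the
  removed letter may be assumed to have the least multiplicity, and comparing the possible strips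
  with the greedy one shows that, if $K > 0$, then $K > 1$ iff within a run of consecutive $k$ with $\Omega_k < D_k$ there
  are two descents $\lambda(j)_k > \lambda(j)_{k+1}$ (for different pairs $(j, k)$), or there is one at a
  position $k$ that is neither the first nor the last of its run. A finite automaton checks this
  while $k$ runs up to the length of $\omega$, and each step only takes additions and comparisons of
  binary numbers, which a multitape machine does with its tapes used as stacks.
\<close>

section \<open>Sums of the largest letters\<close>

text \<open>Two strips of the same size in one shape differ only at descents, and trading a removed
  box between two descents lowers the sums D_k in between by one. This is harmless while these sums
  are strict, which is why runs of strict positions decide. A single descent inside its run splits,
  possibly after several removals, into two adjacent descents of a smaller shape; at an end of the
  run one of the strict neighbours required for this is missing. Removing a least letter is what
  makes this traceable. It leaves \<Omega>_k unchanged for all k up to the number of remaining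
  letters, and every later position beyond the row where the greedy strip ends is strict, because
  the rows there are shorter than every multiplicity. Entries are binary, so n may be exponential in
  the input size. The program therefore never handles single boxes, and its time bound rests on a
  space budget: a sum grows by no more cells than are freed by the number added to it.\<close>

fun top_sum :: "nat list \<Rightarrow> nat \<Rightarrow> nat" where
  "top_sum [] k = 0"
| "top_sum (m # w) 0 = 0"
| "top_sum (m # w) (Suc k) = max (top_sum w (Suc k)) (top_sum w k + m)"

lemma top_sum_0 [simp]: "top_sum w 0 = 0" by (cases w) auto

lemma top_sum_mono_Suc: "top_sum w k \<le> top_sum w (Suc k)"
proof (induction w arbitrary: k)
  case (Cons m w)
  show ?case
  proof (cases k)
    case (Suc i)
    then show ?thesis using Cons[of k] Cons[of i] by auto
  qed simp
qed simp

lemma top_sum_full: "length w \<le> k \<Longrightarrow> top_sum w k = sum_list w"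
proof (induction w arbitrary: k)
  case (Cons m w)
  then obtain i where k: "k = Suc i" "length w \<le> i" by (cases k) auto
  with Cons.IH[of i] Cons.IH[of k] show ?case by simp
qed simp

lemma top_sum_swap: "top_sum (a # b # w) k = top_sum (b # a # w) k"
  by (cases k; cases "k - 1") (auto simp: max_def)

lemma top_sum_Cons_cong: "(\<And>k. top_sum u k = top_sum v k) \<Longrightarrow> top_sum (a # u) k = top_sum (a # v) k"
  by (cases k) auto

lemma top_sum_insort: "top_sum (insort a w) k = top_sum (a # w) k"
proof (induction w arbitrary: k)
  case (Cons b w)
  show ?case
  proof (cases "a \<le> b")
    case False
    then have "top_sum (insort a (b # w)) k = top_sum (b # insort a w) k" by simp
    also have "\<dots> = top_sum (b # a # w) k" by (rule top_sum_Cons_cong) (rule Cons.IH)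
    finally show ?thesis by (simp only: top_sum_swap)
  qed simp
qed simp

lemma top_sum_sort: "top_sum (sort w) k = top_sum w k"
proof (induction w arbitrary: k)
  case (Cons a w)
  have "top_sum (sort (a # w)) k = top_sum (a # sort w) k" by (simp add: top_sum_insort)
  then show ?case using top_sum_Cons_cong[OF Cons.IH] by simp
qed simp

lemma top_sum_mset: "mset u = mset v \<Longrightarrow> top_sum u k = top_sum v k"
  by (metis top_sum_sort mset_sort properties_for_sort sorted_sort)

lemma top_sum_add_min_le: "\<forall>x\<in>set w. m \<le> x \<Longrightarrow> k < length w \<Longrightarrow> top_sum w k + m \<le> top_sum w (Suc k)"
proof (induction w arbitrary: k)
  case (Cons a w)
  show ?case
  proof (cases k)
    case (Suc i)
    with Cons have "top_sum w i + m \<le> top_sum w k" by simp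
    moreover have "top_sum w (Suc i) + m \<le> top_sum w k + a" using Suc Cons.prems by simp
    ultimately show ?thesis using Suc by (auto simp: max_def)
  qed (use Cons.prems in auto)
qed simp

text \<open>A least letter never improves a choice of at most \<open>length w\<close> letters.
  Beyond that range the two sides differ by \<open>m\<close>, so the bound on \<open>k\<close>
  returns in every later use.\<close>

lemma top_sum_Cons_min: "\<forall>x\<in>set w. m \<le> x \<Longrightarrow> k \<le> length w \<Longrightarrow> top_sum (m # w) k = top_sum w k"
  using top_sum_add_min_le[of w m "k - 1"] by (cases k) auto

text \<open>The letters outside the \<open>k\<close> largest number \<open>length w - k\<close>, and
  each is at least \<open>m\<close>. This later forces strictness at all positions beyond the
  threshold row.\<close>

lemma top_sum_tail: "\<forall>x\<in>set w. m \<le> x \<Longrightarrow> k \<le> length w \<Longrightarrow> top_sum w k + (length w - k) * m \<le> sum_list w"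
proof (induction w arbitrary: k)
  case (Cons a w)
  have full: "top_sum w (Suc (length w)) = sum_list w" by (simp add: top_sum_full)
  show ?case
  proof (cases k)
    case 0
    then show ?thesis using Cons.IH[of 0] Cons.prems by auto
  next
    case (Suc i)
    with Cons have i: "top_sum w i + (length w - i) * m \<le> sum_list w" by simp
    show ?thesis
    proof (cases "k \<le> length w")
      case True
      with Cons have "top_sum w k + (length w - k) * m \<le> sum_list w" by simp
      moreover have "length w - i = Suc (length w - k)" using Suc True by simp
      ultimately show ?thesis using i Suc Cons.prems(1) by (auto simp: max_def)
    next
      case False
      then have "i = length w" using Suc Cons.prems by simp
      then show ?thesis using i Suc full by simp
    qed
  qed
qed simp

lemma top_sum_Suc_le_max: "\<forall>x\<in>set w. x \<le> a \<Longrightarrow> top_sum w (Suc k) \<le> top_sum w k + a"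
proof (induction w arbitrary: k)
  case (Cons b w)
  then have IH: "top_sum w (Suc k) \<le> top_sum w k + a" for k by simp
  show ?case
  proof (cases k)
    case 0
    then show ?thesis using IH[of 0] Cons.prems by auto
  next
    case (Suc i)
    then show ?thesis using IH[of k] IH[of i] by (auto simp: max_def)
  qed
qed simp

lemma top_sum_Cons_max: "\<forall>x\<in>set w. x \<le> a \<Longrightarrow> top_sum (a # w) (Suc k) = a + top_sum w k"
  using top_sum_Suc_le_max[of w a k] by simp

section \<open>Integer points of a box with prescribed coordinate sum\<close>

lemma choose_between:
  fixes lo hi :: "nat \<Rightarrow> nat"
  assumes "\<And>j. lo j \<le> hi j" "(\<Sum>j<r. lo j) \<le> t" "t \<le> (\<Sum>j<r. hi j)"
  shows "\<exists>v. (\<forall>j. lo j \<le> v j \<and> v j \<le> hi j) \<and> (\<Sum>j<r. v j) = t"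
  using assms(2,3)
proof (induction r arbitrary: t)
  case 0
  then show ?case using assms(1) by (intro exI[of _ lo]) auto
next
  case (Suc r)
  \<comment> \<open>The last coordinate takes as much of \<open>t\<close> as it can hold once the
    minima of the others are reserved.\<close>
  define c where "c = min (hi r) (t - (\<Sum>j<r. lo j))"
  have c: "lo r \<le> c" "c \<le> hi r" "(\<Sum>j<r. lo j) \<le> t - c" "c \<le> t" "t - c \<le> (\<Sum>j<r. hi j)"
    using Suc.prems assms(1)[of r] sum_mono[of "{..<r}" lo hi] assms(1) unfolding c_def by auto
  obtain v where v: "\<forall>j. lo j \<le> v j \<and> v j \<le> hi j" "(\<Sum>j<r. v j) = t - c"
    using Suc.IH[OF c(3,5)] by blast
  have "(\<Sum>j<r. (v(r := c)) j) = (\<Sum>j<r. v j)" by (rule sum.cong) auto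
  then show ?case using v c by (intro exI[of _ "v(r := c)"]) auto
qed

text \<open>From one solution a second one arises by passing a unit between two coordinates. The
  strict bounds on \<open>t\<close> provide a coordinate that can give and one that can take; if
  they coincide, another coordinate with a nontrivial interval serves as partner.\<close>

lemma choose_between_two:
  fixes lo hi :: "nat \<Rightarrow> nat"
  assumes lohi: "\<And>j. lo j \<le> hi j" and t: "(\<Sum>j<r. lo j) < t" "t < (\<Sum>j<r. hi j)"
    and jj: "j < r" "j' < r" "j \<noteq> j'" "lo j < hi j" "lo j' < hi j'"
  shows "\<exists>v v'. v \<noteq> v' \<and> (\<forall>j. lo j \<le> v j \<and> v j \<le> hi j) \<and> (\<Sum>j<r. v j) = t
     \<and> (\<forall>j. lo j \<le> v' j \<and> v' j \<le> hi j) \<and> (\<Sum>j<r. v' j) = t"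
proof -
  obtain v where v: "\<forall>i. lo i \<le> v i \<and> v i \<le> hi i" "(\<Sum>i<r. v i) = t"
    using choose_between[of lo hi r t] lohi t by auto
  have "\<exists>u. u \<noteq> v \<and> (\<forall>j. lo j \<le> u j \<and> u j \<le> hi j) \<and> (\<Sum>j<r. u j) = t"
  proof (rule ccontr)
    assume neg: "\<nexists>u. u \<noteq> v \<and> (\<forall>j. lo j \<le> u j \<and> u j \<le> hi j) \<and> (\<Sum>j<r. u j) = t"
    have uniq: "u = v" if "\<And>i. lo i \<le> u i \<and> u i \<le> hi i" "(\<Sum>i<r. u i) = t" for u
      using neg that by blast
  have move: False if p: "p < r" "q < r" "p \<noteq> q" "v p < hi p" "lo q < v q" for p q
  proof -
    define u where "u = v(p := Suc (v p), q := v q - 1)"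
    have upd: "(\<Sum>i<r. (x(k := y)) i) + x k = (\<Sum>i<r. x i) + y" if "k < r" for x :: "nat \<Rightarrow> nat" and k y
    proof -
      have "(\<Sum>i\<in>{..<r} - {k}. (x(k := y)) i) = (\<Sum>i\<in>{..<r} - {k}. x i)" by (rule sum.cong) auto
      then show ?thesis using that
        by (simp only: sum.remove[of "{..<r}" k x] sum.remove[of "{..<r}" k "x(k := y)"] finite_lessThan lessThan_iff) simp
    qed
    have "(\<Sum>i<r. (v(p := Suc (v p))) i) = Suc (\<Sum>i<r. v i)" using upd[of p v "Suc (v p)"] p(1) by (simp del: fun_upd_apply)
    moreover have "(\<Sum>i<r. u i) + v q = (\<Sum>i<r. (v(p := Suc (v p))) i) + (v q - 1)"
      unfolding u_def using p(2,3) upd[of q "v(p := Suc (v p))" "v q - 1"] by simp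
    ultimately have "(\<Sum>i<r. u i) = t" using v(2) p(5) by simp
    moreover have "lo i \<le> u i \<and> u i \<le> hi i" for i
      using v(1)[rule_format, of i] v(1)[rule_format, of q] p unfolding u_def by auto
    ultimately have "u = v" using uniq by blast
    then have "u p = v p" by simp
    then show False using p(3) by (simp add: u_def)
  qed
  have "\<not> (\<forall>i<r. v i = lo i)"
  proof
    assume "\<forall>i<r. v i = lo i"
    then have "(\<Sum>i<r. v i) = (\<Sum>i<r. lo i)" by simp
    then show False using v(2) t(1) by simp
  qed
  then obtain q where q: "q < r" "lo q < v q" using v(1) by (metis le_neq_implies_less)
  have "\<not> (\<forall>i<r. v i = hi i)"
  proof
    assume "\<forall>i<r. v i = hi i"
    then have "(\<Sum>i<r. v i) = (\<Sum>i<r. hi i)" by simp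
    then show False using v(2) t(2) by simp
  qed
  then obtain p where p: "p < r" "v p < hi p" using v(1) by (metis le_neq_implies_less)
  show False
  proof (cases "p = q")
    case False
    then show ?thesis using move p q by blast
  next
    case True
    define o' where "o' = (if p = j then j' else j)"
    have o: "o' < r" "o' \<noteq> p" "lo o' < hi o'" using jj by (auto simp: o'_def)
    have "v o' < hi o' \<or> lo o' < v o'" using o(3) v(1)[rule_format, of o'] by linarith
    then show ?thesis using move[of o' q] move[of p o'] o p q True by auto
  qed
qed
  then show ?thesis using v by blast
qed

section \<open>Chains of shapes and the dominance criterion\<close>

text \<open>Sums run over a fixed range of \<open>r\<close> shapes and \<open>R\<close> rows, and
  shapes vanish outside it. Shapes with different numbers of rows thus become comparable
  pointwise.\<close>

locale box =
  fixes r R :: nat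
begin

definition shapes :: "(nat \<Rightarrow> nat \<Rightarrow> nat) set" where
  "shapes = {f. (\<forall>j i. f j (Suc i) \<le> f j i) \<and> (\<forall>j i. j \<ge> r \<or> i \<ge> R \<longrightarrow> f j i = 0)}"

definition row :: "(nat \<Rightarrow> nat \<Rightarrow> nat) \<Rightarrow> nat \<Rightarrow> nat" where
  "row f i = (\<Sum>j<r. f j i)"

definition rows :: "(nat \<Rightarrow> nat \<Rightarrow> nat) \<Rightarrow> nat \<Rightarrow> nat" where
  "rows f k = (\<Sum>i<k. row f i)"

text \<open>Interlacing of consecutive rows says that no column loses two boxes. These are the
  horizontal strips, taken in all \<open>r\<close> shapes at once and with common size
  \<open>m\<close>.\<close>

definition strips :: "(nat \<Rightarrow> nat \<Rightarrow> nat) \<Rightarrow> nat \<Rightarrow> (nat \<Rightarrow> nat \<Rightarrow> nat) set" where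
  "strips f m = {g. (\<forall>j i. f j (Suc i) \<le> g j i \<and> g j i \<le> f j i) \<and> rows g R + m = rows f R}"

text \<open>The head of the list belongs to the letter removed first, which is the largest one;
  hence the reversed list when tableaux are counted.\<close>

fun chains :: "(nat \<Rightarrow> nat \<Rightarrow> nat) \<Rightarrow> nat list \<Rightarrow> nat" where
  "chains f [] = (if rows f R = 0 then 1 else 0)"
| "chains f (m # w) = (\<Sum>g\<in>strips f m. chains g w)"

lemma rows_0 [simp]: "rows f 0 = 0" and rows_Suc: "rows f (Suc k) = rows f k + row f k"
  by (auto simp: rows_def)

lemma shapes_outside: "f \<in> shapes \<Longrightarrow> j \<ge> r \<or> i \<ge> R \<Longrightarrow> f j i = 0"
  by (auto simp: shapes_def)

lemma shapes_dec: "f \<in> shapes \<Longrightarrow> f j (Suc i) \<le> f j i"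
  by (auto simp: shapes_def)

lemma shapes_antimono: "f \<in> shapes \<Longrightarrow> i \<le> k \<Longrightarrow> f j k \<le> f j i"
  by (rule lift_Suc_antimono_le[of "f j"]) (auto simp: shapes_dec)

lemma row_antimono: "f \<in> shapes \<Longrightarrow> i \<le> k \<Longrightarrow> row f k \<le> row f i"
  unfolding row_def by (rule sum_mono) (rule shapes_antimono)

lemma row_outside: "f \<in> shapes \<Longrightarrow> i \<ge> R \<Longrightarrow> row f i = 0"
  by (auto simp: row_def shapes_outside)

lemma rows_mono: "i \<le> k \<Longrightarrow> rows f i \<le> rows f k"
  unfolding rows_def by (intro sum_mono2) auto

lemma rows_full: assumes "f \<in> shapes" "k \<ge> R" shows "rows f k = rows f R"
  using assms(2) by (induction k rule: dec_induct) (auto simp: rows_Suc row_outside assms)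

lemma rows_le_total: "f \<in> shapes \<Longrightarrow> rows f k \<le> rows f R"
  by (metis rows_full rows_mono nle_le)

lemma strip_shape: assumes "f \<in> shapes" "g \<in> strips f m" shows "g \<in> shapes"
proof -
  have b: "f j (Suc i) \<le> g j i" "g j i \<le> f j i" for j i
    using assms(2) by (auto simp: strips_def)
  have "g j (Suc i) \<le> g j i" for j i using b(2)[of j "Suc i"] b(1)[of j i] by linarith
  moreover have "g j i = 0" if "j \<ge> r \<or> i \<ge> R" for j i
    using b(2)[of j i] shapes_outside[OF assms(1) that] by simp
  ultimately show ?thesis by (auto simp: shapes_def)
qed

lemma strip_le: "g \<in> strips f m \<Longrightarrow> g j i \<le> f j i"
  and strip_ge: "g \<in> strips f m \<Longrightarrow> f j (Suc i) \<le> g j i"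
  and strip_total: "g \<in> strips f m \<Longrightarrow> rows g R + m = rows f R"
  by (auto simp: strips_def)

lemma strip_row_le: "g \<in> strips f m \<Longrightarrow> row g i \<le> row f i"
  and strip_row_ge: "g \<in> strips f m \<Longrightarrow> row f (Suc i) \<le> row g i"
  unfolding row_def by (rule sum_mono, simp add: strip_le strip_ge)+

lemma strip_rows_le: "g \<in> strips f m \<Longrightarrow> rows g k \<le> rows f k"
  unfolding rows_def by (rule sum_mono) (rule strip_row_le)

text \<open>From row \<open>k\<close> on, \<open>g\<close> contains the rows of \<open>f\<close>
  from \<open>k + 1\<close> on; comparing the complements of the two prefixes gives the bound. The
  greedy strip attains it beyond its threshold row.\<close>

lemma strip_rows_ge: assumes f: "f \<in> shapes" and g: "g \<in> strips f m"
  shows "rows g k + m \<le> rows f (Suc k)"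
proof -
  have "rows f (Suc k + d) + rows g k \<le> rows g (k + d) + rows f (Suc k)" for d
  proof (induction d)
    case (Suc d)
    then show ?case using strip_row_ge[OF g, of "k + d"] by (simp add: rows_Suc)
  qed simp
  from this[of R] have "rows f R + rows g k \<le> rows g R + rows f (Suc k)"
    using rows_full[OF f, of "Suc k + R"] rows_full[OF strip_shape[OF f g], of "k + R"] by simp
  then show ?thesis using strip_total[OF g] by simp
qed


text \<open>Only the row totals have to interlace: the bounds for a row of \<open>g\<close> involve
  \<open>f\<close> alone, so each total can be distributed over the \<open>r\<close> shapes
  independently of the other rows.\<close>

lemma strip_exists:
  assumes \<rho>: "\<And>i. row f (Suc i) \<le> \<rho> i \<and> \<rho> i \<le> row f i" "(\<Sum>i<R. \<rho> i) + m = rows f R" and f: "f \<in> shapes"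
  shows "\<exists>g\<in>strips f m. \<forall>i. row g i = \<rho> i"
proof -
  have "\<exists>v. (\<forall>j. f j (Suc i) \<le> v j \<and> v j \<le> f j i) \<and> (\<Sum>j<r. v j) = \<rho> i" for i
    using \<rho>(1)[of i] by (intro choose_between) (auto simp: shapes_dec[OF f] row_def)
  then obtain v where v: "\<And>i j. f j (Suc i) \<le> v i j \<and> v i j \<le> f j i" "\<And>i. (\<Sum>j<r. v i j) = \<rho> i"
    by metis
  define g where "g = (\<lambda>j i. v i j)"
  have "row g i = \<rho> i" for i by (simp add: row_def g_def v)
  moreover from this have "g \<in> strips f m" using v(1) \<rho>(2) by (simp add: strips_def rows_def g_def)
  ultimately show ?thesis by blast
qed

lemma finite_strips: assumes f: "f \<in> shapes" shows "finite (strips f m)"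
proof -
  define M where "M = Max ((\<lambda>(j, i). f j i) ` ({..<r} \<times> {..<R}))"
  let ?H = "{h. \<forall>x. (x \<in> {..<r} \<times> {..<R} \<longrightarrow> h x \<in> {..M}) \<and> (x \<notin> {..<r} \<times> {..<R} \<longrightarrow> h x = (0::nat))}"
  have fin: "finite ?H" by (rule finite_set_of_finite_funs) auto
  have "strips f m \<subseteq> curry ` ?H"
  proof
    fix g assume g: "g \<in> strips f m"
    have "f j i \<le> M" if "j < r" "i < R" for j i unfolding M_def using that by (auto intro!: Max_ge)
    then have "case_prod g \<in> ?H"
      using shapes_outside[OF strip_shape[OF f g]] order_trans[OF strip_le[OF g]]
      by (auto simp: not_less)
    then have "curry (case_prod g) \<in> curry ` ?H" by (rule imageI)
    then show "g \<in> curry ` ?H" by (simp only: curry_case_prod)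
  qed
  then show ?thesis by (rule finite_subset) (rule finite_imageI[OF fin])
qed

lemma chains_Cons_pos: "f \<in> shapes \<Longrightarrow> chains f (m # w) > 0 \<longleftrightarrow> (\<exists>g\<in>strips f m. chains g w > 0)"
  unfolding chains.simps neq0_conv[symmetric] by (simp only: sum_eq_0_iff[OF finite_strips]) auto

text \<open>Shifting up all rows after \<open>h\<close> removes \<open>row f (Suc h)\<close> boxes,
  and shifting row \<open>h\<close> as well removes \<open>row f h\<close>. The two bounds thus say
  that the uppermost boxes of the greedy strip lie in row \<open>h\<close>.\<close>

lemma threshold_exists:
  assumes "f \<in> shapes" "0 < m" "m \<le> row f 0"
  shows "\<exists>h. row f (Suc h) < m \<and> m \<le> row f h"
proof -
  have "row f R < m" using row_outside[OF assms(1) order_refl] assms(2) by simp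
  moreover have "\<not> row f 0 < m" using assms(3) by simp
  ultimately show ?thesis using ex_least_nat_less[of "\<lambda>k. row f k < m" R] not_less by blast
qed

text \<open>The strip of the greedy algorithm: it takes the boxes as low as possible, so that the
  prefix sums of the remaining shape are as large as possible.\<close>

lemma greedy_strip:
  assumes f: "f \<in> shapes" and h: "row f (Suc h) < m" "m \<le> row f h"
  obtains g where "g \<in> strips f m" "\<And>i. i < h \<Longrightarrow> row g i = row f i"
    "row g h = row f h + row f (Suc h) - m" "\<And>i. h < i \<Longrightarrow> row g i = row f (Suc i)"
    "\<And>k. k \<le> h \<Longrightarrow> rows g k = rows f k" "\<And>k. h < k \<Longrightarrow> rows g k + m = rows f (Suc k)"
proof -
  \<comment> \<open>Row \<open>h\<close> gives the \<open>m - row f (Suc h)\<close> boxes that the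
    rows after it cannot supply.\<close>
  define \<rho> where "\<rho> i = (if i < h then row f i else if i = h then row f h + row f (Suc h) - m
    else row f (Suc i))" for i
  have lo: "(\<Sum>i<k. \<rho> i) = rows f k" if "k \<le> h" for k
    using that unfolding rows_def by (intro sum.cong) (auto simp: \<rho>_def)
  have hi: "(\<Sum>i<k. \<rho> i) + m = rows f (Suc k)" if "Suc h \<le> k" for k
    using that
  proof (induction k rule: dec_induct)
    case base
    then show ?case using lo[of h] h by (simp add: rows_Suc \<rho>_def)
  next
    case (step k)
    then show ?case by (simp add: rows_Suc \<rho>_def)
  qed
  have "h < R" using h row_outside[OF f, of h] by (metis not_le le_zero_eq less_nat_zero_code)
  then have "(\<Sum>i<R. \<rho> i) + m = rows f R" using hi[of R] rows_full[OF f, of "Suc R"] by simp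
  moreover have "row f (Suc i) \<le> \<rho> i \<and> \<rho> i \<le> row f i" for i
    using h row_antimono[OF f, of i "Suc i"] by (auto simp: \<rho>_def)
  ultimately obtain g where g: "g \<in> strips f m" "\<And>i. row g i = \<rho> i"
    using strip_exists f by metis
  then have "rows g k = (\<Sum>i<k. \<rho> i)" for k by (simp add: rows_def)
  then show ?thesis using that[of g] g lo hi by (simp add: \<rho>_def)
qed

text \<open>For necessity, \<open>strip_rows_ge\<close> covers the choices of letters that include
  the removed one and \<open>strip_rows_le\<close> the others. For sufficiency, the greedy strip
  attains one of these two bounds at every \<open>k\<close>. The order of \<open>w\<close> is
  arbitrary.\<close>

theorem chains_pos_iff:
  "f \<in> shapes \<Longrightarrow> chains f w > 0 \<longleftrightarrow> rows f R = sum_list w \<and> (\<forall>k. top_sum w k \<le> rows f k)"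
proof (induction w arbitrary: f)
  case (Cons m w)
  note f = \<open>f \<in> shapes\<close>
  show ?case
  proof
    assume "chains f (m # w) > 0"
    then obtain g where g: "g \<in> strips f m" "chains g w > 0" using chains_Cons_pos f by blast
    then have *: "rows g R = sum_list w" "top_sum w k \<le> rows g k" for k
      using Cons.IH[OF strip_shape[OF f g(1)]] by auto
    have "top_sum (m # w) k \<le> rows f k" for k
    proof (cases k)
      case (Suc i)
      have "top_sum w i + m \<le> rows f (Suc i)"
        using *(2)[of i] strip_rows_ge[OF f g(1), of i] by simp
      moreover have "top_sum w (Suc i) \<le> rows f (Suc i)"
        using *(2)[of "Suc i"] strip_rows_le[OF g(1), of "Suc i"] by simp
      ultimately show ?thesis using Suc by simp
    qed simp
    then show "rows f R = sum_list (m # w) \<and> (\<forall>k. top_sum (m # w) k \<le> rows f k)"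
      using *(1) strip_total[OF g(1)] by simp
  next
    assume A: "rows f R = sum_list (m # w) \<and> (\<forall>k. top_sum (m # w) k \<le> rows f k)"
    have tops: "top_sum w k \<le> rows f k" "top_sum w k + m \<le> rows f (Suc k)" for k
      using A[THEN conjunct2, rule_format, of k] A[THEN conjunct2, rule_format, of "Suc k"]
      by (cases k; simp)+
    show "chains f (m # w) > 0"
    \<comment> \<open>A strip without boxes has no threshold row.\<close>
    proof (cases "m = 0")
      case True
      then have "f \<in> strips f m" by (auto simp: strips_def shapes_dec[OF f])
      moreover have "chains f w > 0" using Cons.IH[OF f] A tops True by simp
      ultimately show ?thesis using chains_Cons_pos f by blast
    next
      case False
      have "m \<le> row f 0" using tops(2)[of 0] by (simp add: rows_Suc)
      then obtain h where h: "row f (Suc h) < m" "m \<le> row f h"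
        using threshold_exists f False by blast
      obtain g where g: "g \<in> strips f m" "\<And>k. k \<le> h \<Longrightarrow> rows g k = rows f k"
        "\<And>k. h < k \<Longrightarrow> rows g k + m = rows f (Suc k)"
        using greedy_strip[OF f h] by metis
      have "top_sum w k \<le> rows g k" for k
        using g(2,3)[of k] tops[of k] by (cases "k \<le> h") auto
      moreover have "rows g R = sum_list w" using strip_total[OF g(1)] A by simp
      ultimately have "chains g w > 0" using Cons.IH[OF strip_shape[OF f g(1)]] by simp
      then show ?thesis using g(1) chains_Cons_pos f by blast
    qed
  qed
next
  case Nil
  then have "rows f k \<le> rows f R" for k by (rule rows_le_total)
  then show ?case by auto
qed

lemma chains_ge2:
  assumes f: "f \<in> shapes" and g: "g \<in> strips f m" "g' \<in> strips f m" "g \<noteq> g'" "chains g w > 0" "chains g' w > 0"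
  shows "chains f (m # w) \<ge> 2"
proof -
  have "(\<Sum>x\<in>{g, g'}. chains x w) \<le> chains f (m # w)"
    unfolding chains.simps using g by (intro sum_mono2 finite_strips[OF f]) auto
  then show ?thesis using g by simp
qed

lemma chains_ge_strip:
  assumes f: "f \<in> shapes" and g: "g \<in> strips f m"
  shows "chains g w \<le> chains f (m # w)"
  using member_le_sum[of g "strips f m" "\<lambda>g. chains g w"] finite_strips[OF f] g by simp

section \<open>Strict positions, descents and violations\<close>

definition strict :: "(nat \<Rightarrow> nat \<Rightarrow> nat) \<Rightarrow> nat list \<Rightarrow> nat \<Rightarrow> bool" where
  "strict f w k \<longleftrightarrow> top_sum w k < rows f k"

text \<open>Row \<open>p\<close> loses one box more and row \<open>q\<close> one fewer. The prefix
  sums drop by one exactly for \<open>p < k \<le> q\<close>, and strictness there keeps the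
  dominance criterion satisfied.\<close>

lemma exchange:
  assumes f: "f \<in> shapes" and g: "g \<in> strips f m" "chains g w > 0"
    and pq: "p < q" "row f (Suc p) < row g p" "row g q < row f q"
    and st: "\<And>k. p < k \<Longrightarrow> k \<le> q \<Longrightarrow> strict g w k"
  shows "chains f (m # w) \<ge> 2"
proof -
  define \<rho> where "\<rho> = (row g)(p := row g p - 1, q := Suc (row g q))"
  have gs: "g \<in> shapes" by (rule strip_shape[OF f g(1)])
  have P: "(\<Sum>i<k. \<rho> i) + (if p < k \<and> k \<le> q then 1 else 0) = rows g k" for k
  proof (induction k)
    case (Suc k)
    then show ?case using pq by (auto simp: \<rho>_def rows_Suc split: if_splits)
  qed simp
  have "q < R" using pq row_outside[OF f, of q] by (metis not_le less_nat_zero_code)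
  then have tot: "(\<Sum>i<R. \<rho> i) = rows g R" using P[of R] by simp
  have "row f (Suc i) \<le> \<rho> i \<and> \<rho> i \<le> row f i" for i
    using strip_row_le[OF g(1), of i] strip_row_ge[OF g(1), of i] pq by (auto simp: \<rho>_def)
  then obtain g' where g': "g' \<in> strips f m" "\<And>i. row g' i = \<rho> i"
    using strip_exists[of f \<rho> m] f tot strip_total[OF g(1)] by metis
  have rg': "rows g' k = (\<Sum>i<k. \<rho> i)" for k by (simp add: rows_def g')
  have "top_sum w k \<le> rows g' k" for k
    using P[of k] st[of k] g(2) chains_pos_iff[OF gs] unfolding rg' strict_def
    by (auto split: if_splits)
  moreover have "rows g' R = sum_list w" using g(2) chains_pos_iff[OF gs] tot rg' by simp
  ultimately have "chains g' w > 0" using chains_pos_iff[OF strip_shape[OF f g'(1)]] by simp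
  moreover have "g \<noteq> g'" using g'(2)[of q] by (auto simp: \<rho>_def)
  ultimately show ?thesis using chains_ge2 f g g' by blast
qed


text \<open>Rows are counted from \<open>0\<close>, so this compares the rows \<open>k\<close> and \<open>k + 1\<close> of the informal
  numbering; for \<open>k = 0\<close> it is false, since the subtraction is truncated.\<close>

definition desc :: "(nat \<Rightarrow> nat \<Rightarrow> nat) \<Rightarrow> nat \<Rightarrow> nat \<Rightarrow> bool" where
  "desc f j k \<longleftrightarrow> f j k < f j (k - 1)"

text \<open>Pairs of indices are compared, not rows, so two partitions that descend at the same row
  already count as two descents.\<close>

definition viol :: "(nat \<Rightarrow> nat \<Rightarrow> nat) \<Rightarrow> nat list \<Rightarrow> bool" where
  "viol f w \<longleftrightarrow>
     (\<exists>j b j' a. (j, b) \<noteq> (j', a) \<and> b \<le> a \<and> desc f j b \<and> desc f j' a \<and> (\<forall>k\<in>{b..a}. strict f w k)) \<or>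
     (\<exists>j k. desc f j k \<and> strict f w (k - 1) \<and> strict f w k \<and> strict f w (Suc k))"

lemma viol1: "desc f j b \<Longrightarrow> desc f j' a \<Longrightarrow> b \<le> a \<Longrightarrow> (j, b) \<noteq> (j', a) \<Longrightarrow>
    (\<And>k. b \<le> k \<Longrightarrow> k \<le> a \<Longrightarrow> strict f w k) \<Longrightarrow> viol f w"
  unfolding viol_def by (intro disjI1 exI[of _ j] exI[of _ b] exI[of _ j'] exI[of _ a]) auto

lemma viol2: "desc f j k \<Longrightarrow> strict f w (k - 1) \<Longrightarrow> strict f w k \<Longrightarrow> strict f w (Suc k) \<Longrightarrow> viol f w"
  unfolding viol_def by blast

lemma not_strict_0 [simp]: "\<not> strict f w 0"
  by (simp add: strict_def)

lemma desc_pos: "desc f j k \<Longrightarrow> 0 < k"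
  by (cases k) (auto simp: desc_def)

lemma desc_less_r: "f \<in> shapes \<Longrightarrow> desc f j k \<Longrightarrow> j < r"
  using shapes_outside[of f j "k - 1"] by (auto simp: desc_def not_le[symmetric])

lemma desc_row: assumes f: "f \<in> shapes" and d: "desc f j k" shows "row f k < row f (k - 1)"
  unfolding row_def
proof (rule sum_strict_mono_ex1)
  show "\<forall>j\<in>{..<r}. f j k \<le> f j (k - 1)" using shapes_antimono[OF f, of "k - 1" k] by simp
  show "\<exists>j\<in>{..<r}. f j k < f j (k - 1)" using d desc_less_r[OF f d] by (auto simp: desc_def)
qed simp

lemma row_less_imp_less:
  assumes "row f i < row g i'" obtains j where "j < r" "f j i < g j i'"
proof -
  have "\<not> (\<forall>j<r. g j i' \<le> f j i)"
  proof
    assume "\<forall>j<r. g j i' \<le> f j i"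
    then have "row g i' \<le> row f i" unfolding row_def by (intro sum_mono) simp
    then show False using assms by simp
  qed
  then show ?thesis using that by (auto simp: not_le)
qed

lemma strip_eq_if_row_eq:
  assumes f: "f \<in> shapes" and g: "g \<in> strips f m"
  shows "row g i = row f i \<Longrightarrow> g j i = f j i"
    and "row g i = row f (Suc i) \<Longrightarrow> g j i = f j (Suc i)"
proof -
  have out: "j \<ge> r \<Longrightarrow> g j i = 0 \<and> f j i = 0 \<and> f j (Suc i) = 0"
    using shapes_outside[OF strip_shape[OF f g]] shapes_outside[OF f] by blast
  show "g j i = f j i" if "row g i = row f i"
    using sum_mono_inv[of "\<lambda>j. g j i" "{..<r}" "\<lambda>j. f j i" j] that strip_le[OF g] out
    by (cases "j < r") (auto simp: row_def)
  show "g j i = f j (Suc i)" if "row g i = row f (Suc i)"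
    using sum_mono_inv[of "\<lambda>j. f j (Suc i)" "{..<r}" "\<lambda>j. g j i" j] that strip_ge[OF g] out
    by (cases "j < r") (auto simp: row_def)
qed

text \<open>If position \<open>k\<close> were tight, a row of at most \<open>m\<close> boxes could
  not exceed the \<open>m\<close> contributed by one more letter, so position \<open>k + 1\<close>
  would be tight too.\<close>

lemma row_strict:
  assumes f: "f \<in> shapes" and pos: "\<And>k. top_sum (m # w) k \<le> rows f k"
    and min: "\<forall>x\<in>set w. m \<le> x" and k: "k \<le> length w" "strict f (m # w) (Suc k)" "row f k \<le> m"
  shows "strict f (m # w) k"
proof (rule ccontr)
  assume "\<not> strict f (m # w) k"
  then have "rows f k = top_sum w k"
    using pos[of k] top_sum_Cons_min[OF min k(1)] by (simp add: strict_def)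
  then show False using k(2,3) by (simp add: strict_def rows_Suc)
qed

text \<open>Induction along the greedy strip \<open>g\<close> of a least letter. Either
  \<open>g\<close> has a violation, or the violation of \<open>f\<close> yields a second strip. What
  happens depends on the threshold row \<open>h\<close>: rows before it are unchanged, rows after it
  are shifted up by one.\<close>

theorem chains_ge2_if_viol:
  "f \<in> shapes \<Longrightarrow> sorted w \<Longrightarrow> chains f w > 0 \<Longrightarrow> viol f w \<Longrightarrow> chains f w \<ge> 2"
proof (induction w arbitrary: f)
  case Nil
  then have "\<not> strict f [] k" for k
    using chains_pos_iff[of f "[]"] rows_le_total[of f k] by (simp add: strict_def)
  then show ?case using Nil.prems(4) by (auto simp: viol_def)
next
  case (Cons m w)
  note f = \<open>f \<in> shapes\<close>
  let ?S = "strict f (m # w)"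
  have min: "\<forall>x\<in>set w. m \<le> x" and sw: "sorted w" using Cons.prems(2) by auto
  have tot: "rows f R = m + sum_list w" and pos: "top_sum (m # w) k \<le> rows f k" for k
    using Cons.prems(3) unfolding chains_pos_iff[OF f] by auto
  show ?case
  proof (cases "m = 0")
    case True
    then have g: "f \<in> strips f m" by (auto simp: strips_def shapes_dec[OF f])
    have eq: "top_sum (m # w) k = top_sum w k" for k
      using True top_sum_mono_Suc[of w "k - 1"] by (cases k) auto
    then have "chains f w > 0" using chains_pos_iff[OF f] tot pos True by simp
    moreover have "strict f (m # w) = strict f w" unfolding fun_eq_iff strict_def eq by simp
    then have "viol f w" using Cons.prems(4) unfolding viol_def by simp
    ultimately show ?thesis using Cons.IH[OF f sw] chains_ge_strip[OF f g, of w] by simp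
  next
    case False
    have "m \<le> row f 0" using pos[of 1] by (simp add: rows_Suc)
    then obtain h where h: "row f (Suc h) < m" "m \<le> row f h"
      using threshold_exists f False by blast
    obtain g where g: "g \<in> strips f m" "\<And>i. i < h \<Longrightarrow> row g i = row f i"
      "row g h = row f h + row f (Suc h) - m" "\<And>i. h < i \<Longrightarrow> row g i = row f (Suc i)"
      "\<And>k. k \<le> h \<Longrightarrow> rows g k = rows f k" "\<And>k. h < k \<Longrightarrow> rows g k + m = rows f (Suc k)"
      using greedy_strip[OF f h] by metis
    have gs: "g \<in> shapes" by (rule strip_shape[OF f g(1)])
    have gtot: "rows g R = sum_list w" using strip_total[OF g(1)] tot by simp
    have gpos: "top_sum w k \<le> rows g k" for k
    proof (cases "k \<le> h")
      case True
      then show ?thesis using g(5)[of k] pos[of k] by (cases k) auto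
    next
      case False
      then show ?thesis using g(6)[of k] pos[of "Suc k"] by auto
    qed
    have gch: "chains g w > 0" using chains_pos_iff[OF gs] gtot gpos by simp
    have g1: "g j i = f j i" if "i < h" for j i using strip_eq_if_row_eq(1)[OF f g(1)] g(2) that by blast
    have g2: "g j i = f j (Suc i)" if "h < i" for j i
      using strip_eq_if_row_eq(2)[OF f g(1)] g(4) that by blast
    have eq: "top_sum (m # w) k = top_sum w k" if "k \<le> length w" for k
      using top_sum_Cons_min[OF min that] .
    have S_le: "k \<le> length w" if "?S k" for k
    proof (rule ccontr)
      assume "\<not> k \<le> length w"
      then have "top_sum (m # w) k = m + sum_list w" by (simp add: top_sum_full)
      then show False using that rows_le_total[OF f, of k] tot by (simp add: strict_def)
    qed
    have hl: "h \<le> length w"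
    proof (rule ccontr)
      assume "\<not> h \<le> length w"
      then have "rows f h \<ge> rows f R" using pos[of h] tot by (simp add: top_sum_full)
      then show False using rows_le_total[OF f, of "Suc h"] h False by (simp add: rows_Suc)
    qed
    \<comment> \<open>Rows after \<open>h\<close> have at most \<open>m - 1\<close> boxes, and by
      dominance the shape has at most \<open>length w + 1\<close> nonempty rows, of which at most
      \<open>d\<close> lie beyond the first \<open>k\<close>.\<close>
    have rows_tail: "rows f R \<le> rows f k + d * (m - 1)" if "h < k" "k + d = Suc (length w)" for k d
    proof -
      have "rows f (k + e) \<le> rows f k + e * (m - 1)" for e
      proof (induction e)
        case (Suc e)
        have "row f (k + e) \<le> row f (Suc h)" using that(1) by (intro row_antimono[OF f]) simp
        then show ?case using Suc h(1) by (simp add: rows_Suc)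
      qed simp
      from this[of d] show ?thesis using that(2) pos[of "k + d"] tot by (simp add: top_sum_full)
    qed
    \<comment> \<open>The \<open>d + 1\<close> rows from \<open>k\<close> on hold at most
      \<open>m - 1\<close> boxes each, while the \<open>d + 1\<close> letters of
      \<open>m # w\<close> outside the \<open>k\<close> largest have multiplicity at least
      \<open>m\<close>.\<close>
    have strict_high: "?S k" if k: "h < k" "k \<le> length w" for k
    proof -
      define d where "d = length w - k"
      have "rows f R \<le> rows f k + Suc d * (m - 1)" using k by (intro rows_tail) (auto simp: d_def)
      moreover have "top_sum w k + d * m \<le> sum_list w" using top_sum_tail[OF min k(2)] by (simp add: d_def)
      moreover have "Suc d * m = Suc d * (m - 1) + Suc d" using False by (cases m) auto
      ultimately show ?thesis using tot eq[OF k(2)] by (simp add: strict_def)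
    qed
    have gstrict_high: "strict g w k" if k: "h < k" "k < length w" for k
    proof -
      define d where "d = length w - k"
      have "rows f R \<le> rows f (Suc k) + d * (m - 1)" using k by (intro rows_tail) (auto simp: d_def)
      moreover have "top_sum w k + d * m \<le> sum_list w" using top_sum_tail[OF min, of k] k by (simp add: d_def)
      moreover have "d * m = d * (m - 1) + d" "0 < d" using False k by (cases m; simp add: d_def)+
      ultimately show ?thesis using tot g(6)[OF k(1)] by (simp add: strict_def)
    qed
    \<comment> \<open>Up to \<open>h\<close> neither side changes: \<open>g\<close> keeps these
      prefix sums, and the removed letter is a least one.\<close>
    have gstrict: "strict g w k" if "?S k" "k < length w" for k
    proof (cases "k \<le> h")
      case True
      then show ?thesis using that g(5)[of k] eq[of k] by (simp add: strict_def)
    next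
      case False
      then show ?thesis using gstrict_high that by simp
    qed
    have desc_low: "desc g j k" if "desc f j k" "k \<le> h" for j k
    proof -
      have "g j (k - 1) = f j (k - 1)" using g1 that desc_pos[OF that(1)] by simp
      then show ?thesis using that(1) strip_le[OF g(1), of j k] by (simp add: desc_def)
    qed
    have done_if: "chains f (m # w) \<ge> 2" if "viol g w"
      using Cons.IH[OF gs sw gch that] chains_ge_strip[OF f g(1), of w] by simp
    show ?thesis
    \<comment> \<open>In this extreme case position \<open>h\<close> itself is tight, so all strict
      positions are smaller than \<open>h\<close> and the violation persists in
      \<open>g\<close>.\<close>
    proof (cases "h = length w")
      case True
      have "\<not> ?S (length w)"
      proof -
        have "rows f h + m \<le> rows f R"
          using h(2) rows_le_total[OF f, of "Suc h"] by (simp add: rows_Suc)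
        then show ?thesis using True tot eq[of h] by (simp add: strict_def top_sum_full)
      qed
      then have *: "k < h" if "?S k" for k using S_le[OF that] that True by (metis le_neq_implies_less)
      from Cons.prems(4) have "viol g w" unfolding viol_def[of f]
      proof (elim disjE exE conjE)
        fix j b j' a assume A: "(j, b) \<noteq> (j', a)" "b \<le> a" "desc f j b" "desc f j' a" "\<forall>k\<in>{b..a}. ?S k"
        then show ?thesis
          using *[of a] True gstrict by (intro viol1[of g j b j' a] desc_low) auto
      next
        fix j k assume "desc f j k" "?S (k - 1)" "?S k" "?S (Suc k)"
        then show ?thesis using * True gstrict by (intro viol2[of g j k] desc_low) (auto intro: less_imp_le)
      qed
      then show ?thesis by (rule done_if)
    next
      case False
      then have hl: "h < length w" using hl by simp
      have Sh: "?S (Suc h)" using strict_high hl by simp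
      \<comment> \<open>The greedy strip takes a box from row \<open>h\<close> and none from row
        \<open>b - 1\<close>, where the descent would allow one; these two can be traded.\<close>
      have E1: "chains f (m # w) \<ge> 2" if b: "desc f j b" "b \<le> h" "\<And>k. b \<le> k \<Longrightarrow> k \<le> h \<Longrightarrow> ?S k" for j b
      proof (rule exchange[OF f g(1) gch, of "b - 1" h])
        show "b - 1 < h" using b(2) desc_pos[OF b(1)] by simp
        show "row f (Suc (b - 1)) < row g (b - 1)"
          using desc_row[OF f b(1)] g(2)[of "b - 1"] b(2) desc_pos[OF b(1)] by simp
        show "row g h < row f h" using g(3) h by simp
        show "strict g w k" if "b - 1 < k" "k \<le> h" for k using b(3)[of k] gstrict[of k] that hl by simp
      qed
      \<comment> \<open>Boundary case of the threshold: the strip takes all it can from row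
        \<open>h\<close> too, so \<open>g\<close> is \<open>f\<close> shifted up from row
        \<open>h\<close> on.\<close>
      have full: "\<And>j i. h \<le> i \<Longrightarrow> g j i = f j (Suc i)" "?S h" "0 < h" if "m = row f h"
      proof -
        show "g j i = f j (Suc i)" if "h \<le> i" for j i
          using g2[of i j] strip_eq_if_row_eq(2)[OF f g(1), of h j] g(3) \<open>m = row f h\<close> that
          by (cases "h = i") auto
        show "?S h" using row_strict[OF f pos min _ Sh] hl that by simp
        then show "0 < h" by (cases h) auto
      qed
      have full_desc: "desc g j (k - 1)" if "m = row f h" "desc f j k" "h < k" for j k
      proof (cases "k = Suc h")
        case True
        have "f j h \<le> f j (h - 1)" by (intro shapes_antimono[OF f]) simp
        then show ?thesis using that(2) True full(1)[OF that(1), of h j] full(3)[OF that(1)] g1[of "h - 1" j]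
          by (simp add: desc_def)
      next
        case False
        then show ?thesis using that full(1)[OF that(1), of "k - 1" j] full(1)[OF that(1), of "k - 2" j]
          by (simp add: desc_def numeral_2_eq_2 Suc_diff_Suc)
      qed
      have V1: "chains f (m # w) \<ge> 2" if A: "(j, b) \<noteq> (j', a)" "b \<le> a" "desc f j b" "desc f j' a"
        "\<And>k. b \<le> k \<Longrightarrow> k \<le> a \<Longrightarrow> ?S k" for j b j' a
      proof -
        have al: "a \<le> length w" using S_le A(2,5) by simp
        \<comment> \<open>The descents are located relative to the threshold row. In the last case
          both are at \<open>h + 1\<close>, in different partitions, so there are no two rows to
          trade between.\<close>
        consider "a \<le> h" | "b \<le> h" "h < a" | "h < b" "m = row f h" | "h < b" "m < row f h" "Suc h < a"
          | "b = Suc h" "a = Suc h" "m < row f h"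
          using A(2) h(2) by linarith
        then show ?thesis
        proof cases
          case 1
          then show ?thesis using A hl gstrict
            by (intro done_if viol1[of g j b j' a] desc_low) auto
        next
          case 2
          then show ?thesis using A by (intro E1[of j b]) auto
        next
          case 3
          have "?S k" if "b - 1 \<le> k" "k \<le> a - 1" for k
            using that full(2)[OF 3(2)] strict_high[of k] 3(1) al by (cases "k = h") auto
          moreover have "(j, b - 1) \<noteq> (j', a - 1)" using A(1,2) 3(1) by auto
          ultimately show ?thesis using A 3 gstrict al full_desc
            by (intro done_if viol1[of g j "b - 1" j' "a - 1"]) auto
        next
          case 4
          show ?thesis
          proof (rule exchange[OF f g(1) gch, of h "a - 1"])
            show "row f (Suc h) < row g h" using 4 g(3) by simp
            show "row g (a - 1) < row f (a - 1)" using desc_row[OF f A(4)] g(4)[of "a - 1"] 4 by simp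
          qed (use 4 al gstrict_high in auto)
        next
          case 5
          have lt: "f j (Suc h) < f j h" "f j' (Suc h) < f j' h" "j \<noteq> j'" using A 5 by (auto simp: desc_def)
          have b: "(\<Sum>j<r. f j (Suc h)) < row g h" "row g h < (\<Sum>j<r. f j h)"
            using g(3) 5 h(1) unfolding row_def by linarith+
          \<comment> \<open>The total of row \<open>h\<close> lies strictly between its bounds and
            two partitions leave room, so the row can be distributed in two ways. The row totals,
            and with them dominance, stay the same.\<close>
          obtain v v' where v: "v \<noteq> v'" "\<forall>j. f j (Suc h) \<le> v j \<and> v j \<le> f j h" "(\<Sum>j<r. v j) = row g h"
            "\<forall>j. f j (Suc h) \<le> v' j \<and> v' j \<le> f j h" "(\<Sum>j<r. v' j) = row g h"
            using choose_between_two[of "\<lambda>j. f j (Suc h)" "\<lambda>j. f j h", OF shapes_dec[OF f] b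
              desc_less_r[OF f A(3)] desc_less_r[OF f A(4)] lt(3,1,2)] by blast
          define G where "G u = (\<lambda>j i. if i = h then u j else g j i)" for u :: "nat \<Rightarrow> nat"
          have G: "G u \<in> strips f m" "chains (G u) w > 0"
            if u: "\<forall>j. f j (Suc h) \<le> u j \<and> u j \<le> f j h" "(\<Sum>j<r. u j) = row g h" for u
          proof -
            have "row (G u) i = row g i" for i using u(2) by (cases "i = h") (simp_all add: row_def G_def)
            then have rG: "rows (G u) = rows g" by (simp add: rows_def fun_eq_iff)
            then show *: "G u \<in> strips f m" using u(1) g(1) by (auto simp: strips_def G_def)
            show "chains (G u) w > 0"
              using chains_pos_iff[OF strip_shape[OF f *]] rG gtot gpos by simp
          qed
          have "G v \<noteq> G v'"
          proof
            assume "G v = G v'"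
            then have "G v j h = G v' j h" for j by simp
            then show False using v(1) by (auto simp: G_def)
          qed
          then show ?thesis using chains_ge2[OF f G(1)[OF v(2,3)] G(1)[OF v(4,5)]] G(2)[OF v(2,3)] G(2)[OF v(4,5)] by simp
        qed
      qed
      from Cons.prems(4) show ?thesis unfolding viol_def
      proof (elim disjE exE conjE)
        fix j b j' a assume "(j, b) \<noteq> (j', a)" "b \<le> a" "desc f j b" "desc f j' a" "\<forall>k\<in>{b..a}. ?S k"
        then show ?thesis by (intro V1[of j b j' a]) auto
      next
        fix j k assume A: "desc f j k" "?S (k - 1)" "?S k" "?S (Suc k)"
        have kl: "Suc k \<le> length w" using S_le A(4) by simp
        consider "k < h" | "k = h" | "k = Suc h" "m < row f h" | "k = Suc h" "m = row f h" | "Suc h < k"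
          using h(2) by linarith
        then show ?thesis
        proof cases
          case 1
          then show ?thesis using A hl gstrict by (intro done_if viol2[of g j k] desc_low) auto
        next
          case 2
          then show ?thesis using A by (intro E1[of j k]) auto
        next
          case 3
          \<comment> \<open>Here the single descent splits: row \<open>h\<close> of \<open>g\<close>
            lies strictly between the rows \<open>h + 1\<close> and \<open>h\<close> of
            \<open>f\<close>, which creates descents of \<open>g\<close> at \<open>h + 1\<close> and
            at \<open>h\<close>.\<close>
          have "row f (Suc h) < row g h" using g(3) 3 by simp
          then obtain j1 where j1: "f j1 (Suc h) < g j1 h" by (rule row_less_imp_less)
          have "row g h < row f h" using g(3) h by simp
          then obtain j2 where j2: "g j2 h < f j2 h" by (rule row_less_imp_less)
          have Sh: "?S h" using A(2) 3 by simp
          then have h0: "0 < h" by (cases h) auto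
          have "desc g j1 (Suc h)" using j1 strip_le[OF g(1), of j1 "Suc h"] by (simp add: desc_def)
          moreover have "desc g j2 h"
            using j2 h0 g1[of "h - 1" j2] shapes_antimono[OF f, of "h - 1" h j2] by (simp add: desc_def)
          moreover have "strict g w i" if "h \<le> i" "i \<le> Suc h" for i
          proof -
            have "i = h \<or> i = Suc h" using that by linarith
            then show ?thesis using gstrict[of i] Sh A(3) 3 kl by auto
          qed
          ultimately show ?thesis by (intro done_if viol1[of g j2 h j1 "Suc h"]) auto
        next
          case 4
          have Sh: "?S h" and h0: "0 < h" using full 4 by auto
          show ?thesis
          \<comment> \<open>The descent moves to position \<open>h\<close> of \<open>g\<close>,
            where it needs \<open>h - 1\<close> to be strict. If \<open>h - 1\<close> is tight,
            \<open>row_strict\<close> forces row \<open>h - 1\<close> to exceed row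
            \<open>h\<close>, and \<open>f\<close> has a descent at \<open>h\<close> for an
            exchange.\<close>
          proof (cases "?S (h - 1)")
            case True
            then show ?thesis using full_desc[OF 4(2) A(1)] 4 A(3) Sh gstrict kl
              by (intro done_if viol2[of g j h]) auto
          next
            case False
            have "\<not> row f (h - 1) \<le> m"
              using row_strict[OF f pos min, of "h - 1"] Sh h0 hl False by (auto simp: less_imp_diff_less less_imp_le)
            then have "row f h < row f (h - 1)" using 4 by simp
            then obtain j1 where "f j1 h < f j1 (h - 1)" by (rule row_less_imp_less)
            then have "desc f j1 h" by (simp add: desc_def)
            then show ?thesis using Sh by (intro E1[of j1 h]) auto
          qed
        next
          case 5
          \<comment> \<open>The threshold itself forces a descent at \<open>h + 1\<close>, which is
            paired with the given one.\<close>
          have "row f (Suc h) < row f h" using h by simp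
          then obtain j0 where "f j0 (Suc h) < f j0 h" by (rule row_less_imp_less)
          then have "desc f j0 (Suc h)" by (simp add: desc_def)
          then show ?thesis using A 5 strict_high kl by (intro V1[of j0 "Suc h" j k]) auto
        qed
      qed
    qed
  qed
qed


section \<open>Uniqueness in the absence of violations\<close>

lemma shape_le_eq:
  assumes f: "f \<in> shapes" and g: "g \<in> shapes" and le: "\<And>j i. g j i \<le> f j i" and eq: "rows g R = rows f R"
  shows "g = f"
proof (intro ext)
  fix j i
  show "g j i = f j i"
  proof (cases "j < r \<and> i < R")
    case True
    have "row g i \<le> row f i" for i unfolding row_def by (intro sum_mono le)
    then have "row g i = row f i"
      using sum_mono_inv[of "row g" "{..<R}" "row f" i] eq True by (simp add: rows_def)
    then show ?thesis
      using sum_mono_inv[of "\<lambda>j. g j i" "{..<r}" "\<lambda>j. f j i" j] le True by (simp add: row_def)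
  qed (use shapes_outside[OF f] shapes_outside[OF g] in \<open>auto simp: not_less\<close>)
qed

text \<open>Let \<open>s\<close> be the last tight position up to the number \<open>?l\<close> of
  remaining letters. A strip that can be completed leaves the rows before \<open>s\<close> alone,
  empties the rows from \<open>?l\<close> on, and can vary only at descents after \<open>s\<close>.
  Without a violation there is at most one, and the size of the strip determines the entry there. It
  remains to see that the smaller shape has no violation either.\<close>

theorem chains_le1_if_not_viol:
  "f \<in> shapes \<Longrightarrow> sorted w \<Longrightarrow> \<not> viol f w \<Longrightarrow> chains f w \<le> 1"
proof (induction w arbitrary: f)
  case (Cons m w)
  note f = \<open>f \<in> shapes\<close>
  let ?S = "strict f (m # w)"
  let ?l = "length w"
  have min: "\<forall>x\<in>set w. m \<le> x" and sw: "sorted w" using Cons.prems(2) by auto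
  show ?case
  proof (cases "chains f (m # w) = 0")
    case False
    then have pos: "top_sum (m # w) k \<le> rows f k" for k
      unfolding neq0_conv chains_pos_iff[OF f] by auto
    have eq: "top_sum (m # w) k = top_sum w k" if "k \<le> ?l" for k
      using top_sum_Cons_min[OF min that] .
    define P where "P s \<longleftrightarrow> (\<forall>k. s \<le> k \<longrightarrow> k \<le> ?l \<longrightarrow> ?S k)" for s
    have "P (Suc ?l)" "\<not> P 0" using not_strict_0 by (auto simp: P_def)
    then obtain s where P: "\<not> P s" "P (Suc s)" using ex_least_nat_less[of P "Suc ?l"] by blast
    then obtain k where k: "s \<le> k" "k \<le> ?l" "\<not> ?S k" unfolding P_def by blast
    have s: "\<And>k. Suc s \<le> k \<Longrightarrow> k \<le> ?l \<Longrightarrow> ?S k" using P(2) by (simp add: P_def)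
    then have "k = s" using k by (metis le_antisym not_less_eq_eq)
    then have s: "\<And>k. Suc s \<le> k \<Longrightarrow> k \<le> ?l \<Longrightarrow> ?S k" "s \<le> ?l" "\<not> ?S s" using s k by auto
    have uniq_desc: "j = j' \<and> k = k'" if "desc f j k" "s < k" "k \<le> ?l" "desc f j' k'" "s < k'" "k' \<le> ?l" for j k j' k'
    proof (rule ccontr)
      assume ne: "\<not> (j = j' \<and> k = k')"
      have "viol f (m # w)"
      proof (cases "k \<le> k'")
        case True
        then show ?thesis using that ne s(1) by (intro viol1[of f j k j' k']) auto
      next
        case False
        then show ?thesis using that ne s(1) by (intro viol1[of f j' k' j k]) auto
      qed
      then show False using Cons.prems(3) by simp
    qed
    have good: "(i < s \<longrightarrow> g j i = f j i) \<and> (?l \<le> i \<longrightarrow> g j i = 0) \<and>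
        (\<not> desc f j (Suc i) \<longrightarrow> g j i = f j i)"
      if g: "g \<in> strips f m" "chains g w > 0" for g j i
    proof (intro conjI impI)
      have gp: "rows g R = sum_list w" "\<And>k. top_sum w k \<le> rows g k"
        using g(2) chains_pos_iff[OF strip_shape[OF f g(1)]] by auto
      show "g j i = f j i" if "i < s"
      proof -
        have "rows f s \<le> rows g s" using gp(2)[of s] s(2,3) eq[of s] by (simp add: strict_def)
        then have "(\<Sum>i<s. row g i) = (\<Sum>i<s. row f i)"
          using strip_rows_le[OF g(1), of s] by (simp add: rows_def)
        then have "row g i = row f i"
          using sum_mono_inv[of "row g" "{..<s}" "row f" i] strip_row_le[OF g(1)] that by simp
        then show ?thesis by (rule strip_eq_if_row_eq(1)[OF f g(1)])
      qed
      show "g j i = 0" if "?l \<le> i"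
      proof -
        have "rows g R \<le> rows g i" using gp(1) gp(2)[of i] that by (simp add: top_sum_full)
        then have "row g i = 0"
          using rows_le_total[OF strip_shape[OF f g(1)], of "Suc i"] by (simp add: rows_Suc)
        then show ?thesis
          using shapes_outside[OF strip_shape[OF f g(1)], of j i] by (cases "j < r") (auto simp: row_def)
      qed
      show "g j i = f j i" if "\<not> desc f j (Suc i)"
        using that strip_le[OF g(1), of j i] strip_ge[OF g(1), of j i] by (simp add: desc_def)
    qed
    \<comment> \<open>Two such strips differ in at most one entry, hence are comparable, and equal
      totals make them equal.\<close>
    have uniq: "g = g'" if g: "g \<in> strips f m" "chains g w > 0" and g': "g' \<in> strips f m" "chains g' w > 0" for g g'
    proof -
      have eq: "rows g R = rows g' R" using strip_total[OF g(1)] strip_total[OF g'(1)] by simp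
      have diff: "s \<le> i \<and> i < ?l \<and> desc f j (Suc i)" if "g j i \<noteq> g' j i" for j i
        using good[OF g, of i j] good[OF g', of i j] that by (metis not_le)
      then have one: "j = j' \<and> i = i'" if "g j i \<noteq> g' j i" "g j' i' \<noteq> g' j' i'" for j i j' i'
        using uniq_desc[of j "Suc i" j' "Suc i'"] diff[OF that(1)] diff[OF that(2)] by simp
      have "(\<forall>j i. g j i \<le> g' j i) \<or> (\<forall>j i. g' j i \<le> g j i)"
        using one by (metis le_cases order_refl)
      then show ?thesis
        using shape_le_eq[of g g'] shape_le_eq[of g' g] strip_shape[OF f g(1)] strip_shape[OF f g'(1)] eq
        by auto
    qed
    obtain g where g: "g \<in> strips f m" "chains g w > 0" using False chains_Cons_pos[OF f] by blast
    have gs: "g \<in> shapes" by (rule strip_shape[OF f g(1)])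
    have "chains f (m # w) = (\<Sum>x\<in>strips f m. if x = g then chains g w else 0)"
      unfolding chains.simps using uniq g by (intro sum.cong) auto
    also have "\<dots> = chains g w" using g(1) finite_strips[OF f] by simp
    also have "\<dots> \<le> 1"
    proof (rule Cons.IH[OF gs sw])
      have gt: "rows g R = sum_list w" using g(2) chains_pos_iff[OF gs] by auto
      have S': "?S k \<and> k < ?l" if "strict g w k" for k
      proof -
        have "\<not> ?l \<le> k"
          using that rows_le_total[OF gs, of k] gt by (auto simp: strict_def top_sum_full)
        then show ?thesis using that strip_rows_le[OF g(1), of k] eq[of k] by (simp add: strict_def)
      qed
      then have ns: "\<not> strict g w s" using s(3) by blast
      \<comment> \<open>Before \<open>s\<close> the shape is unchanged. After \<open>s\<close>, if
        \<open>f\<close> has no descent at \<open>k\<close>, then a descent of \<open>g\<close> at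
        \<open>k\<close> requires row \<open>k\<close> to have lost a box, which is possible only at
        a descent of \<open>f\<close> at \<open>k + 1\<close>.\<close>
      have D: "k < s \<and> desc f j k \<or> s < k \<and> desc f j k \<or> s < k \<and> desc f j (Suc k)"
        if "strict g w k" "desc g j k" for j k
      proof -
        have "k \<noteq> s" using that(1) ns by blast
        moreover have "desc f j k" if "k < s"
          using that \<open>desc g j k\<close> good[OF g, of k j] good[OF g, of "k - 1" j] by (simp add: desc_def less_imp_diff_less)
        moreover have "desc f j k \<or> desc f j (Suc k)"
          using \<open>desc g j k\<close> desc_pos[OF that(2)] good[OF g, of k j] good[OF g, of "k - 1" j] strip_le[OF g(1), of j "k - 1"]
          by (auto simp: desc_def)
        ultimately show ?thesis by linarith
      qed
      show "\<not> viol g w"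
      proof
        assume "viol g w"
        then have "viol f (m # w)" unfolding viol_def[of g]
        proof (elim disjE exE conjE)
          fix j b j' a assume A: "(j, b) \<noteq> (j', a)" "b \<le> a" "desc g j b" "desc g j' a"
            "\<forall>k\<in>{b..a}. strict g w k"
          have st: "strict g w a" "strict g w b" using A by auto
          show ?thesis
          proof (cases "a < s")
            case True
            then show ?thesis using D[OF st(1) A(4)] D[OF st(2) A(3)] A S'
              by (intro viol1[of f j b j' a]) auto
          next
            case False
            \<comment> \<open>After \<open>s\<close> the shape \<open>f\<close> has one descent
              only, so both descents of \<open>g\<close> stem from it. They lie at consecutive
              positions, and the descent of \<open>f\<close> is at the later one, with strict
              neighbours on both sides.\<close>
            have "\<not> b \<le> s" using A(5) ns False by auto
            then obtain b' a' where *: "b' \<in> {b, Suc b}" "desc f j b'" "a' \<in> {a, Suc a}" "desc f j' a'" "s < b"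
              using D[OF st(1) A(4)] D[OF st(2) A(3)] False A(2) by auto
            then have "j = j' \<and> b' = a'"
              using uniq_desc[of j b' j' a'] S'[OF st(1)] S'[OF st(2)] A(2) by auto
            then have "desc f j a" "a = Suc b" using * A(1,2) by auto
            then show ?thesis using * S'[OF st(1)] S'[OF st(2)] s(1)[of "Suc a"]
              by (intro viol2[of f j a]) auto
          qed
        next
          fix j k assume A: "desc g j k" "strict g w (k - 1)" "strict g w k" "strict g w (Suc k)"
          have "k - 1 \<noteq> s" using A(2) ns by blast
          then consider "desc f j k" | "s < k - 1" "desc f j (Suc k)" using D[OF A(3,1)] by linarith
          then show ?thesis
          proof cases
            case 1
            then show ?thesis using A S' by (intro viol2[of f j k]) auto
          next
            case 2
            then show ?thesis using A S' s(1)[of "Suc (Suc k)"] S'[OF A(4)]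
              by (intro viol2[of f j "Suc k"]) auto
          qed
        qed
        then show False using Cons.prems(3) by simp
      qed
    qed
    finally show ?thesis .
  qed simp
qed simp

end

section \<open>Symmetry in the letters and tableaux\<close>

context box
begin

lemma rows_swap: "rows f R = (\<Sum>j<r. \<Sum>i<R. f j i)"
  unfolding rows_def row_def by (rule sum.swap)

text \<open>\<open>lo i\<close> and \<open>hi (Suc i)\<close> are the maximum and the minimum of the
  same two numbers, so they add up to \<open>f (Suc i) + h i\<close>.\<close>

lemma sum_min_max:
  fixes f h :: "nat \<Rightarrow> nat"
  defines "lo \<equiv> \<lambda>i. max (f (Suc i)) (h i)"
    and "hi \<equiv> \<lambda>i. case i of 0 \<Rightarrow> f 0 | Suc k \<Rightarrow> min (f i) (h k)"
  shows "(\<Sum>i<n. lo i + hi i) + hi n = (\<Sum>i<n. f i + h i) + f n"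
proof (induction n)
  case (Suc n)
  have "lo n + hi (Suc n) = f (Suc n) + h n" by (auto simp: lo_def hi_def)
  then show ?case using Suc by simp
qed (simp add: hi_def)

text \<open>The Bender-Knuth symmetry: between two shapes at distance two, the middle shapes are given by
  independent intervals, and reflecting every interval exchanges the two strip sizes.\<close>

definition lower :: "(nat \<Rightarrow> nat \<Rightarrow> nat) \<Rightarrow> (nat \<Rightarrow> nat \<Rightarrow> nat) \<Rightarrow> nat \<Rightarrow> nat \<Rightarrow> nat" where
  "lower f h j i = max (f j (Suc i)) (h j i)"

definition upper :: "(nat \<Rightarrow> nat \<Rightarrow> nat) \<Rightarrow> (nat \<Rightarrow> nat \<Rightarrow> nat) \<Rightarrow> nat \<Rightarrow> nat \<Rightarrow> nat" where
  "upper f h j i = (case i of 0 \<Rightarrow> f j 0 | Suc k \<Rightarrow> min (f j i) (h j k))"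

definition reflect :: "(nat \<Rightarrow> nat \<Rightarrow> nat) \<Rightarrow> (nat \<Rightarrow> nat \<Rightarrow> nat) \<times> (nat \<Rightarrow> nat \<Rightarrow> nat) \<Rightarrow>
    (nat \<Rightarrow> nat \<Rightarrow> nat) \<times> (nat \<Rightarrow> nat \<Rightarrow> nat)" where
  "reflect f = (\<lambda>(g, h). (\<lambda>j i. lower f h j i + upper f h j i - g j i, h))"

text \<open>The totals of \<open>lower\<close> and \<open>upper\<close> add up to those of
  \<open>f\<close> and \<open>h\<close>. The reflected shape therefore has the total of
  \<open>f\<close> plus that of \<open>h\<close> minus that of \<open>g\<close>, which exchanges
  \<open>a\<close> and \<open>b\<close>.\<close>

lemma reflect_mem:
  assumes f: "f \<in> shapes" and gh: "(g, h) \<in> (SIGMA g:strips f a. strips g b)"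
  shows "reflect f (g, h) \<in> (SIGMA g:strips f b. strips g a)" "reflect f (reflect f (g, h)) = (g, h)"
proof -
  let ?lo = "lower f h" and ?hi = "upper f h"
  have g: "g \<in> strips f a" and h: "h \<in> strips g b" using gh by auto
  define g' where "g' = (\<lambda>j i. ?lo j i + ?hi j i - g j i)"
  have lo: "?lo j i \<le> g j i" for j i
    using strip_ge[OF g] strip_le[OF h] by (simp add: lower_def)
  have hi: "g j i \<le> ?hi j i" for j i
    using strip_le[OF g, of j i] strip_ge[OF h, of j] by (auto simp: upper_def split: nat.splits)
  have g': "?lo j i \<le> g' j i" "g' j i \<le> ?hi j i" for j i
    using lo[of j i] hi[of j i] unfolding g'_def by linarith+
  have gg: "g j i + g' j i = ?lo j i + ?hi j i" for j i
    using lo[of j i] hi[of j i] unfolding g'_def by linarith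
  have "(\<Sum>i<R. ?lo j i + ?hi j i) = (\<Sum>i<R. f j i + h j i)" for j
  proof -
    \<comment> \<open>The boundary terms of the telescoped sum vanish at row
      \<open>R\<close>.\<close>
    have "?hi j R = 0 \<and> f j R = 0" using shapes_outside[OF f, of j R] by (auto simp: upper_def split: nat.splits)
    then show ?thesis
      using sum_min_max[of "f j" "h j" R] by (simp add: lower_def upper_def cong: nat.case_cong)
  qed
  then have "(\<Sum>i<R. g j i) + (\<Sum>i<R. g' j i) = (\<Sum>i<R. f j i) + (\<Sum>i<R. h j i)" for j
    by (simp add: sum.distrib[symmetric] gg)
  then have "rows g R + rows g' R = rows f R + rows h R"
    by (simp add: rows_swap sum.distrib[symmetric])
  then have tot: "rows g' R + b = rows f R" "rows h R + a = rows g' R"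
    using strip_total[OF g] strip_total[OF h] by auto
  have up: "?hi j i \<le> f j i" "?hi j (Suc i) \<le> h j i" for j i
    by (auto simp: upper_def split: nat.splits)
  have down: "f j (Suc i) \<le> ?lo j i" "h j i \<le> ?lo j i" for j i
    by (auto simp: lower_def)
  have "g' \<in> strips f b"
    unfolding strips_def using order_trans[OF down(1) g'(1)] order_trans[OF g'(2) up(1)] tot by blast
  moreover have "h \<in> strips g' a"
    unfolding strips_def using order_trans[OF g'(2) up(2)] order_trans[OF down(2) g'(1)] tot by blast
  moreover have r1: "reflect f (g, h) = (g', h)" by (simp add: reflect_def g'_def)
  ultimately show "reflect f (g, h) \<in> (SIGMA g:strips f b. strips g a)" by simp
  have "?lo j i + ?hi j i - g' j i = g j i" for j i using gg[of j i] by linarith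
  then show "reflect f (reflect f (g, h)) = (g, h)" unfolding r1 by (simp add: reflect_def)
qed

lemma chains_swap: assumes f: "f \<in> shapes" shows "chains f (a # b # w) = chains f (b # a # w)"
proof -
  have eq: "chains f (a # b # w) = (\<Sum>(g, h)\<in>(SIGMA g:strips f a. strips g b). chains h w)" for a b
    unfolding chains.simps using f finite_strips strip_shape by (subst sum.Sigma) auto
  have "(\<Sum>(g, h)\<in>(SIGMA g:strips f a. strips g b). chains h w) =
    (\<Sum>(g, h)\<in>(SIGMA g:strips f b. strips g a). chains h w)"
  proof (rule sum.reindex_bij_witness[of _ "reflect f" "reflect f"])
    fix x assume x: "x \<in> (SIGMA g:strips f b. strips g a)"
    show "reflect f (reflect f x) = x" using reflect_mem(2)[OF f, of "fst x" "snd x" b a] x by simp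
    show "reflect f x \<in> (SIGMA g:strips f a. strips g b)"
      using reflect_mem(1)[OF f, of "fst x" "snd x" b a] x by simp
  next
    fix x assume x: "x \<in> (SIGMA g:strips f a. strips g b)"
    show "reflect f (reflect f x) = x" using reflect_mem(2)[OF f, of "fst x" "snd x" a b] x by simp
    show "reflect f x \<in> (SIGMA g:strips f b. strips g a)"
      using reflect_mem(1)[OF f, of "fst x" "snd x" a b] x by simp
    show "(case reflect f x of (g, h) \<Rightarrow> chains h w) = (case x of (g, h) \<Rightarrow> chains h w)"
      by (simp add: reflect_def split: prod.splits)
  qed
  then show ?thesis unfolding eq .
qed

lemma chains_Cons_cong:
  assumes "f \<in> shapes" "\<And>g. g \<in> shapes \<Longrightarrow> chains g u = chains g v"
  shows "chains f (a # u) = chains f (a # v)"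
  unfolding chains.simps using assms strip_shape by (intro sum.cong) auto

lemma chains_insort: "f \<in> shapes \<Longrightarrow> chains f (insort a w) = chains f (a # w)"
proof (induction w arbitrary: f)
  case (Cons b w)
  show ?case
  proof (cases "a \<le> b")
    case False
    then have "chains f (insort a (b # w)) = chains f (b # insort a w)" by simp
    also have "\<dots> = chains f (b # a # w)" by (rule chains_Cons_cong[OF Cons.prems Cons.IH])
    finally show ?thesis by (simp only: chains_swap[OF Cons.prems])
  qed simp
qed simp

lemma chains_sort: "f \<in> shapes \<Longrightarrow> chains f (sort w) = chains f w"
proof (induction w arbitrary: f)
  case (Cons a w)
  then show ?case using chains_insort[OF Cons.prems, of a "sort w"] chains_Cons_cong[OF Cons.prems Cons.IH]
    by simp
qed simp

section \<open>Tableaux as chains of strips\<close>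

text \<open>A family of tableaux as a function giving the row \<open>i\<close> of tableau \<open>j\<close>.\<close>

definition tableaux :: "(nat \<Rightarrow> nat \<Rightarrow> nat) \<Rightarrow> nat list \<Rightarrow> (nat \<Rightarrow> nat \<Rightarrow> nat list) set" where
  "tableaux f w = {E. (\<forall>j i. length (E j i) = f j i \<and> sorted (E j i) \<and> 0 \<notin> set (E j i)) \<and>
     (\<forall>j i c. c < f j (Suc i) \<longrightarrow> E j i ! c < E j (Suc i) ! c) \<and>
     (\<forall>x\<ge>1. entry w x = (\<Sum>j<r. \<Sum>i<R. count_list (E j i) x))}"

lemma tableaux_entries:
  assumes f: "f \<in> shapes" and E: "E \<in> tableaux f w" and x: "x \<in> set (E j i)"
  shows "1 \<le> x" "x \<le> length w"
proof -
  have len: "length (E j i) = f j i" and "0 \<notin> set (E j i)"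
    and wt: "\<And>x. 1 \<le> x \<Longrightarrow> entry w x = (\<Sum>j<r. \<Sum>i<R. count_list (E j i) x)"
    using E by (auto simp: tableaux_def)
  then show 1: "1 \<le> x" using x by (metis One_nat_def Suc_leI not_gr_zero)
  have ji: "j < r" "i < R" using len x shapes_outside[OF f, of j i] by (auto simp: not_le[symmetric])
  have "entry w x \<noteq> 0"
  proof
    assume "entry w x = 0"
    then have "count_list (E j i) x = 0" using wt[OF 1] ji by simp
    then show False using x by (simp add: count_list_0_iff)
  qed
  then show "x \<le> length w" by (auto simp: entry_def split: if_splits)
qed

lemma sorted_split_max:
  fixes N :: nat
  shows "sorted xs \<Longrightarrow> \<forall>x\<in>set xs. x \<le> N \<Longrightarrow>
    xs = filter (\<lambda>x. x < N) xs @ replicate (length xs - length (filter (\<lambda>x. x < N) xs)) N"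
proof (induction xs)
  case (Cons x xs)
  show ?case
  proof (cases "x < N")
    case False
    then have "\<forall>y\<in>set (x # xs). y = N" using Cons.prems by (auto intro: le_antisym)
    moreover from this have "filter (\<lambda>x. x < N) (x # xs) = []" by (auto simp: filter_empty_conv)
    ultimately show ?thesis by (simp add: replicate_length_same del: filter.simps)
  qed (use Cons in auto)
qed simp

lemma entry_append: "x \<ge> 1 \<Longrightarrow> entry (w @ [m]) x = entry w x + (if x = Suc (length w) then m else 0)"
  by (auto simp: entry_def nth_append)

lemma count_list_replicate: "count_list (replicate n y) x = (if x = y then n else 0)"
  by (induction n) auto

lemma count_list_filter: "count_list (filter P xs) x = (if P x then count_list xs x else 0)"
  by (induction xs) auto

definition extend where
  "extend f N g E = (\<lambda>j i. E j i @ replicate (f j i - g j i) (N :: nat))"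

definition cut :: "nat \<Rightarrow> (nat \<Rightarrow> nat \<Rightarrow> nat list) \<Rightarrow> nat \<Rightarrow> nat \<Rightarrow> nat list" where
  "cut N E = (\<lambda>j i. filter (\<lambda>x. x < N) (E j i))"

lemma rows_diff:
  assumes "g \<in> strips f m" shows "(\<Sum>j<r. \<Sum>i<R. f j i - g j i) = m"
proof -
  have "(\<Sum>j<r. \<Sum>i<R. f j i - g j i) + (\<Sum>j<r. \<Sum>i<R. g j i) = (\<Sum>j<r. \<Sum>i<R. f j i)"
    using strip_le[OF assms] by (simp add: sum.distrib[symmetric])
  then show ?thesis using strip_total[OF assms] by (simp add: rows_swap)
qed

text \<open>By interlacing, a box of row \<open>Suc i\<close> of \<open>f\<close> always has a box
  of \<open>g\<close> above it. So the new largest letter never stands above another entry, and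
  columns stay strict.\<close>

lemma extend_mem:
  assumes f: "f \<in> shapes" and g: "g \<in> strips f m" and E: "E \<in> tableaux g w"
  shows "extend f (Suc (length w)) g E \<in> tableaux f (w @ [m])"
    and "cut (Suc (length w)) (extend f (Suc (length w)) g E) = E"
proof -
  let ?N = "Suc (length w)"
  let ?E = "extend f ?N g E"
  have len: "length (E j i) = g j i" and sor: "sorted (E j i)"
    and col: "\<And>c. c < g j (Suc i) \<Longrightarrow> E j i ! c < E j (Suc i) ! c" for j i
    using E by (auto simp: tableaux_def)
  have wt: "\<And>x. 1 \<le> x \<Longrightarrow> entry w x = (\<Sum>j<r. \<Sum>i<R. count_list (E j i) x)"
    using E by (auto simp: tableaux_def)
  have ent: "1 \<le> x \<and> x < ?N" if "x \<in> set (E j i)" for x j i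
    using tableaux_entries[OF strip_shape[OF f g] E that] by simp
  show "cut ?N ?E = E"
    unfolding cut_def extend_def using ent by (auto simp: fun_eq_iff filter_id_conv)
  have "length (?E j i) = f j i" for j i using len strip_le[OF g] by (simp add: extend_def)
  moreover have "sorted (?E j i)" for j i
    using sor ent by (fastforce simp: extend_def sorted_append sorted_replicate)
  moreover have "0 \<notin> set (?E j i)" for j i using ent by (fastforce simp: extend_def)
  moreover have "?E j i ! c < ?E j (Suc i) ! c" if c: "c < f j (Suc i)" for j i c
  proof -
    have c': "c < g j i" using c strip_ge[OF g, of j i] by simp
    then have 1: "?E j i ! c = E j i ! c" by (simp add: extend_def nth_append len)
    show ?thesis
    proof (cases "c < g j (Suc i)")
      case True
      then show ?thesis using 1 col[OF True] by (simp add: extend_def nth_append len)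
    next
      case False
      then have "?E j (Suc i) ! c = ?N" using c by (simp add: extend_def nth_append len)
      moreover have "E j i ! c \<in> set (E j i)" using c' len by simp
      ultimately show ?thesis using 1 ent by simp
    qed
  qed
  moreover have "entry (w @ [m]) x = (\<Sum>j<r. \<Sum>i<R. count_list (?E j i) x)" if x: "x \<ge> 1" for x
  proof -
    have "(\<Sum>j<r. \<Sum>i<R. count_list (?E j i) x) = (\<Sum>j<r. \<Sum>i<R. count_list (E j i) x) +
      (\<Sum>j<r. \<Sum>i<R. if x = ?N then f j i - g j i else 0)"
      by (simp add: extend_def count_list_append count_list_replicate sum.distrib cong: if_cong)
    also have "\<dots> = entry w x + (if x = ?N then m else 0)" using wt[OF x] rows_diff[OF g] by simp
    finally show ?thesis using entry_append[OF x] by simp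
  qed
  ultimately show "?E \<in> tableaux f (w @ [m])" by (simp add: tableaux_def)
qed

text \<open>In a sorted row the largest letters stand at the end, and two of them in one column
  would contradict strictness. Hence the smaller entries form a shape that interlaces with
  \<open>f\<close>.\<close>

lemma cut_mem:
  assumes f: "f \<in> shapes" and E: "E \<in> tableaux f (w @ [m])"
  defines "N \<equiv> Suc (length w)"
  defines "g \<equiv> \<lambda>j i. length (cut N E j i)"
  shows "g \<in> strips f m" "cut N E \<in> tableaux g w" "extend f N g (cut N E) = E"
proof -
  have len: "length (E j i) = f j i" and sor: "sorted (E j i)" and z: "0 \<notin> set (E j i)"
    and col: "\<And>c. c < f j (Suc i) \<Longrightarrow> E j i ! c < E j (Suc i) ! c" for j i
    using E by (auto simp: tableaux_def)
  have wt: "\<And>x. 1 \<le> x \<Longrightarrow> entry (w @ [m]) x = (\<Sum>j<r. \<Sum>i<R. count_list (E j i) x)"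
    using E by (auto simp: tableaux_def)
  have ent: "x \<le> N" if "x \<in> set (E j i)" for x j i
    using tableaux_entries[OF f E that] by (simp add: N_def)
  have split: "E j i = cut N E j i @ replicate (f j i - g j i) N" for j i
    using sorted_split_max[OF sor[of j i], of N] ent by (simp add: cut_def g_def len)
  then show "extend f N g (cut N E) = E" by (simp add: extend_def fun_eq_iff)
  have pre: "E j i ! c = cut N E j i ! c" if "c < g j i" for j i c
  proof -
    have "E j i ! c = (cut N E j i @ replicate (f j i - g j i) N) ! c" using split[of j i] by simp
    then show ?thesis using that by (simp add: nth_append g_def)
  qed
  have post: "E j i ! c = N" if "g j i \<le> c" "c < f j i" for j i c
  proof -
    have "E j i ! c = (cut N E j i @ replicate (f j i - g j i) N) ! c" using split[of j i] by simp
    then show ?thesis using that by (simp add: nth_append g_def)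
  qed
  have le: "g j i \<le> f j i" for j i unfolding g_def cut_def len[symmetric] by (rule length_filter_le)
  have ge: "f j (Suc i) \<le> g j i" for j i
  proof (rule ccontr)
    assume "\<not> f j (Suc i) \<le> g j i"
    then have c: "g j i < f j (Suc i)" by simp
    then have "g j i < f j i" using shapes_dec[OF f, of j i] by simp
    then have "E j i ! g j i = N" by (intro post) auto
    moreover have "E j (Suc i) ! g j i \<in> set (E j (Suc i))" using c len by simp
    ultimately show False using col[OF c] ent by fastforce
  qed
  have "m = (\<Sum>j<r. \<Sum>i<R. count_list (E j i) N)"
    using wt[of N] by (simp add: N_def entry_def)
  also have "\<dots> = (\<Sum>j<r. \<Sum>i<R. f j i - g j i)"
  proof (intro sum.cong refl)
    fix j i
    have "count_list (E j i) N = count_list (cut N E j i @ replicate (f j i - g j i) N) N"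
      using split[of j i] by simp
    then show "count_list (E j i) N = f j i - g j i"
      by (simp add: count_list_append count_list_replicate cut_def count_list_filter)
  qed
  finally have "rows g R + m = rows f R"
    using le by (simp add: rows_swap sum.distrib[symmetric])
  then show gs: "g \<in> strips f m" using le ge by (simp add: strips_def)
  have "cut N E j i ! c < cut N E j (Suc i) ! c" if c: "c < g j (Suc i)" for j i c
  proof -
    have "c < f j (Suc i)" "c < g j i" using c le[of j "Suc i"] ge[of j i] by linarith+
    then show ?thesis using col[of c j i] pre[of c j i] pre[of c j "Suc i"] c by simp
  qed
  moreover have "entry w x = (\<Sum>j<r. \<Sum>i<R. count_list (cut N E j i) x)" if x: "x \<ge> 1" for x
    using wt[OF x] entry_append[OF x, of w m] by (auto simp: cut_def count_list_filter N_def entry_def)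
  ultimately show "cut N E \<in> tableaux g w"
    using sor z by (auto simp: tableaux_def g_def cut_def sorted_wrt_filter)
qed

text \<open>The tableaux are classified by the shape \<open>g\<close> that remains without the last
  letter; distinct \<open>g\<close> give disjoint classes. The induction appends a letter to
  \<open>w\<close>, whereas \<open>chains\<close> takes it from the front, hence
  \<open>rev\<close>.\<close>

theorem card_tableaux: "f \<in> shapes \<Longrightarrow> finite (tableaux f w) \<and> card (tableaux f w) = chains f (rev w)"
proof (induction w arbitrary: f rule: rev_induct)
  case Nil
  have len: "length (E j i) = f j i" if "E \<in> tableaux f []" for E j i
    using that by (auto simp: tableaux_def)
  have "E j i = []" if "E \<in> tableaux f []" for E j i
  proof -
    have "x \<notin> set (E j i)" for x using tableaux_entries[OF Nil that, of x] by auto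
    then show ?thesis by (cases "E j i") auto
  qed
  then have E: "E = (\<lambda>j i. []) \<and> f = (\<lambda>j i. 0)" if "E \<in> tableaux f []" for E
    using len[OF that] that by (metis (no_types, lifting) ext list.size(3))
  show ?case
  proof (cases "f = (\<lambda>j i. 0)")
    case True
    then have "(\<lambda>j i. []) \<in> tableaux f []" by (auto simp: tableaux_def entry_def)
    then have "tableaux f [] = {\<lambda>j i. []}" using E by blast
    then show ?thesis using True by (simp add: rows_def row_def)
  next
    case False
    then have "tableaux f [] = {}" using E by blast
    moreover have "rows f R \<noteq> 0"
      using shape_le_eq[of f "\<lambda>j i. 0"] Nil False by (auto simp: shapes_def rows_def row_def)
    ultimately show ?thesis by simp
  qed
next
  case (snoc m w)
  note f = \<open>f \<in> shapes\<close>
  let ?N = "Suc (length w)"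
  let ?X = "\<lambda>g. extend f ?N g ` tableaux g w"
  have IH: "finite (tableaux g w)" "card (tableaux g w) = chains g (rev w)" if "g \<in> strips f m" for g
    using snoc.IH[OF strip_shape[OF f that]] by auto
  have eq: "tableaux f (w @ [m]) = (\<Union>g\<in>strips f m. ?X g)"
  proof
    show "tableaux f (w @ [m]) \<subseteq> (\<Union>g\<in>strips f m. ?X g)"
    proof
      fix E assume E: "E \<in> tableaux f (w @ [m])"
      show "E \<in> (\<Union>g\<in>strips f m. ?X g)"
      proof (rule UN_I[OF cut_mem(1)[OF f E]])
        show "E \<in> ?X (\<lambda>j i. length (cut ?N E j i))"
          by (rule image_eqI[where x = "cut ?N E"]) (simp_all only: cut_mem(2,3)[OF f E])
      qed
    qed
    show "(\<Union>g\<in>strips f m. ?X g) \<subseteq> tableaux f (w @ [m])"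
      using extend_mem(1)[OF f] by blast
  qed
  have inj: "inj_on (extend f ?N g) (tableaux g w)" if "g \<in> strips f m" for g
    by (rule inj_on_inverseI[of _ "cut ?N"]) (rule extend_mem(2)[OF f that])
  have "?X g \<inter> ?X g' = {}" if g: "g \<in> strips f m" "g' \<in> strips f m" "g \<noteq> g'" for g g'
  proof -
    have "g = g'" if "E \<in> tableaux g w" "E' \<in> tableaux g' w" "extend f ?N g E = extend f ?N g' E'" for E E'
    proof -
      have "E = E'" using that extend_mem(2)[OF f g(1) that(1)] extend_mem(2)[OF f g(2) that(2)] by simp
      moreover have "length (E j i) = g j i" "length (E' j i) = g' j i" for j i
        using that by (auto simp: tableaux_def)
      ultimately show ?thesis by (metis ext)
    qed
    then show ?thesis using g(3) by blast
  qed
  then have "card (\<Union>g\<in>strips f m. ?X g) = (\<Sum>g\<in>strips f m. card (?X g))"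
    using finite_strips[OF f] IH by (intro card_UN_disjoint) auto
  also have "\<dots> = chains f (rev (w @ [m]))"
    using card_image[OF inj] IH by simp
  finally show ?case using eq finite_strips[OF f] IH by simp
qed

end

section \<open>Families of partitions and the deciding automaton\<close>

definition part :: "nat list list \<Rightarrow> nat \<Rightarrow> nat \<Rightarrow> nat" where
  "part ls j i = (if j < length ls \<and> i < length (ls ! j) then ls ! j ! i else 0)"

text \<open>A common bound on the numbers of rows; as a sum it also makes sense for the empty
  family.\<close>

abbreviation max_rows :: "nat list list \<Rightarrow> nat" where
  "max_rows ls \<equiv> sum_list (map length ls)"

lemma length_le_max_rows: "j < length ls \<Longrightarrow> length (ls ! j) \<le> max_rows ls"
  by (intro member_le_sum_list) auto

lemma part_shapes:
  assumes "\<forall>l\<in>set ls. sorted_wrt (\<ge>) l"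
  shows "part ls \<in> box.shapes (length ls) (max_rows ls)"
proof -
  have "part ls j (Suc i) \<le> part ls j i" for j i
    using assms sorted_wrt_nth_less[of "(\<ge>)" "ls ! j" i "Suc i"] by (auto simp: part_def)
  moreover have "part ls j i = 0" if "length ls \<le> j \<or> max_rows ls \<le> i" for j i
    using that length_le_max_rows[of j ls] by (auto simp: part_def)
  ultimately show ?thesis by (auto simp: box.shapes_def)
qed

lemma count_list_concat: "count_list (concat T) x = (\<Sum>i<length T. count_list (T ! i) x)"
proof -
  have "count_list (concat T) x = sum_list (map (\<lambda>row. count_list row x) T)"
    by (induction T) (auto simp: count_list_append)
  then show ?thesis by (simp add: sum_list_sum_nth atLeast0LessThan)
qed

definition row_function :: "nat list list \<Rightarrow> nat list list list \<Rightarrow> nat \<Rightarrow> nat \<Rightarrow> nat list" where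
  "row_function ls Ts = (\<lambda>j i. if j < length ls \<and> i < length (ls ! j) then Ts ! j ! i else [])"

definition row_lists :: "nat list list \<Rightarrow> (nat \<Rightarrow> nat \<Rightarrow> nat list) \<Rightarrow> nat list list list" where
  "row_lists ls E = map (\<lambda>j. map (E j) [0..<length (ls ! j)]) [0..<length ls]"

lemma multitableaux_length:
  assumes "Ts \<in> multitableaux ls w"
  shows "length Ts = length ls" "j < length ls \<Longrightarrow> length (Ts ! j) = length (ls ! j)"
    "j < length ls \<Longrightarrow> i < length (ls ! j) \<Longrightarrow> length (Ts ! j ! i) = ls ! j ! i"
proof -
  have l: "list_all2 semistandard ls Ts" using assms by (simp add: multitableaux_def)
  then show "length Ts = length ls" by (auto dest: list_all2_lengthD)
  have m: "map length (Ts ! j) = ls ! j" if "j < length ls" for j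
    using list_all2_nthD[OF l that] by (simp add: semistandard_def)
  show 1: "length (Ts ! j) = length (ls ! j)" if "j < length ls"
    using m[OF that] by (metis length_map)
  show "length (Ts ! j ! i) = ls ! j ! i" if "j < length ls" "i < length (ls ! j)"
    using m[OF that(1)] that(2) 1[OF that(1)] by (metis nth_map)
qed

lemma sum_pad_zero:
  fixes a :: "nat \<Rightarrow> nat"
  assumes "n \<le> R" "\<And>i. n \<le> i \<Longrightarrow> a i = 0" shows "(\<Sum>i<R. a i) = (\<Sum>i<n. a i)"
  using assms by (intro sum.mono_neutral_right) auto

lemma weight_row_function:
  assumes "length Ts = length ls" "\<And>j. j < length ls \<Longrightarrow> length (Ts ! j) = length (ls ! j)"
  shows "(\<Sum>T\<leftarrow>Ts. weight T x) = (\<Sum>j<length ls. \<Sum>i<max_rows ls. count_list (row_function ls Ts j i) x)"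
proof -
  have "weight (Ts ! j) x = (\<Sum>i<max_rows ls. count_list (row_function ls Ts j i) x)" if j: "j < length ls" for j
  proof -
    have "(\<Sum>i<max_rows ls. count_list (row_function ls Ts j i) x) =
        (\<Sum>i<length (ls ! j). count_list (row_function ls Ts j i) x)"
      using j length_le_max_rows by (intro sum_pad_zero) (auto simp: row_function_def)
    also have "\<dots> = (\<Sum>i<length (Ts ! j). count_list (Ts ! j ! i) x)"
      using assms(2)[OF j] j by (simp add: row_function_def)
    finally show ?thesis by (simp add: weight_def count_list_concat)
  qed
  then show ?thesis by (simp add: sum_list_sum_nth atLeast0LessThan assms(1))
qed

lemma row_function_mem:
  assumes "Ts \<in> multitableaux ls w"
  shows "row_function ls Ts \<in> box.tableaux (length ls) (max_rows ls) (part ls) w"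
    and "row_lists ls (row_function ls Ts) = Ts"
proof -
  note len = multitableaux_length[OF assms]
  have l: "list_all2 semistandard ls Ts" using assms by (simp add: multitableaux_def)
  have ss: "semistandard (ls ! j) (Ts ! j)" if "j < length ls" for j
    using list_all2_nthD[OF l that] .
  have "Ts ! j ! i \<in> set (Ts ! j)" if "j < length ls" "i < length (ls ! j)" for j i
    using len that by simp
  then have row: "sorted (Ts ! j ! i) \<and> 0 \<notin> set (Ts ! j ! i)" if "j < length ls" "i < length (ls ! j)" for j i
    using ss[OF that(1)] that by (auto simp: semistandard_def)
  have col: "row_function ls Ts j i ! c < row_function ls Ts j (Suc i) ! c"
    if c: "c < part ls j (Suc i)" for j i c
  proof -
    have ji: "j < length ls" "Suc i < length (ls ! j)" using c by (auto simp: part_def split: if_splits)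
    then have "c < length (Ts ! j ! Suc i)" "Suc i < length (Ts ! j)" using c len by (auto simp: part_def)
    then show ?thesis using ss[OF ji(1)] ji by (simp add: semistandard_def row_function_def)
  qed
  have "entry w x = (\<Sum>j<length ls. \<Sum>i<max_rows ls. count_list (row_function ls Ts j i) x)" if "x \<ge> 1" for x
    using assms that weight_row_function[OF len(1,2), of x] by (simp add: multitableaux_def)
  then show "row_function ls Ts \<in> box.tableaux (length ls) (max_rows ls) (part ls) w"
    using row col len by (auto simp: box.tableaux_def row_function_def part_def)
  show "row_lists ls (row_function ls Ts) = Ts"
    using len by (intro nth_equalityI) (auto simp: row_lists_def row_function_def)
qed

lemma row_lists_mem:
  assumes E: "E \<in> box.tableaux (length ls) (max_rows ls) (part ls) w"
  shows "row_lists ls E \<in> multitableaux ls w" "row_function ls (row_lists ls E) = E"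
proof -
  have len: "length (E j i) = part ls j i" and sor: "sorted (E j i)" "0 \<notin> set (E j i)"
    and col: "c < part ls j (Suc i) \<Longrightarrow> E j i ! c < E j (Suc i) ! c" for j i c
    using E by (auto simp: box.tableaux_def)
  have wt: "\<And>x. 1 \<le> x \<Longrightarrow> entry w x = (\<Sum>j<length ls. \<Sum>i<max_rows ls. count_list (E j i) x)"
    using E by (auto simp: box.tableaux_def)
  have "E j i = []" if "\<not> (j < length ls \<and> i < length (ls ! j))" for j i
    using len[of j i] that by (auto simp: part_def)
  then show rf: "row_function ls (row_lists ls E) = E"
    by (auto simp: fun_eq_iff row_function_def row_lists_def)
  have "semistandard (ls ! j) (map (E j) [0..<length (ls ! j)])" if j: "j < length ls" for j
  proof -
    have "map length (map (E j) [0..<length (ls ! j)]) = ls ! j"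
      using j by (intro nth_equalityI) (auto simp: len part_def)
    then show ?thesis using j sor by (auto simp: semistandard_def len intro!: col)
  qed
  then have "list_all2 semistandard ls (row_lists ls E)"
    by (simp add: list_all2_conv_all_nth row_lists_def)
  moreover have "(\<Sum>T\<leftarrow>row_lists ls E. weight T x) = (\<Sum>j<length ls. \<Sum>i<max_rows ls. count_list (E j i) x)" for x
    using weight_row_function[of "row_lists ls E" ls x] rf by (simp add: row_lists_def)
  ultimately show "row_lists ls E \<in> multitableaux ls w" using wt by (simp add: multitableaux_def)
qed

text \<open>\<open>row_function\<close> and \<open>row_lists\<close> translate between lists of rows
  and functions padded with empty rows and are inverse to each other on the two sets.\<close>

lemma kostka_chains:
  assumes "\<forall>l\<in>set ls. sorted_wrt (\<ge>) l"
  shows "kostka ls w = box.chains (length ls) (max_rows ls) (part ls) (rev w)"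
proof -
  have "bij_betw (row_function ls) (multitableaux ls w) (box.tableaux (length ls) (max_rows ls) (part ls) w)"
    using row_function_mem row_lists_mem
    by (intro bij_betw_byWitness[where f' = "row_lists ls"]) blast+
  then show ?thesis
    using box.card_tableaux[OF part_shapes[OF assms]] by (simp add: kostka_def bij_betw_same_card)
qed

text \<open>The automaton of the decision procedure. States: 1, no run of strict inequalities is open;
  2, the open run has no descent; 3, it has one, at its first position; 4, it has one, at the
  current position, which is not the first one; 5, a violation; 6, the dominance test has failed.\<close>

definition transition :: "nat \<Rightarrow> nat \<Rightarrow> nat \<Rightarrow> nat \<Rightarrow> nat" where
  "transition q c d e =
    (if q = 6 \<or> d < e then 6 else if q = 5 then 5 else if d = e then 1
     else if q = 1 then (if c = 0 then 2 else if c = 1 then 3 else 5)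
     else if q = 2 then (if c = 0 then 2 else if c = 1 then 4 else 5)
     else if q = 3 then (if c = 0 then 3 else 5)
     else 5)"

definition heads :: "nat list list \<Rightarrow> nat" where
  "heads ls = (\<Sum>l\<leftarrow>ls. case l of [] \<Rightarrow> 0 | x # _ \<Rightarrow> x)"

text \<open>Parts are positive, so the last entry of a partition is always followed by a descent to
  zero.\<close>

definition drops_at_head :: "nat list \<Rightarrow> bool" where
  "drops_at_head l \<longleftrightarrow> l \<noteq> [] \<and> (tl l = [] \<or> hd (tl l) \<noteq> hd l)"

definition drops :: "nat list list \<Rightarrow> nat" where
  "drops ls = length (filter drops_at_head ls)"

text \<open>One row and one letter are consumed together, so the scan ends with the letters even if
  some shapes have further rows.\<close>

fun scan :: "nat list list \<Rightarrow> nat list \<Rightarrow> nat \<Rightarrow> nat \<Rightarrow> nat \<Rightarrow> nat" where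
  "scan ls [] d e q = q"
| "scan ls (m # w) d e q =
    scan (map tl ls) w (d + heads ls) (e + m) (transition q (drops ls) (d + heads ls) (e + m))"

section \<open>Invariant of the automaton\<close>

context box
begin

text \<open>The violations that are visible after \<open>n\<close> positions; an inner descent at
  \<open>k\<close> is recognised only once \<open>k + 1\<close> has been read.\<close>

definition viol_upto :: "(nat \<Rightarrow> nat \<Rightarrow> nat) \<Rightarrow> nat list \<Rightarrow> nat \<Rightarrow> bool" where
  "viol_upto f w n \<longleftrightarrow>
     (\<exists>j b j' a. (j, b) \<noteq> (j', a) \<and> b \<le> a \<and> a \<le> n \<and> desc f j b \<and> desc f j' a \<and> (\<forall>k\<in>{b..a}. strict f w k)) \<or>
     (\<exists>j k. Suc k \<le> n \<and> desc f j k \<and> strict f w (k - 1) \<and> strict f w k \<and> strict f w (Suc k))"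

text \<open>\<open>s\<close> is the tight position just before the open run, so the run begins at
  \<open>Suc s\<close>.\<close>

definition state_inv :: "(nat \<Rightarrow> nat \<Rightarrow> nat) \<Rightarrow> nat list \<Rightarrow> nat \<Rightarrow> nat \<Rightarrow> bool" where
  "state_inv f w n q \<longleftrightarrow> q = 5 \<and> viol_upto f w n \<or> \<not> viol_upto f w n \<and>
    (q = 1 \<and> \<not> strict f w n \<or>
     (\<exists>s<n. \<not> strict f w s \<and> (\<forall>k. s < k \<longrightarrow> k \<le> n \<longrightarrow> strict f w k) \<and>
       (q = 2 \<and> (\<forall>j k. s < k \<longrightarrow> k \<le> n \<longrightarrow> \<not> desc f j k) \<or>
        q = 3 \<and> (\<exists>j0. \<forall>j k. s < k \<longrightarrow> k \<le> n \<longrightarrow> desc f j k = (j = j0 \<and> k = Suc s)) \<or>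
        q = 4 \<and> Suc s < n \<and> (\<exists>j0. \<forall>j k. s < k \<longrightarrow> k \<le> n \<longrightarrow> desc f j k = (j = j0 \<and> k = n)))))"

text \<open>A violation that appears at \<open>Suc n\<close> either has its later descent there, or
  consists of an inner descent at \<open>n\<close> whose right neighbour has just turned out
  strict.\<close>

lemma viol_upto_Suc:
  "viol_upto f w (Suc n) \<longleftrightarrow> viol_upto f w n \<or>
     (\<exists>j b j'. (j, b) \<noteq> (j', Suc n) \<and> b \<le> Suc n \<and> desc f j b \<and> desc f j' (Suc n) \<and> (\<forall>k\<in>{b..Suc n}. strict f w k)) \<or>
     (\<exists>j. desc f j n \<and> strict f w (n - 1) \<and> strict f w n \<and> strict f w (Suc n))"
  (is "?A \<longleftrightarrow> ?B \<or> ?C \<or> ?D")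
proof
  assume ?A
  then show "?B \<or> ?C \<or> ?D" unfolding viol_upto_def[of f w "Suc n"]
  proof (elim disjE exE conjE)
    fix j b j' a assume "(j, b) \<noteq> (j', a)" "b \<le> a" "a \<le> Suc n" "desc f j b" "desc f j' a" "\<forall>k\<in>{b..a}. strict f w k"
    then show ?thesis unfolding viol_upto_def by (cases "a = Suc n") (blast, metis le_SucE)
  next
    fix j k assume "Suc k \<le> Suc n" "desc f j k" "strict f w (k - 1)" "strict f w k" "strict f w (Suc k)"
    then show ?thesis unfolding viol_upto_def by (cases "k = n") (blast, metis Suc_leI le_neq_implies_less Suc_le_mono)
  qed
next
  assume "?B \<or> ?C \<or> ?D"
  then show ?A
  proof (elim disjE)
    assume ?B then show ?A unfolding viol_upto_def by (meson le_SucI)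
  next
    assume ?C then show ?A unfolding viol_upto_def by (meson order_refl)
  next
    assume ?D then show ?A unfolding viol_upto_def by (meson order_refl)
  qed
qed

lemma state_inv_0: "state_inv f w 0 1"
  by (auto simp: state_inv_def viol_upto_def)

text \<open>A tight position closes the run and adds no violation, as both new alternatives ask for
  strictness at \<open>Suc n\<close>. At a strict position two simultaneous descents already form a
  violation, so only the counts 0 and 1 need a look at the old state.\<close>

lemma state_inv_step:
  assumes inv: "state_inv f w n q" and q: "q \<noteq> 6" and pos: "top_sum w (Suc n) \<le> rows f (Suc n)"
    and fin: "finite {j. desc f j (Suc n)}" and c: "c = card {j. desc f j (Suc n)}"
  shows "state_inv f w (Suc n) (transition q c (rows f (Suc n)) (top_sum w (Suc n)))"
proof -
  let ?q = "transition q c (rows f (Suc n)) (top_sum w (Suc n))"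
  have V: "viol_upto f w (Suc n)" if "viol_upto f w n" using that viol_upto_Suc by blast
  show ?thesis
  proof (cases "strict f w (Suc n)")
    case False
    have "q = 5 \<or> ?q = 1" "q = 5 \<longrightarrow> ?q = 5"
      using False q pos by (auto simp: transition_def strict_def)
    moreover have "viol_upto f w (Suc n) \<longleftrightarrow> viol_upto f w n" using False unfolding viol_upto_Suc by force
    moreover have "q \<noteq> 5 \<longrightarrow> \<not> viol_upto f w n" "q = 5 \<longrightarrow> viol_upto f w n" using inv by (auto simp: state_inv_def)
    ultimately show ?thesis using False by (auto simp: state_inv_def)
  next
    case True
    then have lt: "top_sum w (Suc n) < rows f (Suc n)" by (simp add: strict_def)
    have five: "state_inv f w (Suc n) ?q" if "?q = 5" "viol_upto f w (Suc n)" using that by (simp add: state_inv_def)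
    have c0: "\<not> desc f j (Suc n)" if "c = 0" for j using that c fin by auto
    have c1: "\<exists>j0. \<forall>j. desc f j (Suc n) = (j = j0)" if "c = 1"
      using that c card_1_singletonE by (metis (mono_tags, lifting) mem_Collect_eq singletonD singletonI)
    have c2: "viol_upto f w (Suc n)" if "c \<noteq> 0" "c \<noteq> 1"
    proof -
      have "{j. desc f j (Suc n)} \<noteq> {}" using that(1) c by (metis card.empty)
      then obtain j where j: "desc f j (Suc n)" by blast
      have "\<not> {j. desc f j (Suc n)} \<subseteq> {j}"
      proof
        assume "{j. desc f j (Suc n)} \<subseteq> {j}"
        then have "c \<le> 1" unfolding c using card_mono[of "{j}"] by simp
        then show False using that by linarith
      qed
      then obtain j' where "desc f j' (Suc n)" "j' \<noteq> j" by blast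
      then show ?thesis unfolding viol_upto_Suc using j True by force
    qed
    consider "q = 5" "viol_upto f w n" | "q = 1" "\<not> viol_upto f w n" "\<not> strict f w n" |
      s where "\<not> viol_upto f w n" "s < n" "\<not> strict f w s" "\<forall>k. s < k \<longrightarrow> k \<le> n \<longrightarrow> strict f w k"
        "q = 2 \<and> (\<forall>j k. s < k \<longrightarrow> k \<le> n \<longrightarrow> \<not> desc f j k) \<or>
        q = 3 \<and> (\<exists>j0. \<forall>j k. s < k \<longrightarrow> k \<le> n \<longrightarrow> desc f j k = (j = j0 \<and> k = Suc s)) \<or>
        q = 4 \<and> Suc s < n \<and> (\<exists>j0. \<forall>j k. s < k \<longrightarrow> k \<le> n \<longrightarrow> desc f j k = (j = j0 \<and> k = n))"
      using inv unfolding state_inv_def by blast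
    then show ?thesis
    proof cases
      case 1
      then show ?thesis using V lt by (intro five) (auto simp: transition_def)
    next
      case 2
      have step: "\<not> viol_upto f w (Suc n)" if "\<And>j j'. desc f j (Suc n) \<Longrightarrow> desc f j' (Suc n) \<Longrightarrow> j = j'"
      proof -
        have "b = Suc n" if "b \<le> Suc n" "\<forall>k\<in>{b..Suc n}. strict f w k" for b
          using that 2(3) by (metis atLeastAtMost_iff le_SucE le_Suc_eq order_refl)
        then show ?thesis unfolding viol_upto_Suc using 2 that by blast
      qed
      have run: "\<forall>k. n < k \<longrightarrow> k \<le> Suc n \<longrightarrow> strict f w k" using True by (metis le_SucE not_le)
      consider "c = 0" | "c = 1" | "c \<noteq> 0" "c \<noteq> 1" by blast
      then show ?thesis
      proof cases
        case 1
        then have "?q = 2" using 2 lt by (simp add: transition_def)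
        moreover have "\<forall>j k. n < k \<longrightarrow> k \<le> Suc n \<longrightarrow> \<not> desc f j k" using c0[OF 1] by (metis le_SucE not_le)
        ultimately show ?thesis using step c0[OF 1] 2(3) run unfolding state_inv_def by blast
      next
        case c: 2
        then obtain j0 where j0: "\<forall>j. desc f j (Suc n) = (j = j0)" using c1 by blast
        have "?q = 3" using 2 lt c by (simp add: transition_def)
        moreover have "\<forall>j k. n < k \<longrightarrow> k \<le> Suc n \<longrightarrow> desc f j k = (j = j0 \<and> k = Suc n)"
          using j0 by (metis le_SucE not_le)
        moreover have "\<not> viol_upto f w (Suc n)" using step j0 by simp
        ultimately show ?thesis using 2(3) run unfolding state_inv_def by blast
      next
        case 3
        then show ?thesis using 2 c2 lt by (intro five) (auto simp: transition_def)
      qed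
    next
      case (3 s)
      have run: "\<forall>k. s < k \<longrightarrow> k \<le> Suc n \<longrightarrow> strict f w k" using True 3(4) by (metis le_SucE)
      have sn: "s < Suc n" using 3(2) by simp
      have above: "s < b" if "b \<le> Suc n" "\<forall>k\<in>{b..Suc n}. strict f w k" for b
        using that 3(2,3) by (metis atLeastAtMost_iff less_SucI less_imp_le not_le)
      from 3(5) show ?thesis
      proof (elim disjE conjE exE)
        assume q: "q = 2" and nd: "\<forall>j k. s < k \<longrightarrow> k \<le> n \<longrightarrow> \<not> desc f j k"
        have step: "\<not> viol_upto f w (Suc n)" if "\<And>j j'. desc f j (Suc n) \<Longrightarrow> desc f j' (Suc n) \<Longrightarrow> j = j'"
        proof -
          have "b = Suc n" if "b \<le> Suc n" "\<forall>k\<in>{b..Suc n}. strict f w k" "desc f j b" for b j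
            using above[OF that(1,2)] that nd by (metis le_SucE)
          moreover have "\<not> desc f j n" for j using nd 3(2) by simp
          ultimately show ?thesis unfolding viol_upto_Suc using 3(1) that by blast
        qed
        consider "c = 0" | "c = 1" | "c \<noteq> 0" "c \<noteq> 1" by blast
        then show ?thesis
        proof cases
          case 1
          then have "?q = 2" using q lt by (simp add: transition_def)
          moreover have "\<forall>j k. s < k \<longrightarrow> k \<le> Suc n \<longrightarrow> \<not> desc f j k" using c0[OF 1] nd by (metis le_SucE)
          ultimately show ?thesis using step c0[OF 1] 3(3) sn run unfolding state_inv_def by blast
        next
          case c: 2
          then obtain j0 where j0: "\<forall>j. desc f j (Suc n) = (j = j0)" using c1 by blast
          have "?q = 4" using q lt c by (simp add: transition_def)
          moreover have "\<forall>j k. s < k \<longrightarrow> k \<le> Suc n \<longrightarrow> desc f j k = (j = j0 \<and> k = Suc n)"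
            using j0 nd by (metis le_SucE Suc_n_not_le_n)
          moreover have "\<not> viol_upto f w (Suc n)" using step j0 by simp
          moreover have "Suc s < Suc n" using 3(2) by simp
          ultimately show ?thesis using 3(3) sn run unfolding state_inv_def by blast
        next
          case c: 3
          then show ?thesis using q c2 lt by (intro five) (auto simp: transition_def)
        qed
      next
        fix j0 assume q: "q = 3" and d: "\<forall>j k. s < k \<longrightarrow> k \<le> n \<longrightarrow> desc f j k = (j = j0 \<and> k = Suc s)"
        have d0: "desc f j0 (Suc s)" using d 3(2) by simp
        show ?thesis
        proof (cases "c = 0")
          case True
          \<comment> \<open>The only descent of the run is right after the tight position
            \<open>s\<close>; its left neighbour is not strict.\<close>
          have "\<not> (desc f j n \<and> strict f w (n - 1))" for j using d 3(2,3) by auto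
          then have "\<not> viol_upto f w (Suc n)" unfolding viol_upto_Suc using c0[OF True] 3(1) by blast
          moreover have "?q = 3" using q lt True by (simp add: transition_def)
          moreover have "\<forall>j k. s < k \<longrightarrow> k \<le> Suc n \<longrightarrow> desc f j k = (j = j0 \<and> k = Suc s)"
            using d c0[OF True] 3(2) by (metis le_SucE nat_neq_iff Suc_less_eq)
          ultimately show ?thesis using 3(3) sn run unfolding state_inv_def by blast
        next
          case False
          then obtain j where "desc f j (Suc n)" using c by (metis (mono_tags, lifting) card_eq_0_iff empty_Collect_eq)
          moreover have "(j0, Suc s) \<noteq> (j, Suc n)" "Suc s \<le> Suc n" using 3(2) by auto
          moreover have "\<forall>k\<in>{Suc s..Suc n}. strict f w k" using run by simp
          ultimately have "viol_upto f w (Suc n)" unfolding viol_upto_Suc using d0 by blast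
          then show ?thesis using q lt False by (intro five) (auto simp: transition_def)
        qed
      next
        fix j0 assume q: "q = 4" "Suc s < n" and d: "\<forall>j k. s < k \<longrightarrow> k \<le> n \<longrightarrow> desc f j k = (j = j0 \<and> k = n)"
        have "desc f j0 n" using d 3(2) by simp
        moreover have "strict f w (n - 1)" "strict f w n" using 3(4) q(2) by auto
        ultimately have "viol_upto f w (Suc n)" unfolding viol_upto_Suc using True by blast
        then show ?thesis using q lt by (intro five) (auto simp: transition_def)
      qed
    qed
  qed
qed

end

lemma sum_take_Suc: "k < length (v :: nat list) \<Longrightarrow> sum_list (take (Suc k) v) = sum_list (take k v) + v ! k"
  by (simp add: take_Suc_conv_app_nth)

lemma top_sum_sorted: "sorted_wrt (\<ge>) v \<Longrightarrow> top_sum v k = sum_list (take k v)"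
proof (induction v arbitrary: k)
  case (Cons m v)
  then show ?case using top_sum_Cons_max[of v m] by (cases k) auto
qed simp

lemma heads_drop: "heads (map (drop k) ls) = box.row (length ls) (part ls) k"
proof -
  have "(case drop k l of [] \<Rightarrow> 0 | x # _ \<Rightarrow> x) = (if k < length l then l ! k else 0)" for l :: "nat list"
    by (cases "k < length l") (simp_all add: Cons_nth_drop_Suc[symmetric])
  then show ?thesis
    by (simp add: heads_def sum_list_sum_nth atLeast0LessThan box.row_def part_def comp_def)
qed

lemma drops_drop:
  assumes "\<forall>l\<in>set ls. sorted_wrt (\<ge>) l \<and> 0 \<notin> set l"
  shows "drops (map (drop k) ls) = card {j. box.desc (part ls) j (Suc k)}"
    and "finite {j. box.desc (part ls) j (Suc k)}"
proof -
  have "drops_at_head (drop k (ls ! j)) \<longleftrightarrow> box.desc (part ls) j (Suc k)" if j: "j < length ls" for j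
  proof (cases "k < length (ls ! j)")
    case True
    have "sorted_wrt (\<ge>) (ls ! j)" "ls ! j ! k \<noteq> 0" using assms j True by (metis nth_mem)+
    moreover from this have "Suc k < length (ls ! j) \<Longrightarrow> ls ! j ! Suc k \<le> ls ! j ! k"
      using sorted_wrt_nth_less[of "(\<ge>)" "ls ! j" k "Suc k"] by simp
    ultimately show ?thesis using True j
      by (cases "Suc k < length (ls ! j)")
        (auto simp: drops_at_head_def box.desc_def part_def Cons_nth_drop_Suc[symmetric])
  qed (simp add: drops_at_head_def box.desc_def part_def)
  moreover have "\<not> box.desc (part ls) j (Suc k)" if "\<not> j < length ls" for j
    using that by (simp add: box.desc_def part_def)
  ultimately have "{j. box.desc (part ls) j (Suc k)} = {j. j < length ls \<and> drops_at_head (drop k (ls ! j))}"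
    by blast
  then show "drops (map (drop k) ls) = card {j. box.desc (part ls) j (Suc k)}"
    "finite {j. box.desc (part ls) j (Suc k)}"
    by (simp_all add: drops_def filter_map length_filter_conv_card comp_def)
qed

text \<open>State 6 is absorbing and takes precedence over state 5, so both tests can run side by
  side: \<open>good\<close> asks for the invariant only as long as dominance has not failed.\<close>

lemma scan_correct:
  fixes ls v
  defines "r \<equiv> length ls" and "f \<equiv> part ls"
  assumes ls: "\<forall>l\<in>set ls. sorted_wrt (\<ge>) l \<and> 0 \<notin> set l" and v: "sorted_wrt (\<ge>) v"
  defines "good \<equiv> \<lambda>k q. if \<forall>i\<le>k. top_sum v i \<le> box.rows r f i then q \<noteq> 6 \<and> box.state_inv r f v k q else q = 6"
  shows "k \<le> length v \<Longrightarrow> good k q \<Longrightarrow>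
    good (length v) (scan (map (drop k) ls) (drop k v) (box.rows r f k) (top_sum v k) q)"
proof (induction "length v - k" arbitrary: k q)
  case 0
  then show ?case by simp
next
  case (Suc n)
  then have k: "k < length v" by simp
  let ?q = "transition q (drops (map (drop k) ls)) (box.rows r f (Suc k)) (top_sum v (Suc k))"
  have "good (Suc k) ?q"
  proof (cases "\<forall>i\<le>Suc k. top_sum v i \<le> box.rows r f i")
    case True
    then have "q \<noteq> 6" "box.state_inv r f v k q" using Suc.prems(2) by (simp_all add: good_def)
    moreover have "?q \<noteq> 6" using True \<open>q \<noteq> 6\<close> by (simp add: transition_def not_less)
    ultimately show ?thesis using True box.state_inv_step[of r f v k q] drops_drop[OF ls, of k]
      unfolding good_def f_def by simp
  next
    case False
    then have "?q = 6"
    proof (cases "\<forall>i\<le>k. top_sum v i \<le> box.rows r f i")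
      case True
      then have "\<not> top_sum v (Suc k) \<le> box.rows r f (Suc k)" using False by (metis le_SucE)
      then show ?thesis by (simp add: transition_def)
    next
      case no: False
      then have "q = 6" using Suc.prems(2) unfolding good_def by (metis)
      then show ?thesis by (simp add: transition_def)
    qed
    then show ?thesis using False unfolding good_def by presburger
  qed
  moreover have "scan (map (drop k) ls) (drop k v) (box.rows r f k) (top_sum v k) q =
    scan (map (drop (Suc k)) ls) (drop (Suc k) v) (box.rows r f (Suc k)) (top_sum v (Suc k)) ?q"
  proof -
    have "map tl (map (drop k) ls) = map (drop (Suc k)) ls" by (simp add: drop_Suc tl_drop comp_def)
    moreover have "top_sum v (Suc k) = top_sum v k + v ! k"
      using k by (simp add: top_sum_sorted[OF v] sum_take_Suc)
    moreover have "box.rows r f (Suc k) = box.rows r f k + heads (map (drop k) ls)"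
      by (simp add: box.rows_Suc heads_drop r_def f_def)
    ultimately show ?thesis by (simp only: Cons_nth_drop_Suc[OF k, symmetric] scan.simps)
  qed
  ultimately show ?case using Suc.hyps k by simp
qed

text \<open>The counting theorems use the increasing order \<open>u\<close> and the scan the
  decreasing order \<open>v\<close>. Symmetry of \<open>chains\<close> in the letters and invariance
  of \<open>top_sum\<close> under permutations connect them.\<close>

theorem kostka_scan:
  assumes mp: "multipartition r n ls" and w: "composition_of n w"
  defines "q \<equiv> scan ls (rev (sort w)) 0 0 1"
  shows "kostka ls w > 0 \<longleftrightarrow> q \<noteq> 6" "kostka ls w = 1 \<longleftrightarrow> q \<noteq> 5 \<and> q \<noteq> 6"
proof -
  let ?r = "length ls" and ?R = "max_rows ls" and ?f = "part ls"
  have ls: "\<forall>l\<in>set ls. sorted_wrt (\<ge>) l \<and> 0 \<notin> set l"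
    using mp by (simp add: multipartition_def partition_of_def)
  have f: "?f \<in> box.shapes ?r ?R" using ls by (intro part_shapes) simp
  define u where "u = sort w"
  define v where "v = rev u"
  have sv: "sorted_wrt (\<ge>) v" "sorted u" by (simp_all add: v_def u_def sorted_wrt_rev)
  have tv: "top_sum v k = top_sum u k" for k by (intro top_sum_mset) (simp add: v_def)
  have K: "kostka ls w = box.chains ?r ?R ?f u"
  proof -
    have "sort (rev w) = sort w" by (metis mset_rev mset_sort properties_for_sort sorted_sort)
    then show ?thesis using kostka_chains[of ls w] ls box.chains_sort[OF f, of "rev w"] by (simp add: u_def)
  qed
  have tot: "box.rows ?r ?f ?R = sum_list u"
  proof -
    have "box.rows ?r ?f ?R = (\<Sum>j<?r. \<Sum>i<?R. ?f j i)" by (rule box.rows_swap)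
    also have "\<dots> = (\<Sum>j<?r. sum_list (ls ! j))"
    proof (rule sum.cong)
      fix j assume j: "j \<in> {..<?r}"
      have "(\<Sum>i<?R. ?f j i) = (\<Sum>i<length (ls ! j). ?f j i)"
        using j length_le_max_rows by (intro sum_pad_zero) (auto simp: part_def)
      then show "(\<Sum>i<?R. ?f j i) = sum_list (ls ! j)"
        using j by (simp add: part_def sum_list_sum_nth atLeast0LessThan)
    qed simp
    also have "\<dots> = (\<Sum>l\<leftarrow>ls. sum_list l)" by (simp only: sum_list_sum_nth[of "map sum_list ls"]) (simp add: atLeast0LessThan)
    also have "\<dots> = n" using mp by (simp add: multipartition_def)
    also have "\<dots> = sum_list w" using w by (simp add: composition_of_def)
    also have "\<dots> = sum_list u" unfolding u_def by (metis sum_mset_sum_list mset_sort)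
    finally show ?thesis .
  qed
  \<comment> \<open>Beyond the number of letters the top sums are constant while the prefix sums of
    the rows do not decrease.\<close>
  have pos: "(\<forall>k\<le>length v. top_sum v k \<le> box.rows ?r ?f k) \<longleftrightarrow> box.chains ?r ?R ?f u > 0"
  proof -
    have "top_sum u k \<le> box.rows ?r ?f k" if "\<forall>k\<le>length v. top_sum v k \<le> box.rows ?r ?f k" for k
    proof (cases "k \<le> length v")
      case True
      then show ?thesis using that tv by simp
    next
      case False
      then have "top_sum u k = top_sum v (length v)" by (simp add: top_sum_full v_def)
      also have "\<dots> \<le> box.rows ?r ?f (length v)" using that by simp
      also have "\<dots> \<le> box.rows ?r ?f k" using False by (intro box.rows_mono) simp
      finally show ?thesis .
    qed
    then show ?thesis using box.chains_pos_iff[OF f] tot tv by auto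
  qed
  \<comment> \<open>No strict position exceeds the number of letters, so the scan sees every
    violation.\<close>
  have viol: "box.viol_upto ?r ?f v (length v) \<longleftrightarrow> box.viol ?r ?f u"
  proof -
    have st: "box.strict ?r ?f v = box.strict ?r ?f u" by (simp add: fun_eq_iff box.strict_def tv)
    have "k \<le> length v" if "box.strict ?r ?f u k" for k
    proof (rule ccontr)
      assume "\<not> k \<le> length v"
      then show False using that box.rows_le_total[OF f, of k] tot by (simp add: box.strict_def top_sum_full v_def)
    qed
    then show ?thesis unfolding box.viol_def box.viol_upto_def st by (meson atLeastAtMost_iff order_refl)
  qed
  have "box.rows ?r ?f 0 = 0" by (simp add: box.rows_def)
  then have q: "q = scan (map (drop 0) ls) (drop 0 v) (box.rows ?r ?f 0) (top_sum v 0) 1"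
    by (simp add: q_def v_def u_def)
  have inv: "if \<forall>i\<le>length v. top_sum v i \<le> box.rows ?r ?f i
      then q \<noteq> 6 \<and> box.state_inv ?r ?f v (length v) q else q = 6"
    unfolding q by (rule scan_correct[OF ls sv(1)]) (simp_all add: box.state_inv_0[simplified])
  show "kostka ls w > 0 \<longleftrightarrow> q \<noteq> 6" unfolding K using inv pos by metis
  show "kostka ls w = 1 \<longleftrightarrow> q \<noteq> 5 \<and> q \<noteq> 6"
  proof (cases "box.chains ?r ?R ?f u > 0")
    case True
    then have "q \<noteq> 6" and si: "box.state_inv ?r ?f v (length v) q" using inv pos by metis+
    moreover have "q = 5 \<longleftrightarrow> box.viol ?r ?f u" using si viol unfolding box.state_inv_def by auto
    moreover have "box.viol ?r ?f u \<longleftrightarrow> box.chains ?r ?R ?f u \<noteq> 1"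
      using box.chains_ge2_if_viol[OF f sv(2) True] box.chains_le1_if_not_viol[OF f sv(2)] True by fastforce
    ultimately show ?thesis unfolding K by simp
  next
    case False
    then show ?thesis using inv pos unfolding K by auto
  qed
qed

section \<open>Stack programs on Turing machines\<close>

type_synonym store = "nat \<Rightarrow> nat list"

definition top_of :: "nat list \<Rightarrow> nat" where
  "top_of xs = (case xs of [] \<Rightarrow> 0 | x # _ \<Rightarrow> x)"

lemma top_of_simps [simp]: "top_of [] = 0" "top_of (x # xs) = x"
  by (simp_all add: top_of_def)

definition tops :: "store \<Rightarrow> nat \<Rightarrow> nat" where
  "tops s = (\<lambda>i. top_of (s i))"

lemma tops_apply [simp]: "tops s i = top_of (s i)"
  by (simp add: tops_def)

text \<open>Each elementary command is one machine step. A step writes before it moves, so a push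
  needs two commands, \<open>Grow\<close> for the new cell and \<open>Write\<close> for its symbol.
  Tests and written symbols depend only on the tops of the stacks.\<close>

datatype com =
    Grow nat
  | Write nat "(nat \<Rightarrow> nat) \<Rightarrow> nat"
  | Pop nat
  | Seq com com  (infixr ";;" 60)
  | Cond "(nat \<Rightarrow> nat) \<Rightarrow> bool" com com
  | While "(nat \<Rightarrow> nat) \<Rightarrow> bool" com

fun kstep :: "com list \<times> store \<Rightarrow> com list \<times> store" where
  "kstep ([], s) = ([], s)"
| "kstep (Grow l # K, s) = (K, s(l := 0 # s l))"
| "kstep (Write l g # K, s) = (K, s(l := g (tops s) # tl (s l)))"
| "kstep (Pop l # K, s) = (K, s(l := tl (s l)))"
| "kstep ((a ;; b) # K, s) = (a # b # K, s)"
| "kstep (Cond p a b # K, s) = ((if p (tops s) then a else b) # K, s)"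
| "kstep (While p a # K, s) = (if p (tops s) then (a # While p a # K, s) else (K, s))"

text \<open>The finitely many continuations that occur while \<open>c\<close> runs; they become the machine states.\<close>

fun conts :: "com \<Rightarrow> com list \<Rightarrow> com list set" where
  "conts (a ;; b) K = insert ((a ;; b) # K) (conts a (b # K) \<union> conts b K)"
| "conts (Cond p a b) K = insert (Cond p a b # K) (conts a K \<union> conts b K)"
| "conts (While p a) K = insert (While p a # K) (conts a (While p a # K))"
| "conts c K = {c # K}"

lemma finite_conts: "finite (conts c K)"
  by (induction c K rule: conts.induct) auto

lemma conts_self: "c # K \<in> conts c K"
  by (cases c) auto

lemma conts_closed: "X \<in> conts c K \<Longrightarrow> fst (kstep (X, s)) \<in> insert K (conts c K)"
proof (induction c K arbitrary: X rule: conts.induct)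
  case (1 a b K)
  from 1(3) consider "X = (a ;; b) # K" | "X \<in> conts a (b # K)" | "X \<in> conts b K" by auto
  then show ?case
  proof cases
    case 2
    then show ?thesis using 1(1)[of X] conts_self[of b K] by (metis UnI1 UnI2 conts.simps(1) insertE insertI2)
  qed (use 1(2)[of X] conts_self[of a "b # K"] in auto)
next
  case (2 p a b K)
  then show ?case using conts_self[of a K] conts_self[of b K] by auto
next
  case (3 p a K)
  from 3(2) consider "X = While p a # K" | "X \<in> conts a (While p a # K)" by auto
  then show ?case
  proof cases
    case 2
    then show ?thesis using 3(1)[of X] by (metis conts.simps(3) insertE insertI1 insertI2)
  qed (use conts_self[of a "While p a # K"] in auto)
qed auto

text \<open>Ensures that \<open>n\<close> tapes and the alphabet \<open>{..<A}\<close> suffice for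
  the machine built from the program.\<close>

fun bounded :: "nat \<Rightarrow> nat \<Rightarrow> com \<Rightarrow> bool" where
  "bounded n A (Grow l) \<longleftrightarrow> l < n"
| "bounded n A (Write l g) \<longleftrightarrow> l < n \<and> (\<forall>r. (\<forall>i. r i < A) \<longrightarrow> g r < A)"
| "bounded n A (Pop l) \<longleftrightarrow> l < n"
| "bounded n A (a ;; b) \<longleftrightarrow> bounded n A a \<and> bounded n A b"
| "bounded n A (Cond p a b) \<longleftrightarrow> bounded n A a \<and> bounded n A b"
| "bounded n A (While p a) \<longleftrightarrow> bounded n A a"

lemma conts_bounded:
  "X \<in> conts c K \<Longrightarrow> bounded n A c \<Longrightarrow> list_all (bounded n A) K \<Longrightarrow> list_all (bounded n A) X"
  by (induction c K arbitrary: X rule: conts.induct) auto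

section \<open>Stacks on tapes and simulation by a Turing machine\<close>

text \<open>A stack is stored on a tape with the head on its top element; it extends to the right, and
  everything else on the tape is blank.\<close>

definition stack_tape :: "nat list \<Rightarrow> tape \<Rightarrow> bool" where
  "stack_tape xs \<tau> \<longleftrightarrow> (\<forall>i. fst \<tau> (snd \<tau> + i) = (if 0 \<le> i \<and> i < int (length xs) then xs ! nat i else 0))"

lemma stack_tape_read: "stack_tape xs \<tau> \<Longrightarrow> read \<tau> = top_of xs"
  by (cases \<tau>; cases xs) (auto simp: stack_tape_def dest: spec[of _ 0])

lemma stack_tape_stay: "stack_tape xs \<tau> \<Longrightarrow> stack_tape xs (act \<tau> (read \<tau>, Stay))"
  by (cases \<tau>) (simp add: stack_tape_def)

lemma stack_tape_grow: "stack_tape xs \<tau> \<Longrightarrow> stack_tape (0 # xs) (act \<tau> (read \<tau>, MoveLeft))"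
proof -
  assume "stack_tape xs \<tau>"
  then have *: "fst \<tau> (snd \<tau> + i) = (if 0 \<le> i \<and> i < int (length xs) then xs ! nat i else 0)" for i
    by (simp add: stack_tape_def)
  have "fst \<tau> (snd \<tau> - 1 + i) = (if 0 \<le> i \<and> i < 1 + int (length xs) then (0 # xs) ! nat i else 0)" for i
  proof -
    have "nat i = Suc (nat (i - 1))" if "1 \<le> i" using that by simp
    then show ?thesis using *[of "i - 1"] by (cases "1 \<le> i") (auto simp: algebra_simps)
  qed
  then show ?thesis by (cases \<tau>) (simp add: stack_tape_def)
qed

lemma stack_tape_pop: "stack_tape xs \<tau> \<Longrightarrow> stack_tape (tl xs) (act \<tau> (0, MoveRight))"
proof -
  assume "stack_tape xs \<tau>"
  then have *: "fst \<tau> (snd \<tau> + i) = (if 0 \<le> i \<and> i < int (length xs) then xs ! nat i else 0)" for i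
    by (simp add: stack_tape_def)
  have "((fst \<tau>)(snd \<tau> := 0)) (snd \<tau> + 1 + i) =
    (if 0 \<le> i \<and> i < int (length (tl xs)) then tl xs ! nat i else 0)" for i
  proof -
    have "nat (1 + i) = Suc (nat i)" if "0 \<le> i" using that by simp
    then show ?thesis using *[of "1 + i"] by (cases xs) (auto simp: algebra_simps)
  qed
  then show ?thesis by (cases \<tau>) (simp add: stack_tape_def)
qed

lemma stack_tape_write: "stack_tape xs \<tau> \<Longrightarrow> stack_tape (a # tl xs) (act \<tau> (a, Stay))"
proof -
  assume "stack_tape xs \<tau>"
  then have *: "fst \<tau> (snd \<tau> + i) = (if 0 \<le> i \<and> i < int (length xs) then xs ! nat i else 0)" for i
    by (simp add: stack_tape_def)
  have "((fst \<tau>)(snd \<tau> := a)) (snd \<tau> + i) =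
    (if 0 \<le> i \<and> i < 1 + int (length (tl xs)) then (a # tl xs) ! nat i else 0)" for i
  proof -
    have "nat i = Suc (nat (i - 1))" if "1 \<le> i" using that by simp
    then show ?thesis using *[of i] by (cases xs; cases "1 \<le> i") auto
  qed
  then show ?thesis by (cases \<tau>) (simp add: stack_tape_def)
qed

fun action :: "com \<Rightarrow> (nat \<Rightarrow> nat) \<Rightarrow> nat \<Rightarrow> nat \<times> move" where
  "action (Grow l) r i = (r i, if i = l then MoveLeft else Stay)"
| "action (Write l g) r i = (if i = l then g r else r i, Stay)"
| "action (Pop l) r i = (if i = l then (0, MoveRight) else (r i, Stay))"
| "action _ r i = (r i, Stay)"

lemma action_bounded:
  "bounded n A c \<Longrightarrow> \<forall>i. r i < A \<Longrightarrow> fst (action c r i) < A"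
proof -
  assume "bounded n A c" and r: "\<forall>i. r i < A"
  moreover have "0 < A" using r by (metis gr0I not_less_zero)
  ultimately show ?thesis by (cases c) auto
qed

lemma stack_tape_action:
  assumes "stack_tape (s i) \<tau>"
  shows "stack_tape (snd (kstep (c # K, s)) i) (act \<tau> (action c (tops s) i))"
  using stack_tape_read[OF assms] stack_tape_stay[OF assms] stack_tape_grow[OF assms]
    stack_tape_pop[OF assms] stack_tape_write[OF assms]
  by (cases c) (auto simp del: act.simps)

text \<open>The control part of \<open>kstep\<close> as a function of the visible symbols, which are
  all that a transition function can consult.\<close>

fun next_cont :: "com list \<Rightarrow> (nat \<Rightarrow> nat) \<Rightarrow> com list" where
  "next_cont [] r = []"
| "next_cont (Grow l # K) r = K"
| "next_cont (Write l g # K) r = K"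
| "next_cont (Pop l # K) r = K"
| "next_cont ((a ;; b) # K) r = a # b # K"
| "next_cont (Cond p a b # K) r = (if p r then a else b) # K"
| "next_cont (While p a # K) r = (if p r then a # While p a # K else K)"

lemma next_cont_kstep: "fst (kstep (X, s)) = next_cont X (tops s)"
  by (cases X; cases "hd X") auto

lemma ex_store_tops: "\<exists>s. tops s = r"
  by (rule exI[of _ "\<lambda>i. [r i]"]) (simp add: tops_def)

lemma next_cont_conts: "X \<in> conts c K \<Longrightarrow> next_cont X r \<in> insert K (conts c K)"
  using conts_closed ex_store_tops next_cont_kstep by metis

definition input_store :: "bool list \<Rightarrow> store" where
  "input_store x = (\<lambda>_. [])(0 := map (\<lambda>b. if b then 2 else 1) x)"

text \<open>Continuations become states and stacks become tapes, with one machine step per program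
  step. The empty continuation is a state as well: from there one more step inspects the tops and
  accepts or rejects according to \<open>fin\<close>.\<close>

theorem polytime_decidable_if_program:
  fixes c :: com and enc :: "'a \<Rightarrow> bool list"
  assumes bd: "bounded n A c" and n: "1 \<le> n" and A: "3 \<le> A"
    and run: "\<And>x. x \<in> D \<Longrightarrow> \<exists>t s. t \<le> poly p (length (enc x)) \<and>
      (kstep ^^ t) ([c], input_store (enc x)) = ([], s) \<and> fin (tops s) = P x"
  shows "polytime_decidable enc D P"
proof -
  define X where "X = insert [] (conts c [])"
  have "finite X" by (simp add: X_def finite_conts)
  then obtain e :: "com list \<Rightarrow> nat" where e: "inj_on e X" using finite_imp_inj_to_nat_seg by metis
  \<comment> \<open>The shift by 2 reserves the states 0 and 1 for acceptance and rejection.\<close>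
  define code where "code K = e K + 2" for K
  have inj: "inj_on code X" using e by (auto simp: code_def inj_on_def)
  define decode where "decode = inv_into X code"
  have decode: "decode (code K) = K" if "K \<in> X" for K
    using that inj by (simp add: decode_def)
  define reads where "reads as = (\<lambda>i. if i < n then as ! i else 0)" for as :: "nat list"
  define \<delta> where "\<delta> q as = (if q \<notin> code ` X then (q, map (\<lambda>i. (as ! i, Stay)) [0..<n]) else case decode q of
      [] \<Rightarrow> (if fin (reads as) then 0 else 1, map (\<lambda>i. (as ! i, Stay)) [0..<n])
    | a # K \<Rightarrow> (code (next_cont (a # K) (reads as)), map (action a (reads as)) [0..<n]))"
    for q as
  define M where "M = \<lparr>num_tapes = n, states = {0, 1} \<union> code ` X, alphabet = {..<A},
    start = code [c], accept = 0, reject = 1, delta = \<delta>\<rparr>"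
  have M: "num_tapes M = n" "start M = code [c]" "accept M = 0" "reject M = 1" "delta M = \<delta>"
    "states M = {0, 1} \<union> code ` X" "alphabet M = {..<A}" by (simp_all add: M_def)
  have cX: "[c] \<in> X" using conts_self by (simp add: X_def)
  have nextX: "next_cont K r \<in> X" if "K \<in> X" for K r
    using that next_cont_conts[of K c "[]" r] by (auto simp: X_def)
  have Xdec: "decode q \<in> X" if "q \<in> code ` X" for q using that decode by auto
  have bX: "bounded n A a" if "a # K \<in> X" for a K
    using that conts_bounded[of "a # K" c "[]" n A] bd by (simp add: X_def)
  have \<delta>_ok: "fst (\<delta> q as) \<in> states M \<and> length (snd (\<delta> q as)) = n \<and> fst ` set (snd (\<delta> q as)) \<subseteq> {..<A}"
    if q: "q \<in> states M" and as: "length as = n" "set as \<subseteq> {..<A}" for q as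
  proof -
    have asA: "as ! i < A" if "i < n" for i using as that nth_mem[of i as] by (metis lessThan_iff subsetD)
    then have r: "\<forall>i. reads as i < A" using A by (auto simp: reads_def)
    show ?thesis
    proof (cases "q \<in> code ` X")
      case True
      then show ?thesis
      proof (cases "decode q")
        case Nil
        then show ?thesis using True asA by (auto simp: \<delta>_def M)
      next
        case (Cons a K)
        then have aK: "a # K \<in> X" using Xdec[OF True] by simp
        have "fst (action a (reads as) i) < A" for i by (rule action_bounded[OF bX[OF aK] r])
        then show ?thesis using True Cons nextX[OF aK] by (auto simp: \<delta>_def M)
      qed
    qed (use q asA in \<open>auto simp: \<delta>_def M\<close>)
  qed
  have wf: "wf_machine M"
    unfolding wf_machine_def using n A \<delta>_ok cX \<open>finite X\<close> by (auto simp: M)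
  have reads_tops: "reads (map read ts) = tops s"
    if "length ts = n" "\<forall>i<n. stack_tape (s i) (ts ! i)" "\<forall>i\<ge>n. s i = []" for ts s
    using that stack_tape_read by (auto simp: reads_def fun_eq_iff)
  have code2: "code K \<noteq> accept M" "code K \<noteq> reject M" for K by (simp_all add: M code_def)
  have sim1: "\<exists>ts'. step M (code K, ts) = (code (fst (kstep (K, s))), ts') \<and> length ts' = n \<and>
      (\<forall>i<n. stack_tape (snd (kstep (K, s)) i) (ts' ! i)) \<and> (\<forall>i\<ge>n. snd (kstep (K, s)) i = [])"
    if K: "K \<in> X" "K \<noteq> []" and ts: "length ts = n" "\<forall>i<n. stack_tape (s i) (ts ! i)" "\<forall>i\<ge>n. s i = []" for K s ts
  proof -
    obtain a K' where aK: "K = a # K'" using K(2) by (cases K) auto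
    define ts' where "ts' = map2 act ts (map (action a (tops s)) [0..<n])"
    have "\<delta> (code K) (map read ts) = (code (next_cont K (tops s)), map (action a (tops s)) [0..<n])"
      using K(1) decode[OF K(1)] reads_tops[OF ts] by (simp add: \<delta>_def aK)
    then have "step M (code K, ts) = (code (fst (kstep (K, s))), ts')"
      using code2 by (simp add: M(5) ts'_def next_cont_kstep)
    moreover have "stack_tape (snd (kstep (K, s)) i) (ts' ! i)" if "i < n" for i
      using that ts(1,2) stack_tape_action by (simp add: ts'_def aK)
    moreover have "snd (kstep (K, s)) i = []" if "n \<le> i" for i
      using that ts(3) bX[of a K'] K(1) aK by (cases a) auto
    ultimately show ?thesis using ts(1) by (auto simp: ts'_def)
  qed
  have sim: "\<exists>ts. (step M ^^ t) (code [c], ts0) = (code (fst ((kstep ^^ t) ([c], s0))), ts) \<and> length ts = n \<and>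
      (\<forall>i<n. stack_tape (snd ((kstep ^^ t) ([c], s0)) i) (ts ! i)) \<and>
      (\<forall>i\<ge>n. snd ((kstep ^^ t) ([c], s0)) i = []) \<and> fst ((kstep ^^ t) ([c], s0)) \<in> X"
    if "\<forall>u<t. fst ((kstep ^^ u) ([c], s0)) \<noteq> []"
      "length ts0 = n" "\<forall>i<n. stack_tape (s0 i) (ts0 ! i)" "\<forall>i\<ge>n. s0 i = []" for t s0 ts0
    using that(1)
  proof (induction t)
    case 0
    then show ?case using that cX by simp
  next
    case (Suc t)
    obtain K s where Ks: "(kstep ^^ t) ([c], s0) = (K, s)" by (metis surj_pair)
    then have "K \<noteq> []" using Suc.prems by (metis fst_conv lessI)
    moreover obtain ts where ts: "(step M ^^ t) (code [c], ts0) = (code K, ts)" "length ts = n"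
      "\<forall>i<n. stack_tape (s i) (ts ! i)" "\<forall>i\<ge>n. s i = []" "K \<in> X"
      using Suc.IH Suc.prems Ks by auto
    moreover from this have "fst (kstep (K, s)) \<in> X" using nextX next_cont_kstep by metis
    ultimately show ?case using sim1[of K ts s] by (simp add: Ks)
  qed
  \<comment> \<open>The summand 1 pays for the final step out of the empty continuation.\<close>
  have "\<exists>t \<le> poly (p + 1) (length (enc x)).
      fst ((step M ^^ t) (initial M (enc x))) = (if P x then accept M else reject M)" if x: "x \<in> D" for x
  proof -
    obtain t s where t: "t \<le> poly p (length (enc x))"
      "(kstep ^^ t) ([c], input_store (enc x)) = ([], s)" "fin (tops s) = P x"
      using run[OF x] by blast
    \<comment> \<open>On the empty continuation \<open>kstep\<close> idles but the machine moves on,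
      so the simulation is followed only up to the time \<open>u\<close> at which it is first
      reached.\<close>
    define u where "u = (LEAST u. fst ((kstep ^^ u) ([c], input_store (enc x))) = [])"
    have u: "fst ((kstep ^^ u) ([c], input_store (enc x))) = []"
      unfolding u_def by (rule LeastI[of _ t]) (simp add: t)
    have ut: "u \<le> t" unfolding u_def by (rule Least_le) (simp add: t)
    have before: "\<forall>v<u. fst ((kstep ^^ v) ([c], input_store (enc x))) \<noteq> []"
      unfolding u_def using not_less_Least by blast
    have stay: "(kstep ^^ m) ([], s') = ([], s')" for m s' by (induction m) auto
    have us: "(kstep ^^ u) ([c], input_store (enc x)) = ([], s)"
    proof -
      have "(kstep ^^ (t - u + u)) ([c], input_store (enc x)) = ([], s)" using t(2) ut by simp
      then show ?thesis using u stay unfolding funpow_add comp_apply by (metis prod.collapse)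
    qed
    define ts0 where "ts0 = input_tape (enc x) # replicate (n - 1) (input_tape [])"
    have "stack_tape (input_store (enc x) i) (ts0 ! i)" if "i < n" for i
      using that by (cases i) (auto simp: ts0_def input_store_def stack_tape_def input_tape_def)
    moreover have "length ts0 = n" "\<forall>i\<ge>n. input_store (enc x) i = []"
      using n by (auto simp: ts0_def input_store_def)
    ultimately obtain ts where ts: "(step M ^^ u) (code [c], ts0) = (code [], ts)" "length ts = n"
      "\<forall>i<n. stack_tape (s i) (ts ! i)" "\<forall>i\<ge>n. s i = []"
      using sim[of u "input_store (enc x)" ts0] before us by auto
    have "[] \<in> X" by (simp add: X_def)
    then have "\<delta> (code []) (map read ts) = (if fin (tops s) then 0 else 1, map (\<lambda>i. (map read ts ! i, Stay)) [0..<n])"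
      using decode reads_tops[OF ts(2-4)] by (simp add: \<delta>_def)
    then have "fst (step M (code [], ts)) = (if P x then accept M else reject M)"
      using code2 t(3) by (simp add: M(3-5) del: neq0_conv)
    then have "fst ((step M ^^ Suc u) (initial M (enc x))) = (if P x then accept M else reject M)"
      using ts(1) unfolding initial_def M(1,2) ts0_def by (simp del: step.simps)
    moreover have "Suc u \<le> poly (p + 1) (length (enc x))" using ut t(1) by simp
    ultimately show ?thesis by blast
  qed
  then show ?thesis unfolding polytime_decidable_def using wf by blast
qed

text \<open>The exact time \<open>t'\<close> does not depend on the continuation \<open>K\<close>,
  so runs compose in any context; \<open>t\<close> is an upper bound.\<close>

definition runs :: "com \<Rightarrow> store \<Rightarrow> store \<Rightarrow> nat \<Rightarrow> bool" where
  "runs c s s' t \<longleftrightarrow> (\<exists>t'\<le>t. \<forall>K. (kstep ^^ t') (c # K, s) = (K, s'))"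

lemma runs_mono: "runs c s s' t \<Longrightarrow> t \<le> u \<Longrightarrow> runs c s s' u"
  unfolding runs_def by (meson order_trans)

lemma runs_step:
  assumes "\<And>K. kstep (c # K, s) = (K, s')"
  shows "runs c s s' 1"
  unfolding runs_def using assms by (intro exI[of _ 1]) simp

lemma runs_Grow: "runs (Grow l) s (s(l := 0 # s l)) 1"
  and runs_Write: "runs (Write l g) s (s(l := g (tops s) # tl (s l))) 1"
  and runs_Pop: "runs (Pop l) s (s(l := tl (s l))) 1"
  by (rule runs_step, simp)+

lemma runs_Seq:
  assumes "runs a s s1 t1" "runs b s1 s2 t2"
  shows "runs (a ;; b) s s2 (Suc (t1 + t2))"
proof -
  obtain u1 where u1: "u1 \<le> t1" "\<And>K. (kstep ^^ u1) (a # K, s) = (K, s1)" using assms(1) by (auto simp: runs_def)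
  obtain u2 where u2: "u2 \<le> t2" "\<And>K. (kstep ^^ u2) (b # K, s1) = (K, s2)" using assms(2) by (auto simp: runs_def)
  have "(kstep ^^ (u2 + u1 + 1)) ((a ;; b) # K, s) = (K, s2)" for K
    unfolding funpow_add comp_apply by (simp add: u1 u2)
  then show ?thesis unfolding runs_def using u1(1) u2(1) by (intro exI[of _ "u2 + u1 + 1"]) auto
qed

lemma runs_Cond:
  assumes "runs (if p (tops s) then a else b) s s' t"
  shows "runs (Cond p a b) s s' (Suc t)"
proof -
  obtain u where u: "u \<le> t" "\<And>K. (kstep ^^ u) ((if p (tops s) then a else b) # K, s) = (K, s')"
    using assms by (auto simp: runs_def)
  have "(kstep ^^ (u + 1)) (Cond p a b # K, s) = (K, s')" for K
    unfolding funpow_add comp_apply using u(2)[of K] by simp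
  then show ?thesis unfolding runs_def using u(1) by (intro exI[of _ "u + 1"]) auto
qed

lemma runs_While_done: "\<not> p (tops s) \<Longrightarrow> runs (While p a) s s 1"
  by (rule runs_step) simp

lemma runs_While_step:
  assumes "p (tops s)" "runs a s s1 t1" "runs (While p a) s1 s2 t2"
  shows "runs (While p a) s s2 (Suc (t1 + t2))"
proof -
  obtain u1 where u1: "u1 \<le> t1" "\<And>K. (kstep ^^ u1) (a # K, s) = (K, s1)" using assms(2) by (auto simp: runs_def)
  obtain u2 where u2: "u2 \<le> t2" "\<And>K. (kstep ^^ u2) (While p a # K, s1) = (K, s2)"
    using assms(3) by (auto simp: runs_def)
  have "(kstep ^^ (u2 + u1 + 1)) (While p a # K, s) = (K, s2)" for K
    unfolding funpow_add comp_apply by (simp add: u1 u2 assms(1))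
  then show ?thesis unfolding runs_def using u1(1) u2(1) by (intro exI[of _ "u2 + u1 + 1"]) auto
qed

section \<open>Arithmetic on stacks\<close>

lemma runs_eq: "runs c s s1 t \<Longrightarrow> s1 = s2 \<Longrightarrow> t \<le> u \<Longrightarrow> runs c s s2 u"
  using runs_mono by blast

definition skip :: com where "skip = While (\<lambda>_. False) (Pop 0)"

lemma runs_skip [simp]: "runs skip s s (Suc 0)"
  unfolding skip_def using runs_While_done[of "\<lambda>_. False" s "Pop 0"] by simp

definition push :: "nat \<Rightarrow> ((nat \<Rightarrow> nat) \<Rightarrow> nat) \<Rightarrow> com" where
  "push l g = (Grow l ;; Write l g)"

text \<open>\<open>g\<close> is evaluated after the new cell has been opened and therefore sees a
  blank on stack \<open>l\<close>.\<close>

lemma runs_push: "runs (push l g) s (s(l := g ((tops s)(l := 0)) # s l)) 3"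
proof -
  have "tops (s(l := 0 # s l)) = (tops s)(l := 0)" by (auto simp: fun_eq_iff)
  then show ?thesis unfolding push_def
    by (intro runs_eq[OF runs_Seq[OF runs_Grow runs_Write]]) simp_all
qed

text \<open>A transfer reverses the order. A second one restores it, and a single one exchanges the
  most and the least significant end of a number.\<close>

definition move_while :: "(nat \<Rightarrow> bool) \<Rightarrow> nat \<Rightarrow> nat \<Rightarrow> com" where
  "move_while P k l = While (\<lambda>r. P (r k)) (push l (\<lambda>r. r k) ;; Pop k)"

lemma runs_move_while:
  assumes "k \<noteq> l" "\<forall>x\<in>set xs. P x" "\<not> P (top_of ys)" "s k = xs @ ys"
  shows "runs (move_while P k l) s (s(k := ys, l := rev xs @ s l)) (6 * length xs + 1)"
  using assms(2,4)
proof (induction xs arbitrary: s)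
  case Nil
  then have eq: "s(k := ys, l := rev [] @ s l) = s" using assms(1) by (auto simp: fun_eq_iff)
  have "runs (move_while P k l) s s 1"
    unfolding move_while_def using assms(3) Nil by (intro runs_While_done) simp
  then show ?case unfolding eq by simp
next
  case (Cons x xs)
  define s1 where "s1 = s(k := xs @ ys, l := x # s l)"
  have "runs (push l (\<lambda>r. r k) ;; Pop k) s s1 5"
    by (rule runs_eq[OF runs_Seq[OF runs_push runs_Pop]])
      (use Cons.prems assms(1) in \<open>auto simp: s1_def fun_eq_iff\<close>)
  moreover have "runs (move_while P k l) s1 (s1(k := ys, l := rev xs @ s1 l)) (6 * length xs + 1)"
    using Cons assms(1) by (intro Cons.IH) (auto simp: s1_def)
  ultimately show ?case unfolding move_while_def
    using Cons.prems assms(1)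
    by (intro runs_eq[OF runs_While_step[of _ s _ s1 5]]) (auto simp: s1_def fun_eq_iff)
qed

definition clear :: "nat \<Rightarrow> com" where
  "clear k = While (\<lambda>r. r k \<noteq> 0) (Pop k)"

lemma runs_clear: "\<forall>x\<in>set (s k). x \<noteq> 0 \<Longrightarrow> runs (clear k) s (s(k := [])) (2 * length (s k) + 1)"
proof (induction "s k" arbitrary: s)
  case Nil
  then have eq: "s(k := []) = s" by auto
  have "runs (clear k) s s 1" unfolding clear_def using Nil by (intro runs_While_done) simp
  then show ?case unfolding eq using Nil by simp
next
  case (Cons x xs)
  have sk: "s k = x # xs" using Cons.hyps(2) by simp
  have "runs (clear k) (s(k := xs)) ((s(k := xs))(k := [])) (2 * length ((s(k := xs)) k) + 1)"
    using Cons.prems sk by (intro Cons.hyps(1)) auto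
  moreover have "runs (Pop k) s (s(k := xs)) 1" using runs_Pop[of k s] sk by simp
  ultimately show ?case unfolding clear_def
    using Cons.prems sk by (intro runs_eq[OF runs_While_step[of _ s _ "s(k := xs)" 1]]) auto
qed

text \<open>Use of the stacks: 0, input; 1, reversed token string; 2, \<open>\<omega>\<close>; 3, the partitions; 4 and 5,
  operands; 6, output of a pass; 7, 8, scratch; 9, result of a comparison (1 equal, 2 less,
  3 greater) or carry; 10, one plus the number of descents, capped at 3; 11 and 12, the sums
  \<open>D\<^sub>k\<close> and \<open>\<Omega>\<^sub>k\<close>; 13, the state of the automaton.\<close>

abbreviation (input) bit :: "nat \<Rightarrow> bool" where "bit x \<equiv> x = 1 \<or> x = 2"

text \<open>Numbers are stored with the least significant bit on top; the symbols 1 and 2 stand for the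
  bits 0 and 1, and an exhausted number reads as 0.\<close>

fun num :: "nat list \<Rightarrow> nat" where
  "num [] = 0"
| "num (x # xs) = (if x = 2 then 1 else 0) + 2 * num xs"

abbreviation bits :: "nat list \<Rightarrow> bool" where
  "bits xs \<equiv> \<forall>x\<in>set xs. bit x"

section \<open>Comparison of binary numbers\<close>

definition flag :: "nat \<Rightarrow> nat \<Rightarrow> nat \<Rightarrow> nat" where
  "flag m n f = (if m < n then 2 else if n < m then 3 else f)"

definition cmp_step :: "nat \<Rightarrow> nat \<Rightarrow> nat \<Rightarrow> nat" where
  "cmp_step x y f = (if (x = 2) = (y = 2) then f else if x = 2 then 3 else 2)"

text \<open>Digits arrive from the least significant end, so a later difference overrides the
  verdict so far.\<close>

fun compare_digits :: "nat list \<Rightarrow> nat list \<Rightarrow> nat \<Rightarrow> nat" where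
  "compare_digits [] [] f = f"
| "compare_digits (x # xs) [] f = compare_digits xs [] (cmp_step x 0 f)"
| "compare_digits [] (y # ys) f = compare_digits [] ys (cmp_step 0 y f)"
| "compare_digits (x # xs) (y # ys) f = compare_digits xs ys (cmp_step x y f)"

lemma compare_digits: "compare_digits xs ys f = flag (num xs) (num ys) f"
  by (induction xs ys f rule: compare_digits.induct) (auto simp: flag_def cmp_step_def)

text \<open>An exhausted operand reads as a blank, which must not be pushed on the scratch stack, so
  that the operand can be restored unchanged.\<close>

definition save :: "nat \<Rightarrow> nat \<Rightarrow> com" where
  "save k l = Cond (\<lambda>r. r k \<noteq> 0) (push l (\<lambda>r. r k) ;; Pop k) skip"

lemma runs_save:
  assumes "k \<noteq> l" "\<forall>x\<in>set (s k). x \<noteq> 0"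
  shows "runs (save k l) s (s(k := tl (s k), l := take 1 (s k) @ s l)) 6"
proof (cases "s k")
  case Nil
  then have "s(k := tl (s k), l := take 1 (s k) @ s l) = s" using assms(1) by (auto simp: fun_eq_iff)
  then show ?thesis unfolding save_def using Nil
    by (intro runs_eq[OF runs_Cond[where s' = s and t = 1]]) simp_all
next
  case (Cons x xs)
  have "runs (push l (\<lambda>r. r k) ;; Pop k) s (s(k := xs, l := x # s l)) 5"
    by (rule runs_eq[OF runs_Seq[OF runs_push runs_Pop]]) (use Cons assms(1) in \<open>auto simp: fun_eq_iff\<close>)
  then show ?thesis unfolding save_def using Cons assms
    by (intro runs_eq[OF runs_Cond[where t = 5]]) auto
qed

definition compare_body :: "nat \<Rightarrow> nat \<Rightarrow> com" where
  "compare_body a b = (Write 9 (\<lambda>r. cmp_step (r a) (r b) (r 9)) ;; save a 7 ;; save b 8)"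

lemma runs_compare_body:
  assumes ab: "a \<notin> {7, 8, 9}" "b \<notin> {7, 8, 9}" "a \<noteq> b"
    and s: "bits (s a)" "bits (s b)" "s 9 = [f]"
  shows "runs (compare_body a b) s (s(a := tl (s a), b := tl (s b), 7 := take 1 (s a) @ s 7,
    8 := take 1 (s b) @ s 8, 9 := [cmp_step (top_of (s a)) (top_of (s b)) f])) 15"
proof -
  define s1 where "s1 = s(9 := [cmp_step (top_of (s a)) (top_of (s b)) f])"
  define s2 where "s2 = s1(a := tl (s a), 7 := take 1 (s a) @ s 7)"
  define s3 where "s3 = s2(b := tl (s b), 8 := take 1 (s b) @ s 8)"
  have "runs (Write 9 (\<lambda>r. cmp_step (r a) (r b) (r 9))) s s1 1"
    by (rule runs_eq[OF runs_Write]) (use s in \<open>auto simp: s1_def\<close>)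
  moreover have "runs (save a 7) s1 s2 6"
    by (rule runs_eq[OF runs_save]) (use s ab in \<open>auto simp: s1_def s2_def\<close>)
  moreover have "runs (save b 8) s2 s3 6"
    by (rule runs_eq[OF runs_save]) (use s ab in \<open>auto simp: s1_def s2_def s3_def\<close>)
  ultimately have "runs (compare_body a b) s s3 15"
    unfolding compare_body_def by (intro runs_eq[OF runs_Seq[OF _ runs_Seq]]) auto
  moreover have "s3 = s(a := tl (s a), b := tl (s b), 7 := take 1 (s a) @ s 7,
    8 := take 1 (s b) @ s 8, 9 := [cmp_step (top_of (s a)) (top_of (s b)) f])"
    using ab by (simp add: s3_def s2_def s1_def fun_eq_iff)
  ultimately show ?thesis by simp
qed

definition compare_loop :: "nat \<Rightarrow> nat \<Rightarrow> com" where
  "compare_loop a b = While (\<lambda>r. r a \<noteq> 0 \<or> r b \<noteq> 0) (compare_body a b)"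

lemma runs_compare_loop:
  assumes ab: "a \<notin> {7, 8, 9}" "b \<notin> {7, 8, 9}" "a \<noteq> b"
  shows "bits xs \<Longrightarrow> bits ys \<Longrightarrow> s a = xs \<Longrightarrow> s b = ys \<Longrightarrow> s 9 = [f] \<Longrightarrow>
    runs (compare_loop a b) s (s(a := [], b := [], 7 := rev xs @ s 7, 8 := rev ys @ s 8,
      9 := [compare_digits xs ys f])) (16 * (length xs + length ys) + 1)"
proof (induction xs ys f arbitrary: s rule: compare_digits.induct)
  case (1 f)
  then have eq: "s(a := [], b := [], 7 := rev [] @ s 7, 8 := rev [] @ s 8, 9 := [compare_digits [] [] f]) = s"
    using ab by (simp add: fun_eq_iff)
  have "runs (compare_loop a b) s s 1"
    unfolding compare_loop_def using 1 by (intro runs_While_done) simp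
  then show ?case unfolding eq by simp
next
  case (2 x xs f)
  let ?s = "s(a := xs, b := [], 7 := x # s 7, 8 := s 8, 9 := [cmp_step x 0 f])"
  have I: "runs (compare_loop a b) ?s (?s(a := [], b := [], 7 := rev xs @ ?s 7, 8 := rev [] @ ?s 8,
      9 := [compare_digits xs [] (cmp_step x 0 f)])) (16 * (length xs + length ([] :: nat list)) + 1)"
    by (rule "2.IH") (use "2.prems" ab in auto)
  have B: "runs (compare_body a b) s ?s 15"
    by (rule runs_eq[OF runs_compare_body[where s = s and f = f, OF ab]]) (use "2.prems" ab in simp_all)
  have "x \<noteq> 0" using "2.prems" by auto
  then show ?case
    by (intro runs_eq[OF runs_While_step[OF _ B I[unfolded compare_loop_def], folded compare_loop_def]])
      (use "2.prems" ab in \<open>simp_all add: fun_eq_iff\<close>)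
next
  case (3 y ys f)
  let ?s = "s(a := [], b := ys, 7 := s 7, 8 := y # s 8, 9 := [cmp_step 0 y f])"
  have I: "runs (compare_loop a b) ?s (?s(a := [], b := [], 7 := rev [] @ ?s 7, 8 := rev ys @ ?s 8,
      9 := [compare_digits [] ys (cmp_step 0 y f)])) (16 * (length ([] :: nat list) + length ys) + 1)"
    by (rule "3.IH") (use "3.prems" ab in auto)
  have B: "runs (compare_body a b) s ?s 15"
    by (rule runs_eq[OF runs_compare_body[where s = s and f = f, OF ab]]) (use "3.prems" ab in simp_all)
  have "y \<noteq> 0" using "3.prems" by auto
  then show ?case
    by (intro runs_eq[OF runs_While_step[OF _ B I[unfolded compare_loop_def], folded compare_loop_def]])
      (use "3.prems" ab in \<open>simp_all add: fun_eq_iff\<close>)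
next
  case (4 x xs y ys f)
  let ?s = "s(a := xs, b := ys, 7 := x # s 7, 8 := y # s 8, 9 := [cmp_step x y f])"
  have I: "runs (compare_loop a b) ?s (?s(a := [], b := [], 7 := rev xs @ ?s 7, 8 := rev ys @ ?s 8,
      9 := [compare_digits xs ys (cmp_step x y f)])) (16 * (length xs + length ys) + 1)"
    by (rule "4.IH") (use "4.prems" ab in auto)
  have B: "runs (compare_body a b) s ?s 15"
    by (rule runs_eq[OF runs_compare_body[where s = s and f = f, OF ab]]) (use "4.prems" ab in simp_all)
  have "x \<noteq> 0" using "4.prems" by auto
  then show ?case
    by (intro runs_eq[OF runs_While_step[OF _ B I[unfolded compare_loop_def], folded compare_loop_def]])
      (use "4.prems" ab in \<open>simp_all add: fun_eq_iff\<close>)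
qed

definition compare :: "nat \<Rightarrow> nat \<Rightarrow> com" where
  "compare a b = (push 9 (\<lambda>_. 1) ;; compare_loop a b ;; move_while bit 7 a ;; move_while bit 8 b)"

lemma runs_compare:
  assumes ab: "a \<notin> {7, 8, 9}" "b \<notin> {7, 8, 9}" "a \<noteq> b"
    and s: "bits (s a)" "bits (s b)" "s 7 = []" "s 8 = []" "s 9 = []"
  shows "runs (compare a b) s (s(9 := [flag (num (s a)) (num (s b)) 1]))
    (22 * (length (s a) + length (s b)) + 20)"
proof -
  define s1 where "s1 = s(9 := [1])"
  define s2 where "s2 = s1(a := [], b := [], 7 := rev (s a), 8 := rev (s b),
    9 := [flag (num (s a)) (num (s b)) 1])"
  define s3 where "s3 = s2(7 := [], a := s a)"
  define s4 where "s4 = s3(8 := [], b := s b)"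
  have "runs (push 9 (\<lambda>_. 1)) s s1 3"
    by (rule runs_eq[OF runs_push]) (use s in \<open>auto simp: s1_def\<close>)
  moreover have "runs (compare_loop a b) s1 s2 (16 * (length (s a) + length (s b)) + 1)"
    by (rule runs_eq[OF runs_compare_loop[OF ab s(1,2)]]) (use s ab in \<open>auto simp: s1_def s2_def compare_digits\<close>)
  moreover have "runs (move_while bit 7 a) s2 s3 (6 * length (s a) + 1)"
    by (rule runs_eq[OF runs_move_while[where xs = "rev (s a)" and ys = "[]"]])
      (use s ab in \<open>auto simp: s1_def s2_def s3_def\<close>)
  moreover have "runs (move_while bit 8 b) s3 s4 (6 * length (s b) + 1)"
    by (rule runs_eq[OF runs_move_while[where xs = "rev (s b)" and ys = "[]"]])
      (use s ab in \<open>auto simp: s1_def s2_def s3_def s4_def\<close>)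
  ultimately have "runs (compare a b) s s4 (22 * (length (s a) + length (s b)) + 20)"
    unfolding compare_def by (intro runs_eq[OF runs_Seq[OF _ runs_Seq[OF _ runs_Seq]]]) auto
  moreover have "s4 = s(9 := [flag (num (s a)) (num (s b)) 1])"
    using ab s by (auto simp: s4_def s3_def s2_def s1_def fun_eq_iff)
  ultimately show ?thesis by simp
qed

section \<open>Binary addition\<close>

definition sum_bit :: "nat \<Rightarrow> nat \<Rightarrow> nat \<Rightarrow> nat" where
  "sum_bit x y c = (if (x = 2) = ((y = 2) = (c = 2)) then 2 else 1)"

definition carry_bit :: "nat \<Rightarrow> nat \<Rightarrow> nat \<Rightarrow> nat" where
  "carry_bit x y c = (if (if c = 2 then x = 2 \<or> y = 2 else x = 2 \<and> y = 2) then 2 else 1)"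

fun add_digits :: "nat list \<Rightarrow> nat list \<Rightarrow> nat \<Rightarrow> nat list" where
  "add_digits [] [] c = []"
| "add_digits (x # xs) [] c = sum_bit x 0 c # add_digits xs [] (carry_bit x 0 c)"
| "add_digits [] (y # ys) c = sum_bit 0 y c # add_digits [] ys (carry_bit 0 y c)"
| "add_digits (x # xs) (y # ys) c = sum_bit x y c # add_digits xs ys (carry_bit x y c)"

fun carry :: "nat list \<Rightarrow> nat list \<Rightarrow> nat \<Rightarrow> nat" where
  "carry [] [] c = c"
| "carry (x # xs) [] c = carry xs [] (carry_bit x 0 c)"
| "carry [] (y # ys) c = carry [] ys (carry_bit 0 y c)"
| "carry (x # xs) (y # ys) c = carry xs ys (carry_bit x y c)"

definition sum_bits :: "nat list \<Rightarrow> nat list \<Rightarrow> nat \<Rightarrow> nat list" where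
  "sum_bits xs ys c = add_digits xs ys c @ (if carry xs ys c = 2 then [2] else [])"

lemma num_sum_bits: "num (sum_bits xs ys c) = num xs + num ys + (if c = 2 then 1 else 0)"
  unfolding sum_bits_def by (induction xs ys c rule: add_digits.induct) (auto simp: sum_bit_def carry_bit_def)

lemma bits_sum_bits: "bits (sum_bits xs ys c)"
proof -
  have "bits (add_digits xs ys c)" by (induction xs ys c rule: add_digits.induct) (auto simp: sum_bit_def)
  then show ?thesis by (auto simp: sum_bits_def)
qed

lemma length_add_digits: "length (add_digits xs ys c) = max (length xs) (length ys)"
  by (induction xs ys c rule: add_digits.induct) auto

text \<open>The bound has the form required by the space budget: a number consumed from the input
  frees its bits and its comma, that is \<open>length xs + 1\<close> cells.\<close>

lemma length_sum_bits: "length (sum_bits xs ys c) \<le> length xs + length ys + 1"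
  by (simp add: sum_bits_def length_add_digits)

definition add_loop :: "nat \<Rightarrow> com" where
  "add_loop d = While (\<lambda>r. r 4 \<noteq> 0 \<or> r d \<noteq> 0)
     (push 7 (\<lambda>r. sum_bit (r 4) (r d) (r 9)) ;; Write 9 (\<lambda>r. carry_bit (r 4) (r d) (r 9)) ;; Pop 4 ;; Pop d)"

lemma runs_add_body:
  assumes d: "d \<notin> {4, 7, 9}" and s: "s 9 = [c]"
  shows "runs (push 7 (\<lambda>r. sum_bit (r 4) (r d) (r 9)) ;; Write 9 (\<lambda>r. carry_bit (r 4) (r d) (r 9)) ;; Pop 4 ;; Pop d) s
    (s(4 := tl (s 4), d := tl (s d), 7 := sum_bit (top_of (s 4)) (top_of (s d)) c # s 7,
      9 := [carry_bit (top_of (s 4)) (top_of (s d)) c])) 9"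
  by (rule runs_eq[OF runs_Seq[OF runs_push runs_Seq[OF runs_Write runs_Seq[OF runs_Pop runs_Pop]]]])
    (use d s in \<open>auto simp: fun_eq_iff\<close>)

lemma runs_add_loop:
  assumes d: "d \<notin> {4, 7, 9}"
  shows "bits xs \<Longrightarrow> bits ys \<Longrightarrow> s 4 = xs \<Longrightarrow> s d = ys \<Longrightarrow> s 9 = [c] \<Longrightarrow>
    runs (add_loop d) s (s(4 := [], d := [], 7 := rev (add_digits xs ys c) @ s 7, 9 := [carry xs ys c]))
      (10 * (length xs + length ys) + 1)"
proof (induction xs ys c arbitrary: s rule: add_digits.induct)
  case (1 c)
  then have eq: "s(4 := [], d := [], 7 := rev (add_digits [] [] c) @ s 7, 9 := [carry [] [] c]) = s"
    using d by (auto simp: fun_eq_iff)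
  have "runs (add_loop d) s s 1"
    unfolding add_loop_def using 1 by (intro runs_While_done) simp
  then show ?case unfolding eq by simp
next
  case (2 x xs c)
  let ?s = "s(4 := xs, d := [], 7 := sum_bit x 0 c # s 7, 9 := [carry_bit x 0 c])"
  have "runs (add_loop d) ?s (?s(4 := [], d := [], 7 := rev (add_digits xs [] (carry_bit x 0 c)) @ ?s 7,
      9 := [carry xs [] (carry_bit x 0 c)])) (10 * (length xs + length ([] :: nat list)) + 1)"
    by (rule "2.IH") (use "2.prems" d in auto)
  then show ?case unfolding add_loop_def using "2.prems" d
    by (intro runs_eq[OF runs_While_step[OF _ runs_add_body[where s = s and c = c, OF d]]]) (auto simp: fun_eq_iff)
next
  case (3 y ys c)
  let ?s = "s(4 := [], d := ys, 7 := sum_bit 0 y c # s 7, 9 := [carry_bit 0 y c])"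
  have "runs (add_loop d) ?s (?s(4 := [], d := [], 7 := rev (add_digits [] ys (carry_bit 0 y c)) @ ?s 7,
      9 := [carry [] ys (carry_bit 0 y c)])) (10 * (length ([] :: nat list) + length ys) + 1)"
    by (rule "3.IH") (use "3.prems" d in auto)
  then show ?case unfolding add_loop_def using "3.prems" d
    by (intro runs_eq[OF runs_While_step[OF _ runs_add_body[where s = s and c = c, OF d]]]) (auto simp: fun_eq_iff)
next
  case (4 x xs y ys c)
  let ?s = "s(4 := xs, d := ys, 7 := sum_bit x y c # s 7, 9 := [carry_bit x y c])"
  have "runs (add_loop d) ?s (?s(4 := [], d := [], 7 := rev (add_digits xs ys (carry_bit x y c)) @ ?s 7,
      9 := [carry xs ys (carry_bit x y c)])) (10 * (length xs + length ys) + 1)"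
    by (rule "4.IH") (use "4.prems" d in auto)
  then show ?case unfolding add_loop_def using "4.prems" d
    by (intro runs_eq[OF runs_While_step[OF _ runs_add_body[where s = s and c = c, OF d]]]) (auto simp: fun_eq_iff)
qed

definition add_to :: "nat \<Rightarrow> com" where
  "add_to d = (push 9 (\<lambda>_. 1) ;; add_loop d ;; Cond (\<lambda>r. r 9 = 2) (push 7 (\<lambda>_. 2)) skip ;; Pop 9 ;;
     move_while bit 7 d)"

lemma runs_add_to:
  assumes d: "d \<notin> {4, 7, 9}" and s: "bits (s 4)" "bits (s d)" "s 7 = []" "s 9 = []"
  shows "runs (add_to d) s (s(4 := [], d := sum_bits (s 4) (s d) 1)) (16 * (length (s 4) + length (s d)) + 30)"
proof -
  let ?xs = "s 4" and ?ys = "s d"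
  let ?z = "sum_bits ?xs ?ys 1"
  define s1 where "s1 = s(9 := [1])"
  define s2 where "s2 = s1(4 := [], d := [], 7 := rev (add_digits ?xs ?ys 1), 9 := [carry ?xs ?ys 1])"
  define s3 where "s3 = s2(7 := rev ?z)"
  define s4 where "s4 = s3(9 := [])"
  define s5 where "s5 = s4(7 := [], d := ?z)"
  have "runs (push 9 (\<lambda>_. 1)) s s1 3"
    by (rule runs_eq[OF runs_push]) (use s in \<open>auto simp: s1_def\<close>)
  moreover have "runs (add_loop d) s1 s2 (10 * (length ?xs + length ?ys) + 1)"
    by (rule runs_eq[OF runs_add_loop[OF d s(1,2)]]) (use s d in \<open>auto simp: s1_def s2_def\<close>)
  moreover have "runs (Cond (\<lambda>r. r 9 = 2) (push 7 (\<lambda>_. 2)) skip) s2 s3 4"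
  proof (cases "carry ?xs ?ys 1 = 2")
    case True
    have "runs (push 7 (\<lambda>_. 2)) s2 s3 3"
      by (rule runs_eq[OF runs_push]) (use True in \<open>auto simp: s2_def s3_def sum_bits_def\<close>)
    then show ?thesis using True by (intro runs_eq[OF runs_Cond[where t = 3]]) (auto simp: s2_def)
  next
    case False
    then have "s3 = s2" using d by (auto simp: s2_def s3_def sum_bits_def)
    then show ?thesis using False
      by (intro runs_eq[OF runs_Cond[where t = 1]]) (auto simp: s2_def)
  qed
  moreover have "runs (Pop 9) s3 s4 1"
    by (rule runs_eq[OF runs_Pop]) (auto simp: s2_def s3_def s4_def)
  moreover have "runs (move_while bit 7 d) s4 s5 (6 * length ?z + 1)"
    by (rule runs_eq[OF runs_move_while[where xs = "rev ?z" and ys = "[]"]])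
      (use d bits_sum_bits[of ?xs ?ys 1] in \<open>auto simp: s1_def s2_def s3_def s4_def s5_def\<close>)
  ultimately have "runs (add_to d) s s5 (16 * (length ?xs + length ?ys) + 30)"
    unfolding add_to_def using length_sum_bits[of ?xs ?ys 1]
    by (intro runs_eq[OF runs_Seq[OF _ runs_Seq[OF _ runs_Seq[OF _ runs_Seq]]]]) auto
  moreover have "s5 = s(4 := [], d := ?z)"
    using d s by (auto simp: s5_def s4_def s3_def s2_def s1_def fun_eq_iff)
  ultimately show ?thesis by simp
qed

section \<open>Token lists\<close>

definition lsb :: "nat \<Rightarrow> nat list" where
  "lsb n = rev (map (\<lambda>b. if b then 2 else 1) (binary n))"

text \<open>The token strings: 1 and 2 are bits, 3 is the comma and 4 the semicolon.\<close>

definition num_tokens :: "nat \<Rightarrow> nat list" where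
  "num_tokens n = rev (lsb n) @ [3]"

definition tuple_tokens :: "nat list \<Rightarrow> nat list" where
  "tuple_tokens l = concat (map num_tokens l)"

definition family_tokens :: "nat list list \<Rightarrow> nat list" where
  "family_tokens ls = concat (map (\<lambda>l. tuple_tokens l @ [4]) ls)"

lemma bits_lsb: "bits (lsb n)"
  by (auto simp: lsb_def)

lemma bit_lsb: "x \<in> set (lsb n) \<Longrightarrow> bit x"
  by (auto simp: lsb_def)

lemma num_lsb [simp]: "num (lsb n) = n"
proof (induction n rule: binary.induct)
  case (1 n)
  show ?case
  proof (cases "n < 2")
    case True
    then show ?thesis by (auto simp: lsb_def binary.simps[of n])
  next
    case False
    then show ?thesis using 1 by (auto simp: lsb_def binary.simps[of n] elim!: oddE)
  qed
qed

lemma lsb_nonempty: "lsb n \<noteq> []"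
  by (subst lsb_def, subst binary.simps) simp

lemma token_lists [simp]:
  "tuple_tokens [] = []" "tuple_tokens (x # l) = num_tokens x @ tuple_tokens l"
  "family_tokens [] = []" "family_tokens (l # ls) = tuple_tokens l @ 4 # family_tokens ls"
  by (simp_all add: tuple_tokens_def family_tokens_def)

lemma tuple_tokens_range: "x \<in> set (tuple_tokens l) \<Longrightarrow> x \<noteq> 0 \<and> x \<noteq> 4"
  by (induction l) (auto simp: num_tokens_def dest: bit_lsb)

lemma family_tokens_range: "x \<in> set (family_tokens ls) \<Longrightarrow> x \<noteq> 0"
  by (induction ls) (auto dest: tuple_tokens_range)

lemma top_num_tokens: "top_of (num_tokens n @ ys) \<noteq> 0" "top_of (num_tokens n @ ys) \<noteq> 4"
proof -
  obtain x xs where "rev (lsb n) = x # xs" using lsb_nonempty[of n] by (cases "rev (lsb n)") auto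
  moreover from this have "bit x" using bit_lsb[of x n] by (metis list.set_intros(1) set_rev)
  ultimately show "top_of (num_tokens n @ ys) \<noteq> 0" "top_of (num_tokens n @ ys) \<noteq> 4"
    by (auto simp: num_tokens_def)
qed

lemma length_num_tokens [simp]: "length (num_tokens n) = Suc (length (lsb n))"
  by (simp add: num_tokens_def)

text \<open>Tokens have the most significant bit on top; the reversal by the transfer puts the least
  significant bit on top, as the arithmetic expects.\<close>

definition get_num :: "nat \<Rightarrow> nat \<Rightarrow> com" where
  "get_num k l = (move_while bit k l ;; Pop k)"

lemma runs_get_num:
  assumes "k \<noteq> l" "s k = num_tokens n @ ys"
  shows "runs (get_num k l) s (s(k := ys, l := lsb n @ s l)) (6 * length (lsb n) + 3)"
  unfolding get_num_def
  by (rule runs_eq[OF runs_Seq[OF runs_move_while[where xs = "rev (lsb n)" and ys = "3 # ys"] runs_Pop]])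
    (use assms bits_lsb[of n] in \<open>auto simp: num_tokens_def fun_eq_iff\<close>)

definition put_num :: "nat \<Rightarrow> nat \<Rightarrow> com" where
  "put_num k l = (push l (\<lambda>_. 3) ;; move_while bit k l)"

lemma runs_put_num:
  assumes "k \<noteq> l" "s k = lsb n"
  shows "runs (put_num k l) s (s(k := [], l := num_tokens n @ s l)) (6 * length (lsb n) + 5)"
  unfolding put_num_def
  by (rule runs_eq[OF runs_Seq[OF runs_push runs_move_while[where xs = "lsb n" and ys = "[]"]]])
    (use assms bits_lsb[of n] in \<open>auto simp: num_tokens_def fun_eq_iff\<close>)

section \<open>Extraction of the largest entry\<close>

fun bubble :: "nat \<Rightarrow> nat list \<Rightarrow> nat list \<Rightarrow> nat \<times> nat list" where
  "bubble m [] out = (m, out)"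
| "bubble m (x # xs) out = (if m < x then bubble x xs (m # out) else bubble m xs (x # out))"

lemma bubble_mset: "bubble m xs out = (k, rest) \<Longrightarrow> mset (k # rest) = mset (m # xs @ out)"
  by (induction m xs out rule: bubble.induct) (auto split: if_splits simp: add_mset_commute)

lemma bubble_max: "bubble m xs out = (k, rest) \<Longrightarrow> \<forall>x\<in>set out. x \<le> m \<Longrightarrow> \<forall>x\<in>set rest. x \<le> k"
  by (induction m xs out rule: bubble.induct) (fastforce split: if_splits)+

text \<open>A new maximum travels from stack 5 to stack 4 through stack 7, since two transfers keep
  its least significant bit on top.\<close>

definition select_body :: com where
  "select_body = (get_num 2 5 ;; compare 4 5 ;;
     Cond (\<lambda>r. r 9 = 2) (put_num 4 6 ;; move_while bit 5 7 ;; move_while bit 7 4) (put_num 5 6) ;; Pop 9)"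

lemma runs_select_body:
  assumes s: "s 2 = num_tokens x @ ys" "s 4 = lsb m" "s 5 = []" "s 7 = []" "s 8 = []" "s 9 = []"
  shows "runs select_body s (s(2 := ys, 4 := lsb (max m x), 6 := num_tokens (min m x) @ s 6))
    (40 * (length (lsb m) + length (lsb x)) + 60)"
proof -
  define s1 where "s1 = s(2 := ys, 5 := lsb x)"
  define s2 where "s2 = s1(9 := [flag m x 1])"
  define s3 where "s3 = s2(4 := lsb (max m x), 5 := [], 6 := num_tokens (min m x) @ s 6)"
  have "runs (get_num 2 5) s s1 (6 * length (lsb x) + 3)"
    by (rule runs_eq[OF runs_get_num]) (use s in \<open>auto simp: s1_def\<close>)
  moreover have "runs (compare 4 5) s1 s2 (22 * (length (lsb m) + length (lsb x)) + 20)"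
    by (rule runs_eq[OF runs_compare]) (use s bit_lsb in \<open>auto simp: s1_def s2_def\<close>)
  moreover have "runs (Cond (\<lambda>r. r 9 = 2) (put_num 4 6 ;; move_while bit 5 7 ;; move_while bit 7 4) (put_num 5 6))
    s2 s3 (12 * (length (lsb m) + length (lsb x)) + 20)"
  proof (cases "m < x")
    case True
    define u1 where "u1 = s2(4 := [], 6 := num_tokens m @ s 6)"
    define u2 where "u2 = u1(5 := [], 7 := rev (lsb x))"
    have "runs (put_num 4 6) s2 u1 (6 * length (lsb m) + 5)"
      by (rule runs_eq[OF runs_put_num[where n = m]]) (use s in \<open>auto simp: s1_def s2_def u1_def\<close>)
    moreover have "runs (move_while bit 5 7) u1 u2 (6 * length (lsb x) + 1)"
      by (rule runs_eq[OF runs_move_while[where xs = "lsb x" and ys = "[]"]])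
        (use s bit_lsb in \<open>auto simp: s1_def s2_def u1_def u2_def\<close>)
    moreover have "runs (move_while bit 7 4) u2 s3 (6 * length (lsb x) + 1)"
      by (rule runs_eq[OF runs_move_while[where xs = "rev (lsb x)" and ys = "[]"]])
        (use s bit_lsb True in \<open>auto simp: s1_def s2_def u1_def u2_def s3_def fun_eq_iff max_def min_def\<close>)
    ultimately have "runs (put_num 4 6 ;; move_while bit 5 7 ;; move_while bit 7 4) s2 s3
        (12 * (length (lsb m) + length (lsb x)) + 19)"
      by (intro runs_eq[OF runs_Seq[OF _ runs_Seq]]) auto
    then show ?thesis using True
      by (intro runs_eq[OF runs_Cond[where t = "12 * (length (lsb m) + length (lsb x)) + 19"]])
        (auto simp: s2_def flag_def)
  next
    case False
    have "runs (put_num 5 6) s2 s3 (6 * length (lsb x) + 5)"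
      by (rule runs_eq[OF runs_put_num[where n = x]])
        (use s False in \<open>auto simp: s1_def s2_def s3_def fun_eq_iff max_def min_def\<close>)
    then show ?thesis using False
      by (intro runs_eq[OF runs_Cond[where t = "6 * length (lsb x) + 5"]]) (auto simp: s2_def flag_def)
  qed
  moreover have "runs (Pop 9) s3 (s(2 := ys, 4 := lsb (max m x), 6 := num_tokens (min m x) @ s 6)) 1"
    by (rule runs_eq[OF runs_Pop]) (use s in \<open>auto simp: s1_def s2_def s3_def fun_eq_iff\<close>)
  ultimately show ?thesis unfolding select_body_def
    by (intro runs_eq[OF runs_Seq[OF _ runs_Seq[OF _ runs_Seq]]]) auto
qed

definition select_loop :: com where
  "select_loop = While (\<lambda>r. r 2 \<noteq> 0) select_body"

lemma runs_select_loop: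
  assumes "bubble m xs out = (k, rest)"
    and s: "s 2 = tuple_tokens xs" "s 4 = lsb m" "s 5 = []" "s 6 = tuple_tokens out" "s 7 = []" "s 8 = []" "s 9 = []"
    and N: "length (lsb m) + length (tuple_tokens xs) \<le> N"
  shows "runs select_loop s (s(2 := [], 4 := lsb k, 6 := tuple_tokens rest)) (length xs * (40 * N + 61) + 1)"
  using assms
proof (induction m xs out arbitrary: s rule: bubble.induct)
  case (1 m out)
  then have eq: "s(2 := [], 4 := lsb k, 6 := tuple_tokens rest) = s" by (simp add: fun_eq_iff)
  have "runs select_loop s s 1" unfolding select_loop_def using 1 by (intro runs_While_done) simp
  then show ?case unfolding eq by simp
next
  case (2 m x xs out)
  let ?s = "s(2 := tuple_tokens xs, 4 := lsb (max m x), 6 := num_tokens (min m x) @ s 6)"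
  have B: "runs select_body s ?s (40 * N + 60)"
    by (rule runs_eq[OF runs_select_body]) (use "2.prems" in auto)
  have I: "runs select_loop ?s (?s(2 := [], 4 := lsb k, 6 := tuple_tokens rest)) (length xs * (40 * N + 61) + 1)"
  proof (cases "m < x")
    case True
    show ?thesis by (rule "2.IH"(1)[OF True]) (use "2.prems" True in \<open>auto simp: max_def min_def\<close>)
  next
    case False
    show ?thesis by (rule "2.IH"(2)[OF False]) (use "2.prems" False in \<open>auto simp: max_def min_def\<close>)
  qed
  have "top_of (s 2) \<noteq> 0" using "2.prems" top_num_tokens(1) by simp
  then show ?case
    by (intro runs_eq[OF runs_While_step[OF _ B I[unfolded select_loop_def], folded select_loop_def]])
      (simp_all add: fun_eq_iff)
qed

text \<open>The order of the remaining entries may change in every pass; only their multiset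
  matters.\<close>

definition select :: com where
  "select = (get_num 2 4 ;; select_loop ;; move_while (\<lambda>x. x \<noteq> 0) 6 7 ;; move_while (\<lambda>x. x \<noteq> 0) 7 2)"

lemma length_le_tuple_tokens: "length l \<le> length (tuple_tokens l)"
  by (induction l) auto

lemma length_tuple_tokens_mset: "mset l = mset l' \<Longrightarrow> length (tuple_tokens l) = length (tuple_tokens l')"
proof -
  have "length (tuple_tokens l) = sum_mset (image_mset (\<lambda>n. length (num_tokens n)) (mset l))" for l
    by (induction l) auto
  then show "mset l = mset l' \<Longrightarrow> length (tuple_tokens l) = length (tuple_tokens l')" by metis
qed

lemma runs_select:
  assumes b: "bubble x xs [] = (k, rest)"
    and s: "s 2 = tuple_tokens (x # xs)" "s 4 = []" "s 5 = []" "s 6 = []" "s 7 = []" "s 8 = []" "s 9 = []"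
    and N: "length (tuple_tokens (x # xs)) \<le> N"
  shows "runs select s (s(2 := tuple_tokens rest, 4 := lsb k)) (N * (40 * N + 100) + 20)"
proof -
  define s1 where "s1 = s(2 := tuple_tokens xs, 4 := lsb x)"
  define s2 where "s2 = s1(2 := [], 4 := lsb k, 6 := tuple_tokens rest)"
  define s3 where "s3 = s2(6 := [], 7 := rev (tuple_tokens rest))"
  define s4 where "s4 = s3(7 := [], 2 := tuple_tokens rest)"
  have len: "length (lsb k) + length (tuple_tokens rest) < N" "length xs < N" "length (lsb x) < N"
    using N length_tuple_tokens_mset[OF bubble_mset[OF b]] length_le_tuple_tokens[of xs] by simp_all
  have "runs (get_num 2 4) s s1 (6 * N + 3)"
    by (rule runs_eq[OF runs_get_num]) (use s len in \<open>auto simp: s1_def\<close>)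
  moreover have "runs select_loop s1 s2 (N * (40 * N + 61) + 1)"
  proof (rule runs_eq[OF runs_select_loop[OF b, where N = N]])
    show "length xs * (40 * N + 61) + 1 \<le> N * (40 * N + 61) + 1" using len(2) by simp
  qed (use s N in \<open>auto simp: s1_def s2_def\<close>)
  moreover have "runs (move_while (\<lambda>x. x \<noteq> 0) 6 7) s2 s3 (6 * N + 1)"
    by (rule runs_eq[OF runs_move_while[where xs = "tuple_tokens rest" and ys = "[]"]])
      (use s len tuple_tokens_range in \<open>auto simp: s1_def s2_def s3_def\<close>)
  moreover have "runs (move_while (\<lambda>x. x \<noteq> 0) 7 2) s3 s4 (6 * N + 1)"
    by (rule runs_eq[OF runs_move_while[where xs = "rev (tuple_tokens rest)" and ys = "[]"]])
      (use s len tuple_tokens_range in \<open>auto simp: s1_def s2_def s3_def s4_def\<close>)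
  moreover have "s4 = s(2 := tuple_tokens rest, 4 := lsb k)"
    using s by (simp add: s1_def s2_def s3_def s4_def fun_eq_iff)
  ultimately show ?thesis unfolding select_def
    by (intro runs_eq[OF runs_Seq[OF _ runs_Seq[OF _ runs_Seq]]]) (auto simp: algebra_simps)
qed

section \<open>Removal of the first rows and count of descents\<close>

definition mark :: com where
  "mark = Write 10 (\<lambda>r. if r 10 = 1 then 2 else 3)"

definition copy :: com where
  "copy = While (\<lambda>r. bit (r 3)) (push 5 (\<lambda>r. r 3) ;; push 6 (\<lambda>r. r 3) ;; Pop 3)"

lemma runs_copy:
  assumes "bits xs" "\<not> bit (top_of ys)" "s 3 = xs @ ys"
  shows "runs copy s (s(3 := ys, 5 := rev xs @ s 5, 6 := rev xs @ s 6)) (10 * length xs + 1)"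
  using assms(1,3)
proof (induction xs arbitrary: s)
  case Nil
  then have eq: "s(3 := ys, 5 := rev [] @ s 5, 6 := rev [] @ s 6) = s" by (simp add: fun_eq_iff)
  have "runs copy s s 1" unfolding copy_def using assms(2) Nil by (intro runs_While_done) simp
  then show ?case unfolding eq by simp
next
  case (Cons x xs)
  let ?s = "s(3 := xs @ ys, 5 := x # s 5, 6 := x # s 6)"
  have B: "runs (push 5 (\<lambda>r. r 3) ;; push 6 (\<lambda>r. r 3) ;; Pop 3) s ?s 9"
    by (rule runs_eq[OF runs_Seq[OF runs_push runs_Seq[OF runs_push runs_Pop]]])
      (use Cons.prems in \<open>simp_all add: fun_eq_iff\<close>)
  have I: "runs copy ?s (?s(3 := ys, 5 := rev xs @ ?s 5, 6 := rev xs @ ?s 6)) (10 * length xs + 1)"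
    by (rule Cons.IH) (use Cons.prems in auto)
  have "bit (top_of (s 3))" using Cons.prems by simp
  then show ?case
    by (intro runs_eq[OF runs_While_step[OF _ B I[unfolded copy_def], folded copy_def]])
      (simp_all add: fun_eq_iff)
qed

text \<open>With the first entry of a tuple on stack 4, decides whether a strictly smaller entry
  follows, and moves that entry on.\<close>

definition peek :: com where
  "peek = Cond (\<lambda>r. r 3 = 4) mark
     (copy ;; push 6 (\<lambda>_. 3) ;; Pop 3 ;; compare 4 5 ;; clear 5 ;; Cond (\<lambda>r. r 9 = 1) skip mark ;; Pop 9)"

text \<open>The next entry can be inspected only by popping it, so it is copied twice: to stack 5
  for the comparison and to stack 6, the output of the pass, where tokens are kept reversed. The end
  of the tuple counts as a descent.\<close>

lemma runs_peek:
  assumes s: "s 3 = tuple_tokens l @ 4 # ys" "s 4 = lsb x" "s 5 = []" "s 7 = []" "s 8 = []" "s 9 = []"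
      "s 10 = [c]" "c \<in> {1, 2, 3}"
    and N: "length (lsb x) + length (tuple_tokens l) \<le> N"
  shows "runs peek s (s(3 := tuple_tokens (tl l) @ 4 # ys, 6 := rev (tuple_tokens (take 1 l)) @ s 6,
    10 := [min 3 (c + (if drops_at_head (x # l) then 1 else 0))])) (40 * N + 60)"
proof (cases l)
  case Nil
  have "runs mark s (s(3 := tuple_tokens (tl l) @ 4 # ys, 6 := rev (tuple_tokens (take 1 l)) @ s 6,
    10 := [min 3 (c + (if drops_at_head (x # l) then 1 else 0))])) 1"
    unfolding mark_def by (rule runs_eq[OF runs_Write])
      (use s Nil in \<open>auto simp: drops_at_head_def fun_eq_iff\<close>)
  then show ?thesis unfolding peek_def using s Nil
    by (intro runs_eq[OF runs_Cond[where t = 1]]) simp_all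
next
  case (Cons y l')
  define s1 where "s1 = s(3 := 3 # tuple_tokens l' @ 4 # ys, 5 := lsb y, 6 := lsb y @ s 6)"
  define s2 where "s2 = s1(6 := 3 # lsb y @ s 6)"
  define s3 where "s3 = s2(3 := tuple_tokens l' @ 4 # ys)"
  define s4 where "s4 = s3(9 := [flag x y 1])"
  define s5 where "s5 = s4(5 := [])"
  define s6 where "s6 = s5(10 := [min 3 (c + (if drops_at_head (x # l) then 1 else 0))])"
  define s7 where "s7 = s6(9 := [])"
  have len: "length (lsb y) < N" "length (lsb x) + length (lsb y) < N" using N Cons by auto
  have "runs copy s s1 (10 * N + 1)"
    by (rule runs_eq[OF runs_copy[where xs = "rev (lsb y)" and ys = "3 # tuple_tokens l' @ 4 # ys"]])
      (use s len Cons bit_lsb in \<open>auto simp: s1_def num_tokens_def\<close>)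
  moreover have "runs (push 6 (\<lambda>_. 3)) s1 s2 3"
    by (rule runs_eq[OF runs_push]) (simp_all add: s1_def s2_def)
  moreover have "runs (Pop 3) s2 s3 1"
    by (rule runs_eq[OF runs_Pop]) (simp_all add: s1_def s2_def s3_def)
  moreover have "runs (compare 4 5) s3 s4 (22 * N + 20)"
    by (rule runs_eq[OF runs_compare])
      (use s len bit_lsb in \<open>auto simp: s1_def s2_def s3_def s4_def\<close>)
  moreover have "runs (clear 5) s4 s5 (2 * N + 1)"
    by (rule runs_eq[OF runs_clear])
      (use s len bit_lsb in \<open>fastforce simp: s1_def s2_def s3_def s4_def s5_def\<close>)+
  moreover have "runs (Cond (\<lambda>r. r 9 = 1) skip mark) s5 s6 2"
  proof (cases "x = y")
    case True
    then have "s6 = s5"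
      using s Cons by (auto simp: s1_def s2_def s3_def s4_def s5_def s6_def drops_at_head_def fun_eq_iff)
    then show ?thesis using True
      by (intro runs_eq[OF runs_Cond[where t = 1]]) (simp_all add: s4_def s5_def flag_def)
  next
    case False
    have "runs mark s5 s6 1" unfolding mark_def
      by (rule runs_eq[OF runs_Write])
        (use s Cons False in \<open>auto simp: s1_def s2_def s3_def s4_def s5_def s6_def drops_at_head_def\<close>)
    then show ?thesis using False
      by (intro runs_eq[OF runs_Cond[where t = 1]]) (auto simp: s4_def s5_def flag_def)
  qed
  moreover have "runs (Pop 9) s6 s7 1"
    by (rule runs_eq[OF runs_Pop]) (simp_all add: s4_def s5_def s6_def s7_def)
  ultimately have "runs (copy ;; push 6 (\<lambda>_. 3) ;; Pop 3 ;; compare 4 5 ;; clear 5 ;;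
      Cond (\<lambda>r. r 9 = 1) skip mark ;; Pop 9) s s7 (40 * N + 50)"
    by (intro runs_eq[OF runs_Seq[OF _ runs_Seq[OF _ runs_Seq[OF _ runs_Seq[OF _ runs_Seq[OF _ runs_Seq]]]]]]) auto
  moreover have "s7 = s(3 := tuple_tokens (tl l) @ 4 # ys, 6 := rev (tuple_tokens (take 1 l)) @ s 6,
    10 := [min 3 (c + (if drops_at_head (x # l) then 1 else 0))])"
    using s Cons by (simp add: s1_def s2_def s3_def s4_def s5_def s6_def s7_def num_tokens_def fun_eq_iff)
  moreover have "top_of (s 3) \<noteq> 4" using s Cons top_num_tokens(2) by simp
  ultimately show ?thesis unfolding peek_def
    by (intro runs_eq[OF runs_Cond[where t = "40 * N + 50"]]) simp_all
qed

definition row_body :: com where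
  "row_body = Cond (\<lambda>r. r 3 = 4) (push 6 (\<lambda>_. 4) ;; Pop 3)
     (get_num 3 4 ;; peek ;; add_to 11 ;; move_while (\<lambda>x. x \<noteq> 0 \<and> x \<noteq> 4) 3 6 ;; push 6 (\<lambda>_. 4) ;; Pop 3)"

text \<open>The last conclusion is the space budget: the cells gained by the sum on stack 11 are
  paid for by the removed entry and its comma.\<close>

lemma runs_row_body:
  assumes s: "s 3 = tuple_tokens l @ 4 # ys" "s 4 = []" "s 5 = []" "s 7 = []" "s 8 = []" "s 9 = []"
      "s 10 = [c]" "c \<in> {1, 2, 3}" "bits (s 11)"
    and N: "length (tuple_tokens l) + length (s 11) \<le> N"
  shows "\<exists>d. runs row_body s (s(3 := ys, 6 := 4 # rev (tuple_tokens (tl l)) @ s 6,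
      10 := [min 3 (c + (if drops_at_head l then 1 else 0))], 11 := d)) (100 * N + 200) \<and>
    bits d \<and> num d = num (s 11) + (case l of [] \<Rightarrow> 0 | x # _ \<Rightarrow> x) \<and>
    length d + length (tuple_tokens (tl l)) \<le> length (s 11) + length (tuple_tokens l)"
proof (cases l)
  case Nil
  have "runs (push 6 (\<lambda>_. 4) ;; Pop 3) s (s(3 := ys, 6 := 4 # rev (tuple_tokens (tl l)) @ s 6,
      10 := [min 3 (c + (if drops_at_head l then 1 else 0))], 11 := s 11)) 5"
    by (rule runs_eq[OF runs_Seq[OF runs_push runs_Pop]])
      (use s Nil in \<open>auto simp: fun_eq_iff drops_at_head_def\<close>)
  then have "runs row_body s (s(3 := ys, 6 := 4 # rev (tuple_tokens (tl l)) @ s 6,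
      10 := [min 3 (c + (if drops_at_head l then 1 else 0))], 11 := s 11)) (100 * N + 200)"
    unfolding row_body_def using s Nil by (intro runs_eq[OF runs_Cond[where t = 5]]) simp_all
  then show ?thesis using s(9) Nil by (intro exI[of _ "s 11"]) simp
next
  case (Cons x l')
  define d where "d = sum_bits (lsb x) (s 11) 1"
  let ?c = "min 3 (c + (if drops_at_head l then 1 else 0))"
  define s1 where "s1 = s(3 := tuple_tokens l' @ 4 # ys, 4 := lsb x)"
  define s2 where "s2 = s1(3 := tuple_tokens (tl l') @ 4 # ys, 6 := rev (tuple_tokens (take 1 l')) @ s 6, 10 := [?c])"
  define s3 where "s3 = s2(4 := [], 11 := d)"
  define s4 where "s4 = s3(3 := 4 # ys, 6 := rev (tuple_tokens (tl l')) @ rev (tuple_tokens (take 1 l')) @ s 6)"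
  define s5 where "s5 = s4(6 := 4 # s4 6)"
  define s6 where "s6 = s5(3 := ys)"
  have len: "length (lsb x) < N" "length (lsb x) + length (tuple_tokens l') < N" "length (tuple_tokens (tl l')) < N"
    "length (lsb x) + length (s 11) < N"
    using N Cons by (cases l'; simp)+
  have l': "tuple_tokens l' = tuple_tokens (take 1 l') @ tuple_tokens (tl l')" by (cases l') auto
  have "runs (get_num 3 4) s s1 (6 * N + 3)"
    by (rule runs_eq[OF runs_get_num]) (use s len Cons in \<open>auto simp: s1_def\<close>)
  moreover have "runs peek s1 s2 (40 * N + 60)"
    by (rule runs_eq[OF runs_peek[where N = N]]) (use s len Cons in \<open>auto simp: s1_def s2_def\<close>)
  moreover have "runs (add_to 11) s2 s3 (16 * N + 30)"
    by (rule runs_eq[OF runs_add_to]) (use s len bit_lsb in \<open>auto simp: s1_def s2_def s3_def d_def\<close>)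
  moreover have "runs (move_while (\<lambda>x. x \<noteq> 0 \<and> x \<noteq> 4) 3 6) s3 s4 (6 * N + 1)"
    by (rule runs_eq[OF runs_move_while[where xs = "tuple_tokens (tl l')" and ys = "4 # ys"]])
      (use len tuple_tokens_range in \<open>auto simp: s2_def s3_def s4_def\<close>)
  moreover have "runs (push 6 (\<lambda>_. 4)) s4 s5 3"
    by (rule runs_eq[OF runs_push]) (simp_all add: s5_def)
  moreover have "runs (Pop 3) s5 s6 1"
    by (rule runs_eq[OF runs_Pop]) (simp_all add: s4_def s5_def s6_def)
  ultimately have "runs (get_num 3 4 ;; peek ;; add_to 11 ;; move_while (\<lambda>x. x \<noteq> 0 \<and> x \<noteq> 4) 3 6 ;;
      push 6 (\<lambda>_. 4) ;; Pop 3) s s6 (100 * N + 150)"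
    by (intro runs_eq[OF runs_Seq[OF _ runs_Seq[OF _ runs_Seq[OF _ runs_Seq[OF _ runs_Seq]]]]]) auto
  moreover have "s6 = s(3 := ys, 6 := 4 # rev (tuple_tokens (tl l)) @ s 6, 10 := [?c], 11 := d)"
    using s Cons l' by (simp add: s1_def s2_def s3_def s4_def s5_def s6_def fun_eq_iff)
  moreover have "top_of (s 3) \<noteq> 4" using s Cons top_num_tokens(2) by simp
  ultimately have "runs row_body s (s(3 := ys, 6 := 4 # rev (tuple_tokens (tl l)) @ s 6, 10 := [?c], 11 := d))
      (100 * N + 200)"
    unfolding row_body_def by (intro runs_eq[OF runs_Cond[where t = "100 * N + 150"]]) simp_all
  moreover have "num d = num (s 11) + x" by (simp add: d_def num_sum_bits)
  moreover have "length d \<le> length (lsb x) + length (s 11) + 1" unfolding d_def by (rule length_sum_bits)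
  ultimately show ?thesis using Cons bits_sum_bits[of "lsb x" "s 11" 1] unfolding d_def[symmetric]
    by (intro exI[of _ d]) simp
qed

definition row_loop :: com where
  "row_loop = While (\<lambda>r. r 3 \<noteq> 0) row_body"

lemma runs_row_loop:
  assumes s: "s 3 = family_tokens ls" "s 4 = []" "s 5 = []" "s 7 = []" "s 8 = []" "s 9 = []"
      "s 10 = [c]" "c \<in> {1, 2, 3}" "bits (s 11)"
    and N: "length (family_tokens ls) + length (s 11) \<le> N"
  shows "\<exists>d. runs row_loop s (s(3 := [], 6 := rev (family_tokens (map tl ls)) @ s 6,
      10 := [min 3 (c + drops ls)], 11 := d)) (length ls * (100 * N + 201) + 1) \<and>
    bits d \<and> num d = num (s 11) + heads ls \<and>
    length d + length (family_tokens (map tl ls)) \<le> length (s 11) + length (family_tokens ls)"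
  using assms
proof (induction ls arbitrary: s c)
  case Nil
  then have eq: "s(3 := [], 6 := rev (family_tokens (map tl [])) @ s 6, 10 := [min 3 (c + drops [])], 11 := s 11) = s"
    by (auto simp: fun_eq_iff drops_def)
  have "runs row_loop s s 1" unfolding row_loop_def using Nil by (intro runs_While_done) simp
  then have "runs row_loop s (s(3 := [], 6 := rev (family_tokens (map tl [])) @ s 6,
      10 := [min 3 (c + drops [])], 11 := s 11)) (length ([] :: nat list list) * (100 * N + 201) + 1)"
    unfolding eq by simp
  moreover have "num (s 11) = num (s 11) + heads []" by (simp add: heads_def)
  moreover have "length (s 11) + length (family_tokens (map tl [])) \<le> length (s 11) + length (family_tokens [])" by simp
  ultimately show ?case using Nil(9) by blast
next
  case (Cons l ls)
  let ?c = "min 3 (c + (if drops_at_head l then 1 else 0))"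
  obtain d where d: "runs row_body s (s(3 := family_tokens ls, 6 := 4 # rev (tuple_tokens (tl l)) @ s 6,
      10 := [?c], 11 := d)) (100 * N + 200)"
    "bits d" "num d = num (s 11) + (case l of [] \<Rightarrow> 0 | x # _ \<Rightarrow> x)"
    "length d + length (tuple_tokens (tl l)) \<le> length (s 11) + length (tuple_tokens l)"
    using runs_row_body[of s l "family_tokens ls" c N] Cons.prems by auto
  define s1 where "s1 = s(3 := family_tokens ls, 6 := 4 # rev (tuple_tokens (tl l)) @ s 6, 10 := [?c], 11 := d)"
  have "\<exists>d'. runs row_loop s1 (s1(3 := [], 6 := rev (family_tokens (map tl ls)) @ s1 6,
      10 := [min 3 (?c + drops ls)], 11 := d')) (length ls * (100 * N + 201) + 1) \<and>
    bits d' \<and> num d' = num (s1 11) + heads ls \<and>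
    length d' + length (family_tokens (map tl ls)) \<le> length (s1 11) + length (family_tokens ls)"
    by (rule Cons.IH) (use Cons.prems d in \<open>auto simp: s1_def min_def\<close>)
  then obtain d' where d': "runs row_loop s1 (s1(3 := [], 6 := rev (family_tokens (map tl ls)) @ s1 6,
      10 := [min 3 (?c + drops ls)], 11 := d')) (length ls * (100 * N + 201) + 1)"
    "bits d'" "num d' = num d + heads ls"
    "length d' + length (family_tokens (map tl ls)) \<le> length d + length (family_tokens ls)"
    by (auto simp: s1_def)
  \<comment> \<open>Capping after every tuple gives the same count as capping once at the
    end.\<close>
  have min_eq: "min 3 (?c + drops ls) = min 3 (c + drops (l # ls))" by (auto simp: drops_def min_def)
  have body: "runs row_body s s1 (100 * N + 200)" using d(1) unfolding s1_def .
  have top: "top_of (s 3) \<noteq> 0" using Cons.prems(1) top_num_tokens(1) by (cases l) auto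
  have R: "runs row_loop s (s1(3 := [], 6 := rev (family_tokens (map tl ls)) @ s1 6,
      10 := [min 3 (?c + drops ls)], 11 := d')) (length (l # ls) * (100 * N + 201) + 1)"
    by (rule runs_eq[OF runs_While_step[OF _ body d'(1)[unfolded row_loop_def], folded row_loop_def] refl])
      (simp_all add: top)
  have eq: "s1(3 := [], 6 := rev (family_tokens (map tl ls)) @ s1 6, 10 := [min 3 (?c + drops ls)], 11 := d') =
    s(3 := [], 6 := rev (family_tokens (map tl (l # ls))) @ s 6, 10 := [min 3 (c + drops (l # ls))], 11 := d')"
    using min_eq by (simp add: s1_def fun_eq_iff)
  note R[unfolded eq]
  moreover have "num d' = num (s 11) + heads (l # ls)" using d(3) d'(3) by (simp add: heads_def)
  moreover have "length d' + length (family_tokens (map tl (l # ls))) \<le> length (s 11) + length (family_tokens (l # ls))"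
    using d(4) d'(4) by simp
  ultimately show ?case using d'(2) by blast
qed

section \<open>The decision program\<close>

text \<open>The bit pairs of the encoding in tape symbols: the first component separates bits from
  delimiters, the second selects within each group.\<close>

definition token_pair :: "nat \<Rightarrow> nat list" where
  "token_pair k = [if k > 2 then 2 else 1, if even k then 2 else 1]"

lemma encode_tokens:
  "map (\<lambda>b. if b then 2 else 1) (encode (ls, w)) = concat (map token_pair (family_tokens (ls @ [w])))"
proof -
  let ?f = "map (\<lambda>b. if b then 2 else (1 :: nat))"
  have "?f (concat (map (\<lambda>b. [False, b]) bs)) = concat (map token_pair (?f bs))" for bs
    by (induction bs) (auto simp: token_pair_def)
  then have "?f (enc_nat n) = concat (map token_pair (num_tokens n))" for n
    by (simp add: enc_nat_def num_tokens_def lsb_def token_pair_def)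
  then have "?f (enc_tuple l) = concat (map token_pair (tuple_tokens l @ [4]))" for l
    by (induction l) (auto simp: enc_tuple_def token_pair_def)
  then have "?f (concat (map enc_tuple ls)) = concat (map token_pair (family_tokens ls))" for ls
    by (induction ls) auto
  from this[of "ls @ [w]"] show ?thesis by simp
qed

lemma length_concat_token_pair: "length (concat (map token_pair ks)) = 2 * length ks"
  by (induction ks) (auto simp: token_pair_def)

text \<open>The first half of a pair waits on stack 7 until the second half is visible.\<close>

definition tokenize :: com where
  "tokenize = While (\<lambda>r. r 0 \<noteq> 0) (push 7 (\<lambda>r. r 0) ;; Pop 0 ;;
     push 1 (\<lambda>r. if r 7 = 1 then r 0 else if r 0 = 1 then 3 else 4) ;; Pop 0 ;; Pop 7)"

lemma runs_tokenize:
  assumes "set ks \<subseteq> {1, 2, 3, 4}" "s 0 = concat (map token_pair ks)" "s 7 = []"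
  shows "runs tokenize s (s(0 := [], 1 := rev ks @ s 1)) (14 * length ks + 1)"
  using assms
proof (induction ks arbitrary: s)
  case Nil
  then have eq: "s(0 := [], 1 := rev [] @ s 1) = s" by (simp add: fun_eq_iff)
  have "runs tokenize s s 1" unfolding tokenize_def using Nil by (intro runs_While_done) simp
  then show ?case unfolding eq by simp
next
  case (Cons k ks)
  let ?s = "s(0 := concat (map token_pair ks), 1 := k # s 1)"
  have k: "k = 1 \<or> k = 2 \<or> k = 3 \<or> k = 4" using Cons.prems(1) by auto
  have B: "runs (push 7 (\<lambda>r. r 0) ;; Pop 0 ;;
      push 1 (\<lambda>r. if r 7 = 1 then r 0 else if r 0 = 1 then 3 else 4) ;; Pop 0 ;; Pop 7) s ?s 13"
    by (rule runs_eq[OF runs_Seq[OF runs_push runs_Seq[OF runs_Pop runs_Seq[OF runs_push runs_Seq[OF runs_Pop runs_Pop]]]]])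
      (use Cons.prems(2,3) k in \<open>auto simp: token_pair_def[of k] fun_eq_iff\<close>)
  have I: "runs tokenize ?s (?s(0 := [], 1 := rev ks @ ?s 1)) (14 * length ks + 1)"
    by (rule Cons.IH) (use Cons.prems in auto)
  have "top_of (s 0) \<noteq> 0" using Cons.prems(2) by (simp add: token_pair_def)
  then show ?case
    by (intro runs_eq[OF runs_While_step[OF _ B I[unfolded tokenize_def], folded tokenize_def]])
      (simp_all add: fun_eq_iff)
qed

text \<open>The input does not announce the number of partitions. In the reversed token string
  \<omega> comes on top, and all that remains from the next semicolon on is the family.\<close>

definition split_input :: com where
  "split_input = (Pop 1 ;; move_while (\<lambda>x. x \<noteq> 0 \<and> x \<noteq> 4) 1 2 ;; move_while (\<lambda>x. x \<noteq> 0) 1 3)"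

lemma runs_split_input:
  assumes "s 1 = rev (family_tokens (ls @ [w]))" "s 2 = []" "s 3 = []"
    and N: "length (family_tokens ls) + length (tuple_tokens w) \<le> N"
  shows "runs split_input s (s(1 := [], 2 := tuple_tokens w, 3 := family_tokens ls)) (6 * N + 5)"
proof -
  have eq: "rev (family_tokens (ls @ [w])) = 4 # rev (tuple_tokens w) @ rev (family_tokens ls)"
    by (simp add: family_tokens_def)
  have top: "top_of (rev (family_tokens ls)) = 0 \<or> top_of (rev (family_tokens ls)) = 4"
    by (cases ls rule: rev_cases) (simp_all add: family_tokens_def)
  define s1 where "s1 = s(1 := rev (tuple_tokens w) @ rev (family_tokens ls))"
  define s2 where "s2 = s1(1 := rev (family_tokens ls), 2 := tuple_tokens w)"
  have "runs (Pop 1) s s1 1"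
    by (rule runs_eq[OF runs_Pop]) (use assms eq in \<open>simp_all add: s1_def\<close>)
  moreover have "runs (move_while (\<lambda>x. x \<noteq> 0 \<and> x \<noteq> 4) 1 2) s1 s2 (6 * length (tuple_tokens w) + 1)"
    by (rule runs_eq[OF runs_move_while[where xs = "rev (tuple_tokens w)" and ys = "rev (family_tokens ls)"]])
      (use assms tuple_tokens_range top in \<open>auto simp: s1_def s2_def\<close>)
  moreover have "runs (move_while (\<lambda>x. x \<noteq> 0) 1 3) s2 (s2(1 := [], 3 := family_tokens ls))
      (6 * length (family_tokens ls) + 1)"
    by (rule runs_eq[OF runs_move_while[where xs = "rev (family_tokens ls)" and ys = "[]"]])
      (use assms family_tokens_range in \<open>auto simp: s1_def s2_def\<close>)
  moreover have "s2(1 := [], 3 := family_tokens ls) = s(1 := [], 2 := tuple_tokens w, 3 := family_tokens ls)"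
    by (simp add: s1_def s2_def fun_eq_iff)
  ultimately show ?thesis unfolding split_input_def using N
    by (intro runs_eq[OF runs_Seq[OF _ runs_Seq]]) auto
qed

text \<open>Only the outcome of the comparison is available, so the pair 1, 0 stands for any
  \<open>d > e\<close>. The capped counter minus one suffices because \<open>transition\<close>
  distinguishes only 0, 1 and larger counts.\<close>

definition next_state :: "(nat \<Rightarrow> nat) \<Rightarrow> nat" where
  "next_state r = (if r 13 = 6 \<or> r 9 = 2 then 6 else if r 13 = 5 then 5 else if r 9 = 1 then 1
     else transition (r 13) (r 10 - 1) 1 0)"

lemma next_state:
  "r 9 = flag d e 1 \<Longrightarrow> r 10 = min 3 (1 + c) \<Longrightarrow> next_state r = transition (r 13) c d e"
  by (auto simp: next_state_def transition_def flag_def min_def)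

lemma next_state_less: "next_state r < 7"
  by (auto simp: next_state_def transition_def)

section \<open>The main loop\<close>

definition main_body :: com where
  "main_body = (select ;; add_to 12 ;; row_loop ;; move_while (\<lambda>x. x \<noteq> 0) 6 3 ;; compare 11 12 ;;
     Write 13 next_state ;; Pop 9 ;; Write 10 (\<lambda>_. 1))"

text \<open>The last line holds two space budgets: the partitions with the sum on stack 11, and the
  letters with the sum on stack 12. Both stay below the same \<open>N\<close>, so all passes obey
  one time bound.\<close>

definition main_inv :: "nat list list \<Rightarrow> nat list \<Rightarrow> nat \<Rightarrow> nat \<Rightarrow> nat \<Rightarrow> nat \<Rightarrow> store \<Rightarrow> bool" where
  "main_inv ls w d e q N s \<longleftrightarrow> s 2 = tuple_tokens w \<and> s 3 = family_tokens ls \<and>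
     s 4 = [] \<and> s 5 = [] \<and> s 6 = [] \<and> s 7 = [] \<and> s 8 = [] \<and> s 9 = [] \<and> s 10 = [1] \<and>
     bits (s 11) \<and> bits (s 12) \<and> num (s 11) = d \<and> num (s 12) = e \<and> s 13 = [q] \<and>
     length (family_tokens ls) + length (s 11) \<le> N \<and> length (tuple_tokens w) + length (s 12) \<le> N"

lemma length_le_family_tokens: "length ls \<le> length (family_tokens ls)"
  by (induction ls) auto

lemma runs_main_body:
  assumes inv: "main_inv ls (x # xs) d e q N s" and b: "bubble x xs [] = (k, rest)"
  shows "\<exists>s'. runs main_body s s' (140 * N * N + 400 * N + 120) \<and>
    main_inv (map tl ls) rest (d + heads ls) (e + k) (transition q (drops ls) (d + heads ls) (e + k)) N s'"
proof -
  note I = inv[unfolded main_inv_def]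
  define E where "E = sum_bits (lsb k) (s 12) 1"
  have "num E = e + k" using I by (simp add: E_def num_sum_bits)
  then have E: "bits E" "num E = e + k" "length E \<le> length (lsb k) + length (s 12) + 1"
    using bits_sum_bits length_sum_bits unfolding E_def by blast+
  have len: "Suc (length (lsb k) + length (tuple_tokens rest)) + length (s 12) \<le> N"
    using I length_tuple_tokens_mset[OF bubble_mset[OF b]] by simp
  define s1 where "s1 = s(2 := tuple_tokens rest, 4 := lsb k)"
  define s2 where "s2 = s1(4 := [], 12 := E)"
  have r1: "runs select s s1 (N * (40 * N + 100) + 20)"
    by (rule runs_eq[OF runs_select[OF b, where N = N]]) (use I in \<open>auto simp: s1_def\<close>)
  have r2: "runs (add_to 12) s1 s2 (16 * N + 30)"
    by (rule runs_eq[OF runs_add_to]) (use I len bit_lsb in \<open>auto simp: s1_def s2_def E_def\<close>)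
  obtain D where D: "runs row_loop s2 (s2(3 := [], 6 := rev (family_tokens (map tl ls)) @ s2 6,
      10 := [min 3 (1 + drops ls)], 11 := D)) (length ls * (100 * N + 201) + 1)"
    "bits D" "num D = num (s2 11) + heads ls"
    "length D + length (family_tokens (map tl ls)) \<le> length (s2 11) + length (family_tokens ls)"
    using runs_row_loop[of s2 ls 1 N] I by (auto simp: s1_def s2_def)
  define s3 where "s3 = s2(3 := [], 6 := rev (family_tokens (map tl ls)), 10 := [min 3 (1 + drops ls)], 11 := D)"
  define s4 where "s4 = s3(6 := [], 3 := family_tokens (map tl ls))"
  define s5 where "s5 = s4(9 := [flag (d + heads ls) (e + k) 1])"
  define s6 where "s6 = s5(13 := [transition q (drops ls) (d + heads ls) (e + k)])"
  define s7 where "s7 = s6(9 := [])"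
  define s8 where "s8 = s7(10 := [1])"
  have numD: "num D = d + heads ls" using D(3) I by (simp add: s1_def s2_def)
  have lenD: "length D + length (family_tokens (map tl ls)) \<le> N" using D(4) I by (simp add: s1_def s2_def)
  have "length ls \<le> N" using length_le_family_tokens[of ls] I by linarith
  then have "length ls * (100 * N + 201) + 1 \<le> N * (100 * N + 201) + 1" by simp
  then have r3: "runs row_loop s2 s3 (N * (100 * N + 201) + 1)"
    by (intro runs_eq[OF D(1)]) (use I in \<open>simp_all add: s1_def s2_def s3_def\<close>)
  have r4: "runs (move_while (\<lambda>x. x \<noteq> 0) 6 3) s3 s4 (6 * N + 1)"
    by (rule runs_eq[OF runs_move_while[where xs = "rev (family_tokens (map tl ls))" and ys = "[]"]])
      (use lenD family_tokens_range in \<open>auto simp: s3_def s4_def\<close>)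
  have r5: "runs (compare 11 12) s4 s5 (44 * N + 20)"
    by (rule runs_eq[OF runs_compare])
      (use I D(2) E numD lenD len in \<open>auto simp: s1_def s2_def s3_def s4_def s5_def\<close>)
  have r6: "runs (Write 13 next_state) s5 s6 1"
    by (rule runs_eq[OF runs_Write])
      (use I next_state[of "tops s5" "d + heads ls" "e + k" "drops ls"] in
        \<open>simp_all add: s1_def s2_def s3_def s4_def s5_def s6_def\<close>)
  have r7: "runs (Pop 9) s6 s7 1"
    by (rule runs_eq[OF runs_Pop]) (simp_all add: s5_def s6_def s7_def)
  have r8: "runs (Write 10 (\<lambda>_. 1)) s7 s8 1"
    by (rule runs_eq[OF runs_Write]) (simp_all add: s3_def s4_def s5_def s6_def s7_def s8_def)
  \<comment> \<open>Of the quadratic coefficient, 40 comes from the selection and 100 from the row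
    loop; the other coefficients are rounded up.\<close>
  have "runs main_body s s8 (140 * N * N + 400 * N + 120)"
    unfolding main_body_def
    by (rule runs_eq[OF runs_Seq[OF r1 runs_Seq[OF r2 runs_Seq[OF r3 runs_Seq[OF r4 runs_Seq[OF r5
      runs_Seq[OF r6 runs_Seq[OF r7 r8]]]]]]] refl]) (simp add: algebra_simps)
  moreover have "main_inv (map tl ls) rest (d + heads ls) (e + k)
      (transition q (drops ls) (d + heads ls) (e + k)) N s8"
    unfolding main_inv_def using I D(2) numD E lenD len
    by (simp add: s1_def s2_def s3_def s4_def s5_def s6_def s7_def s8_def)
  ultimately show ?thesis by blast
qed

lemma sort_Cons_max:
  assumes "mset (k # rest) = mset w" "\<forall>x\<in>set rest. x \<le> k"
  shows "rev (sort w) = k # rev (sort rest)"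
proof -
  have "sort w = sort rest @ [k]"
    using assms by (intro properties_for_sort) (auto simp: sorted_append)
  then show ?thesis by simp
qed

definition main_loop :: com where
  "main_loop = While (\<lambda>r. r 2 \<noteq> 0) main_body"

text \<open>Successive selections deliver the letters in decreasing order, so the loop performs
  \<open>scan\<close> on the sorted list, one extraction per pass.\<close>

lemma runs_main_loop:
  "main_inv ls w d e q N s \<Longrightarrow> \<exists>s'. runs main_loop s s' (length w * (140 * N * N + 400 * N + 121) + 1) \<and>
    s' 13 = [scan ls (rev (sort w)) d e q]"
proof (induction "length w" arbitrary: ls w d e q s)
  case 0
  then have w: "w = []" by simp
  have "runs main_loop s s 1"
    unfolding main_loop_def using 0 w by (intro runs_While_done) (simp add: main_inv_def)
  then show ?case using 0 w by (intro exI[of _ s]) (simp add: main_inv_def)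
next
  case (Suc n)
  then obtain x xs where w: "w = x # xs" by (cases w) auto
  obtain k rest where b: "bubble x xs [] = (k, rest)" by force
  obtain s1 where s1: "runs main_body s s1 (140 * N * N + 400 * N + 120)"
    "main_inv (map tl ls) rest (d + heads ls) (e + k) (transition q (drops ls) (d + heads ls) (e + k)) N s1"
    using runs_main_body[OF Suc.prems[unfolded w] b] by blast
  have m: "mset (k # rest) = mset w" using bubble_mset[OF b] w by simp
  have len: "length w = Suc (length rest)" using mset_eq_length[OF m] by simp
  obtain s' where s': "runs main_loop s1 s' (length rest * (140 * N * N + 400 * N + 121) + 1)"
    "s' 13 = [scan (map tl ls) (rev (sort rest)) (d + heads ls) (e + k)
      (transition q (drops ls) (d + heads ls) (e + k))]"
    using Suc.hyps(1)[OF _ s1(2)] Suc.hyps(2) len by auto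
  have "top_of (s 2) \<noteq> 0" using Suc.prems w top_num_tokens(1) by (simp add: main_inv_def)
  then have "runs main_loop s s' (length w * (140 * N * N + 400 * N + 121) + 1)"
    unfolding main_loop_def len
    by (intro runs_eq[OF runs_While_step[OF _ s1(1) s'(1)[unfolded main_loop_def]] refl]) simp_all
  moreover have "rev (sort w) = k # rev (sort rest)"
    using sort_Cons_max[OF m] bubble_max[OF b] by simp
  ultimately show ?case using s'(2) by auto
qed

definition program :: com where
  "program = (tokenize ;; split_input ;; push 10 (\<lambda>_. 1) ;; push 13 (\<lambda>_. 1) ;; main_loop)"

lemma runs_program:
  fixes ls w
  defines "N \<equiv> length (encode (ls, w))"
  shows "\<exists>s. runs program (input_store (encode (ls, w))) s (140 * N * N * N + 400 * N * N + 200 * N + 50) \<and>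
    s 13 = [scan ls (rev (sort w)) 0 0 1]"
proof -
  let ?T = "family_tokens (ls @ [w])"
  define s0 where "s0 = input_store (encode (ls, w))"
  have N: "N = 2 * length ?T"
    using arg_cong[OF encode_tokens[of ls w], of length] by (simp only: length_concat_token_pair length_map N_def)
  have T: "?T = family_tokens ls @ tuple_tokens w @ [4]" by (simp add: family_tokens_def)
  have rng: "set ?T \<subseteq> {1, 2, 3, 4}"
  proof -
    have "set (tuple_tokens l) \<subseteq> {1, 2, 3}" for l
      by (induction l) (auto simp: num_tokens_def dest: bit_lsb)
    then have "set (family_tokens ls) \<subseteq> {1, 2, 3, 4}" for ls by (induction ls) fastforce+
    then show ?thesis .
  qed
  define s1 where "s1 = s0(0 := [], 1 := rev ?T)"
  define s2 where "s2 = s1(1 := [], 2 := tuple_tokens w, 3 := family_tokens ls)"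
  define s3 where "s3 = s2(10 := [1])"
  define s4 where "s4 = s3(13 := [1])"
  have r1: "runs tokenize s0 s1 (14 * N + 1)"
    by (rule runs_eq[OF runs_tokenize[OF rng]])
      (use N in \<open>simp_all add: s0_def s1_def input_store_def encode_tokens del: encode.simps\<close>)
  have r2: "runs split_input s1 s2 (6 * N + 5)"
    by (rule runs_eq[OF runs_split_input[where N = N and ls = ls and w = w]])
      (use N T in \<open>simp_all add: s0_def s1_def s2_def input_store_def\<close>)
  have r3: "runs (push 10 (\<lambda>_. 1)) s2 s3 3"
    by (rule runs_eq[OF runs_push]) (simp_all add: s0_def s1_def s2_def s3_def input_store_def)
  have r4: "runs (push 13 (\<lambda>_. 1)) s3 s4 3"
    by (rule runs_eq[OF runs_push]) (simp_all add: s0_def s1_def s2_def s3_def s4_def input_store_def)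
  have inv: "main_inv ls w 0 0 1 N s4"
    using N T by (simp add: main_inv_def s0_def s1_def s2_def s3_def s4_def input_store_def)
  obtain s5 where s5: "runs main_loop s4 s5 (length w * (140 * N * N + 400 * N + 121) + 1)"
    "s5 13 = [scan ls (rev (sort w)) 0 0 1]"
    using runs_main_loop[OF inv] by blast
  have "length w \<le> N" using N T length_le_tuple_tokens[of w] by simp
  then have "length w * (140 * N * N + 400 * N + 121) + 1 \<le> N * (140 * N * N + 400 * N + 121) + 1" by simp
  then have r5: "runs main_loop s4 s5 (N * (140 * N * N + 400 * N + 121) + 1)" by (rule runs_mono[OF s5(1)])
  have "runs program s0 s5 (140 * N * N * N + 400 * N * N + 200 * N + 50)"
    unfolding program_def
    by (rule runs_eq[OF runs_Seq[OF r1 runs_Seq[OF r2 runs_Seq[OF r3 runs_Seq[OF r4 r5]]]] refl])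
      (simp add: algebra_simps)
  then show ?thesis using s5(2) unfolding s0_def by blast
qed

text \<open>There are fourteen stacks, 0 to 13. Symbols up to 6 occur because stack 13 stores the
  state of the automaton.\<close>

lemma bounded_program: "bounded 14 7 program"
proof -
  note defs = push_def skip_def move_while_def clear_def save_def compare_def compare_loop_def compare_body_def
    add_to_def add_loop_def get_num_def put_num_def select_body_def select_loop_def select_def mark_def copy_def
    peek_def row_body_def row_loop_def tokenize_def split_input_def main_body_def main_loop_def
  show ?thesis unfolding program_def
    by (simp add: defs next_state_less cmp_step_def sum_bit_def carry_bit_def)
qed

theorem corollary5p1:
  shows "polytime_decidable encode instances (\<lambda>(ls, w). kostka ls w > 0) \<and>
         polytime_decidable encode instances (\<lambda>(ls, w). kostka ls w = 1)"
proof -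
  \<comment> \<open>One program serves both questions; only the predicate \<open>fin\<close> on the
    final state of the automaton differs.\<close>
  have dec: "polytime_decidable encode instances (\<lambda>(ls, w). P (kostka ls w))"
    if P: "\<And>r n ls w. multipartition r n ls \<Longrightarrow> composition_of n w \<Longrightarrow>
        P (kostka ls w) \<longleftrightarrow> fin (scan ls (rev (sort w)) 0 0 1)" for P fin
  proof (rule polytime_decidable_if_program[OF bounded_program, where p = "[:50, 200, 400, 140:]" and
        fin = "\<lambda>r. fin (r 13)"])
    fix x assume "x \<in> instances"
    then obtain ls w r n where x: "x = (ls, w)" "multipartition r n ls" "composition_of n w"
      by (auto simp: instances_def)
    let ?N = "length (encode x)"
    obtain s where s: "runs program (input_store (encode x)) s (140 * ?N * ?N * ?N + 400 * ?N * ?N + 200 * ?N + 50)"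
      "s 13 = [scan ls (rev (sort w)) 0 0 1]"
      using runs_program[of ls w] x(1) by blast
    obtain t where t: "t \<le> 140 * ?N * ?N * ?N + 400 * ?N * ?N + 200 * ?N + 50"
      "(kstep ^^ t) ([program], input_store (encode x)) = ([], s)"
      using s(1) unfolding runs_def by blast
    have "t \<le> poly [:50, 200, 400, 140:] ?N" using t(1) by (simp add: algebra_simps)
    moreover have "fin (tops s 13) = (case x of (ls, w) \<Rightarrow> P (kostka ls w))"
      using P[OF x(2,3)] s(2) x(1) by simp
    ultimately show "\<exists>t s. t \<le> poly [:50, 200, 400, 140:] ?N \<and>
        (kstep ^^ t) ([program], input_store (encode x)) = ([], s) \<and>
        fin (tops s 13) = (case x of (ls, w) \<Rightarrow> P (kostka ls w))"
      using t(2) by blast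
  qed simp_all
  show ?thesis
    using dec[of "\<lambda>k. k > 0" "\<lambda>q. q \<noteq> 6"] dec[of "\<lambda>k. k = 1" "\<lambda>q. q \<noteq> 5 \<and> q \<noteq> 6"] kostka_scan by blast
qed

end
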